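(* Let $n\ge 1$ and let $K$ be a compact $n$-dimensional submanifold (with boundary) embedded in $\mathbb{R}^n$, with rectifiable boundary $\Sigma=\partial K$. Then the surface area of $K$ is given by $$\mathcal{V}_{n-1}(\Sigma)=\frac{1}{\omega_{n-1}}\int_{u\in \mathbb{S}^{n-1}} \mathcal{V}_{n-1}(\Sigma\,|\,u^\perp)\, dS_u .$$
   Context: Here $\mathcal{V}_{n-1}(\Sigma)=\int_{\Sigma}d\Sigma_q$ is the $(n-1)$-dimensional volume (surface area) of $\Sigma$, where $d\Sigma_q$ is the area element of $\Sigma$ at $q$; $\omega_{n-1}$ is the $(n-1)$-dimensional volume of the unit ball in $\mathbb{R}^{n-1}$; $\mathbb{S}^{n-1}$ is the unit sphere of $\mathbb{R}^n$ and $dS_u$ its area element at $u$. The boundary $\Sigma$ has an outward unit normal $\tilde n(q)$ at almost every $q\in\Sigma$ (with respect to $d\Sigma_q$). For $u\in\mathbb{S}^{n-1}$, $u^\perp$ is the linear hyperplane orthogonal to $u$, and $\mathcal{V}_{n-1}(\Sigma\,|\,u^\perp)$ is the weighted projected area of $\Sigma$ along $u$ onto $u^\perp$, defined by $$\mathcal{V}_{n-1}(\Sigma\,|\,u^\perp)=\frac12\int_{q\in\Sigma}|u\cdot\tilde n(q)|\,d\Sigma_q .$$ (No convexity of $K$ is assumed.) *)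

theory Defs
  imports "HOL-Analysis.Analysis"
begin

(* Standard normalisation omega_m (diam U / 2)^m. The empty set is treated separately because
   0 ^ 0 = 1, which is the right value for one-point sets when m = 0. *)
definition hausdorff_gauge :: "nat \<Rightarrow> 'a::metric_space set \<Rightarrow> ennreal" where
  "hausdorff_gauge m U =
     (if U = {} then 0 else ennreal (unit_ball_vol (real m) * (diameter U / 2) ^ m))"

(* Boundedness is required because diameter is unspecified on unbounded sets. *)
definition hausdorff_pre :: "nat \<Rightarrow> real \<Rightarrow> 'a::metric_space set \<Rightarrow> ennreal" where
  "hausdorff_pre m \<delta> A =
     (INF U \<in> {U :: nat \<Rightarrow> 'a set. A \<subseteq> (\<Union>i. U i) \<and> (\<forall>i. bounded (U i) \<and> diameter (U i) \<le> \<delta>)}.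
        \<Sum>i. hausdorff_gauge m (U i))"

definition hausdorff_outer :: "nat \<Rightarrow> 'a::metric_space set \<Rightarrow> ennreal" where
  "hausdorff_outer m A = (SUP \<delta> \<in> {0<..}. hausdorff_pre m \<delta> A)"

(* By Caratheodory's criterion the outer measure is countably additive on Borel sets, so
   measure_of yields it there and not the null measure. *)
definition hausdorff_measure :: "nat \<Rightarrow> 'a::metric_space measure" where
  "hausdorff_measure m = measure_of UNIV (sets borel) (hausdorff_outer m)"

(* The area element of a hypersurface, used both for boundaries and for the unit sphere;
   in dimension one it is counting measure. *)
definition surface_measure :: "'a::euclidean_space set \<Rightarrow> 'a measure" where
  "surface_measure S = restrict_space (hausdorff_measure (DIM('a) - 1)) S"

(* Countably (H^m, m)-rectifiable: H^m-almost all of S is covered by countably many Lipschitz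
   images of an m-dimensional Euclidean space, realised as a linear subspace V.
   Finiteness of the measure of S is not imposed. *)
definition rectifiable :: "nat \<Rightarrow> 'a::euclidean_space set \<Rightarrow> bool" where
  "rectifiable m S \<longleftrightarrow>
     (\<exists>V (f :: nat \<Rightarrow> 'a \<Rightarrow> 'a). subspace V \<and> dim V = m \<and>
        (\<forall>i. \<exists>L. L-lipschitz_on V (f i)) \<and>
        hausdorff_outer m (S - (\<Union>i. f i ` V)) = 0)"

(* Topological manifold with boundary, of the dimension of the ambient space, in the subspace
   topology: every point has a neighbourhood in K homeomorphic to a relatively open subset of a
   closed half space. *)
definition submanifold_with_boundary :: "'a::euclidean_space set \<Rightarrow> bool" where
  "submanifold_with_boundary K \<longleftrightarrow>
     (\<forall>x\<in>K. \<exists>U V. \<exists>b\<in>Basis. openin (top_of_set K) U \<and> x \<in> U \<and>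
        openin (top_of_set {y::'a. 0 \<le> y \<bullet> b}) V \<and> U homeomorphic V)"

(* For closed K this is the topological frontier, by invariance of domain. *)
definition manifold_boundary :: "'a::euclidean_space set \<Rightarrow> 'a set" where
  "manifold_boundary K =
     {x \<in> K. \<not> (\<exists>U (V :: 'a set). openin (top_of_set K) U \<and> x \<in> U \<and> open V \<and> U homeomorphic V)}"

(* Federer's exterior normal: at q, the set K has density 0 on the outer side of the hyperplane
   orthogonal to v and its complement has density 0 on the inner side. At smooth boundary points
   this is the classical outward unit normal; there is at most one such v. *)
definition is_outward_unit_normal :: "'a::euclidean_space set \<Rightarrow> 'a \<Rightarrow> 'a \<Rightarrow> bool" where
  "is_outward_unit_normal K q v \<longleftrightarrow> norm v = 1 \<and>
     ((\<lambda>r. measure lebesgue ({x \<in> ball q r. (x - q) \<bullet> v > 0} \<inter> K) / r ^ DIM('a)) \<longlongrightarrow> 0) (at_right 0) \<and>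
     ((\<lambda>r. measure lebesgue ({x \<in> ball q r. (x - q) \<bullet> v < 0} - K) / r ^ DIM('a)) \<longlongrightarrow> 0) (at_right 0)"

definition outward_unit_normal :: "'a::euclidean_space set \<Rightarrow> 'a \<Rightarrow> 'a" where
  "outward_unit_normal K q = (THE v. is_outward_unit_normal K q v)"

definition weighted_projected_area :: "'a::euclidean_space set \<Rightarrow> 'a \<Rightarrow> ennreal" where
  "weighted_projected_area K u =
     ennreal (1 / 2) *
     (\<integral>\<^sup>+ q. ennreal \<bar>u \<bullet> outward_unit_normal K q\<bar> \<partial>surface_measure (manifold_boundary K))"

end

theory Submission
  imports Defs
begin

text \<open>
  By Tonelli's theorem the right-hand side is the integral over the boundary of
  \<open>(1/2) \<integral> \<bar>u \<bullet> n\<bar> dS(u) / \<omega>\<close>, where \<open>n\<close> is the outward normal, \<open>\<omega>\<close> the volume of the unit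
  ball one dimension lower and \<open>u\<close> ranges over the unit sphere. The formula therefore says that
  \<open>\<integral> \<bar>u \<bullet> v\<bar> dS(u) = 2 \<omega>\<close> for each unit vector \<open>v\<close> (\<open>nn_integral_sphere_abs_inner\<close>): the sphere
  covers its shadow, a unit ball of a hyperplane, twice. Both areas being Hausdorff measures, three
  points have to be settled.

  The Hausdorff outer measure must be countably additive on Borel sets; this is Caratheodory's criterion
  (\<open>hausdorff_outer_caratheodory_closed\<close>). Its restriction to a rectifiable set is then sigma-finite,
  because Lipschitz images of bounded pieces of a hyperplane have finite measure
  (\<open>sigma_finite_surface_measure\<close>), and Tonelli's theorem applies.

  The area of the sphere must come out with the right constant. A flat disc of radius \<open>r\<close> in a
  hyperplane has Hausdorff measure exactly \<open>\<omega> r^(n-1)\<close> (\<open>hausdorff_outer_disc\<close>): no cover is cheaper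
  by the isodiametric inequality, which is deduced from the Prekopa-Leindler inequality, and arbitrarily
  fine covers of that cost exist by the Vitali covering theorem. A small spherical cap differs from a flat
  disc by a map of Lipschitz constant close to one. The rest is done by averaging over the solid ball
  rather than by an area formula for curved surfaces. If \<open>k u w\<close>
  is invariant under all reflections, then its integral over \<open>w\<close> in space is the same for all unit
  vectors \<open>u\<close>, and its integral over \<open>u\<close> in the sphere depends on \<open>norm w\<close> only; exchanging the
  integrals relates the two (\<open>sphere_ball_average\<close>). With \<open>k\<close> the indicator of a small angle this
  gives the area of the sphere (\<open>emeasure_sphere\<close>), with \<open>k u w = \<bar>w \<bullet> u\<bar>\<close> on the unit ball it gives
  the integral wanted.

  The outward normal is only determined pointwise, by densities, and must be shown to depend measurably
  on the point. Blowing up \<open>K\<close> at a point with normal \<open>v\<close> yields the half ball opposite to \<open>v\<close>, so \<open>v\<close> is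
  the negative direction of the limit of the first moments of the blown-up sets, and first moments are
  measurable functions of the point (\<open>outward_unit_normal_eq_limit_normal\<close>).
\<close>

section \<open>Hausdorff measure is a Borel measure\<close>

lemma hausdorff_gauge_empty [simp]: "hausdorff_gauge m {} = 0"
  by (simp add: hausdorff_gauge_def)

lemma hausdorff_pre_le:
  assumes "A \<subseteq> (\<Union>i. U i)" "\<And>i::nat. bounded (U i)" "\<And>i. diameter (U i) \<le> \<delta>"
  shows "hausdorff_pre m \<delta> A \<le> (\<Sum>i. hausdorff_gauge m (U i))"
  unfolding hausdorff_pre_def using assms by (intro INF_lower) auto

lemma hausdorff_pre_greatest:
  assumes "\<And>U :: nat \<Rightarrow> 'a::metric_space set. A \<subseteq> (\<Union>i. U i) \<Longrightarrow> (\<And>i. bounded (U i)) \<Longrightarrow>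
      (\<And>i. diameter (U i) \<le> \<delta>) \<Longrightarrow> c \<le> (\<Sum>i. hausdorff_gauge m (U i))"
  shows "c \<le> hausdorff_pre m \<delta> A"
  unfolding hausdorff_pre_def using assms by (intro INF_greatest) auto

lemma hausdorff_pre_mono: "A \<subseteq> B \<Longrightarrow> hausdorff_pre m \<delta> A \<le> hausdorff_pre m \<delta> B"
  by (rule hausdorff_pre_greatest) (rule hausdorff_pre_le, auto)

lemma hausdorff_pre_antimono: "\<delta> \<le> \<epsilon> \<Longrightarrow> hausdorff_pre m \<epsilon> A \<le> hausdorff_pre m \<delta> A"
  by (rule hausdorff_pre_greatest) (rule hausdorff_pre_le, auto intro: order_trans)

lemma hausdorff_pre_empty [simp]: "0 \<le> \<delta> \<Longrightarrow> hausdorff_pre m \<delta> {} = 0"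
  using hausdorff_pre_le[of "{}" "\<lambda>_. {}" \<delta> m] by simp

text \<open>Near-optimal covers of the \<open>A i\<close>, with errors summing to an arbitrary \<open>e\<close>, are merged into one
  sequence by enumerating the pairs of indices.\<close>

lemma hausdorff_pre_countable_subadditive:
  fixes A :: "nat \<Rightarrow> 'a::metric_space set"
  shows "hausdorff_pre m \<delta> (\<Union>i. A i) \<le> (\<Sum>i. hausdorff_pre m \<delta> (A i))"
proof (cases "(\<Sum>i. hausdorff_pre m \<delta> (A i)) = \<infinity>")
  case False
  have fin: "hausdorff_pre m \<delta> (A i) < \<infinity>" for i
  proof -
    have "hausdorff_pre m \<delta> (A i) \<le> (\<Sum>i. hausdorff_pre m \<delta> (A i))"
      using sum_le_suminf[of "\<lambda>i. hausdorff_pre m \<delta> (A i)" "{i}"] by simp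
    then show ?thesis using False by (simp add: less_top[symmetric] top_unique) (metis top_unique)
  qed
  show ?thesis
  proof (rule ennreal_le_epsilon)
    fix e :: real assume e: "0 < e"
    define d where "d i = e * (1/2)^Suc i" for i
    have d: "0 < d i" for i using e by (simp add: d_def)
    have "\<exists>U :: nat \<Rightarrow> 'a set. A i \<subseteq> (\<Union>j. U j) \<and> (\<forall>j. bounded (U j) \<and> diameter (U j) \<le> \<delta>) \<and>
        (\<Sum>j. hausdorff_gauge m (U j)) \<le> hausdorff_pre m \<delta> (A i) + d i" for i
    proof -
      have "hausdorff_pre m \<delta> (A i) < hausdorff_pre m \<delta> (A i) + d i"
        using fin[of i] d[of i] by (simp add: ennreal_add_left_cancel_less[of _ 0, simplified] less_top[symmetric])
      then obtain U :: "nat \<Rightarrow> 'a set" where "U \<in> {U. A i \<subseteq> (\<Union>i. U i) \<and> (\<forall>i. bounded (U i) \<and> diameter (U i) \<le> \<delta>)}"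
        "(\<Sum>i. hausdorff_gauge m (U i)) < hausdorff_pre m \<delta> (A i) + d i"
        unfolding hausdorff_pre_def[of m \<delta> "A i"] INF_less_iff by blast
      then show ?thesis by (auto intro: less_imp_le)
    qed
    then obtain U :: "nat \<Rightarrow> nat \<Rightarrow> 'a set" where U: "\<And>i. A i \<subseteq> (\<Union>j. U i j)"
      "\<And>i j. bounded (U i j)" "\<And>i j. diameter (U i j) \<le> \<delta>"
      "\<And>i. (\<Sum>j. hausdorff_gauge m (U i j)) \<le> hausdorff_pre m \<delta> (A i) + d i"
      by metis
    define W where "W k = (case prod_decode k of (i, j) \<Rightarrow> U i j)" for k
    have "(\<Union>i. A i) \<subseteq> (\<Union>k. W k)"
    proof
      fix x assume "x \<in> (\<Union>i. A i)"
      then obtain i j where "x \<in> U i j" using U(1) by blast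
      then have "x \<in> W (prod_encode (i, j))" by (simp add: W_def)
      then show "x \<in> (\<Union>k. W k)" by blast
    qed
    then have "hausdorff_pre m \<delta> (\<Union>i. A i) \<le> (\<Sum>k. hausdorff_gauge m (W k))"
      by (rule hausdorff_pre_le) (auto simp: W_def U split: prod.splits)
    also have "\<dots> = (\<Sum>k. (\<lambda>(i, j). hausdorff_gauge m (U i j)) (prod_decode k))"
      by (intro suminf_cong) (simp add: W_def split: prod.splits)
    also have "\<dots> = (\<Sum>i. \<Sum>j. hausdorff_gauge m (U i j))"
      by (rule suminf_ennreal_2dimen) simp
    also have "\<dots> \<le> (\<Sum>i. hausdorff_pre m \<delta> (A i) + d i)"
      by (intro suminf_le U(4)) auto
    also have "\<dots> = (\<Sum>i. hausdorff_pre m \<delta> (A i)) + (\<Sum>i. ennreal (d i))"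
      by (intro suminf_add[symmetric]) auto
    also have "(\<Sum>i. ennreal (d i)) = ennreal e"
    proof (rule suminf_ennreal_eq)
      show "d sums e" unfolding d_def
        using sums_mult[OF power_half_series, of e] by simp
    qed (use d in \<open>auto intro: less_imp_le\<close>)
    finally show "hausdorff_pre m \<delta> (\<Union>i. A i) \<le> (\<Sum>i. hausdorff_pre m \<delta> (A i)) + ennreal e" .
  qed
qed simp

lemma hausdorff_pre_le_outer: "0 < \<delta> \<Longrightarrow> hausdorff_pre m \<delta> A \<le> hausdorff_outer m A"
  unfolding hausdorff_outer_def by (rule SUP_upper) auto

lemma hausdorff_outer_le:
  "(\<And>\<delta>. 0 < \<delta> \<Longrightarrow> hausdorff_pre m \<delta> A \<le> c) \<Longrightarrow> hausdorff_outer m A \<le> c"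
  unfolding hausdorff_outer_def by (rule SUP_least) auto

lemma hausdorff_outer_mono: "A \<subseteq> B \<Longrightarrow> hausdorff_outer m A \<le> hausdorff_outer m B"
  by (rule hausdorff_outer_le) (meson hausdorff_pre_le_outer hausdorff_pre_mono order_trans)

lemma hausdorff_outer_empty [simp]: "hausdorff_outer m {} = 0"
  using hausdorff_outer_le[of m "{}" 0] by simp

lemma hausdorff_outer_countable_subadditive:
  fixes A :: "nat \<Rightarrow> 'a::metric_space set"
  shows "hausdorff_outer m (\<Union>i. A i) \<le> (\<Sum>i. hausdorff_outer m (A i))"
proof (rule hausdorff_outer_le)
  fix \<delta> :: real assume "0 < \<delta>"
  then have "(\<Sum>i. hausdorff_pre m \<delta> (A i)) \<le> (\<Sum>i. hausdorff_outer m (A i))"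
    by (intro suminf_le hausdorff_pre_le_outer) auto
  then show "hausdorff_pre m \<delta> (\<Union>i. A i) \<le> (\<Sum>i. hausdorff_outer m (A i))"
    using hausdorff_pre_countable_subadditive order_trans by blast
qed

lemma hausdorff_pre_subadditive:
  assumes "0 \<le> \<delta>"
  shows "hausdorff_pre m \<delta> (A \<union> B) \<le> hausdorff_pre m \<delta> A + hausdorff_pre m \<delta> B"
proof -
  have "(\<Union>i::nat. if i = 0 then A else if i = 1 then B else {}) = A \<union> B"
    by (auto split: if_splits)
  then have "hausdorff_pre m \<delta> (A \<union> B) \<le> (\<Sum>i::nat. hausdorff_pre m \<delta> (if i = 0 then A else if i = 1 then B else {}))"
    using hausdorff_pre_countable_subadditive[of m \<delta> "\<lambda>i. if i = 0 then A else if i = 1 then B else {}"] by simp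
  also have "\<dots> = (\<Sum>i\<in>{0::nat, 1}. hausdorff_pre m \<delta> (if i = 0 then A else if i = 1 then B else {}))"
    using assms by (intro suminf_finite) auto
  finally show ?thesis by simp
qed

lemma hausdorff_outer_subadditive:
  "hausdorff_outer m (A \<union> B) \<le> hausdorff_outer m A + hausdorff_outer m B"
  by (rule hausdorff_outer_le)
    (meson add_mono hausdorff_pre_le_outer hausdorff_pre_subadditive less_imp_le order_trans)

text \<open>Once the mesh is finer than the gap between \<open>A\<close> and \<open>B\<close>, no covering set meets both of
  them, so a cover of the union splits into two covers.\<close>

lemma hausdorff_outer_separated:
  fixes A B :: "'a::metric_space set"
  assumes d: "0 < d" and sep: "\<And>x y. x \<in> A \<Longrightarrow> y \<in> B \<Longrightarrow> d \<le> dist x y"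
  shows "hausdorff_outer m A + hausdorff_outer m B \<le> hausdorff_outer m (A \<union> B)"
proof -
  have *: "hausdorff_pre m \<delta> A + hausdorff_pre m \<delta> B \<le> hausdorff_pre m \<delta> (A \<union> B)"
    if \<delta>: "0 < \<delta>" "\<delta> < d" for \<delta>
  proof (rule hausdorff_pre_greatest)
    fix U :: "nat \<Rightarrow> 'a set"
    assume U: "A \<union> B \<subseteq> (\<Union>i. U i)" "\<And>i. bounded (U i)" "\<And>i. diameter (U i) \<le> \<delta>"
    define UA where "UA i = (if U i \<inter> A = {} then {} else U i)" for i
    define UB where "UB i = (if U i \<inter> B = {} then {} else U i)" for i
    have disj: "U i \<inter> A = {} \<or> U i \<inter> B = {}" for i
      using diameter_bounded_bound[OF U(2)[of i]] U(3)[of i] sep \<delta> by fastforce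
    have "hausdorff_pre m \<delta> A \<le> (\<Sum>i. hausdorff_gauge m (UA i))"
      using U \<delta> by (intro hausdorff_pre_le) (fastforce simp: UA_def)+
    moreover have "hausdorff_pre m \<delta> B \<le> (\<Sum>i. hausdorff_gauge m (UB i))"
      using U \<delta> by (intro hausdorff_pre_le) (fastforce simp: UB_def)+
    ultimately have "hausdorff_pre m \<delta> A + hausdorff_pre m \<delta> B \<le>
        (\<Sum>i. hausdorff_gauge m (UA i)) + (\<Sum>i. hausdorff_gauge m (UB i))"
      by (rule add_mono)
    also have "\<dots> = (\<Sum>i. hausdorff_gauge m (UA i) + hausdorff_gauge m (UB i))"
      by (intro suminf_add) auto
    also have "\<dots> \<le> (\<Sum>i. hausdorff_gauge m (U i))"
      using disj by (intro suminf_le) (auto simp: UA_def UB_def)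
    finally show "hausdorff_pre m \<delta> A + hausdorff_pre m \<delta> B \<le> (\<Sum>i. hausdorff_gauge m (U i))" .
  qed
  have pre: "hausdorff_pre m \<delta> A + hausdorff_pre m \<epsilon> B \<le> hausdorff_outer m (A \<union> B)"
    if "0 < \<delta>" "0 < \<epsilon>" for \<delta> \<epsilon>
  proof -
    define \<eta> where "\<eta> = min (min \<delta> \<epsilon>) (d / 2)"
    have \<eta>: "0 < \<eta>" "\<eta> < d" "\<eta> \<le> \<delta>" "\<eta> \<le> \<epsilon>" using that d by (auto simp: \<eta>_def)
    have "hausdorff_pre m \<delta> A + hausdorff_pre m \<epsilon> B \<le> hausdorff_pre m \<eta> A + hausdorff_pre m \<eta> B"
      using \<eta> by (intro add_mono hausdorff_pre_antimono)
    also have "\<dots> \<le> hausdorff_pre m \<eta> (A \<union> B)" using \<eta> by (intro *)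
    also have "\<dots> \<le> hausdorff_outer m (A \<union> B)" using \<eta> by (intro hausdorff_pre_le_outer)
    finally show ?thesis .
  qed
  have "hausdorff_outer m A + hausdorff_pre m \<epsilon> B \<le> hausdorff_outer m (A \<union> B)" if "0 < \<epsilon>" for \<epsilon>
  proof -
    have "hausdorff_outer m A + hausdorff_pre m \<epsilon> B = (SUP \<delta>\<in>{0<..}. hausdorff_pre m \<delta> A + hausdorff_pre m \<epsilon> B)"
      unfolding hausdorff_outer_def[of m A]
      by (rule ennreal_SUP_add_left[symmetric]) (auto intro: greaterThan_non_empty)
    also have "\<dots> \<le> hausdorff_outer m (A \<union> B)" using pre that by (intro SUP_least) auto
    finally show ?thesis .
  qed
  moreover have "hausdorff_outer m A + hausdorff_outer m B = (SUP \<epsilon>\<in>{0<..}. hausdorff_outer m A + hausdorff_pre m \<epsilon> B)"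
    unfolding hausdorff_outer_def[of m B]
    by (rule ennreal_SUP_add_right) auto
  ultimately show ?thesis by (auto intro!: SUP_least)
qed

text \<open>Caratheodory's criterion for a metric outer measure. The points of \<open>T\<close> at distance at least
  \<open>1/(k+1)\<close> from \<open>F\<close> are separated from \<open>F\<close>; what they miss of \<open>T - F\<close> is a union of shells
  around \<open>F\<close>. Shells of equal parity are mutually separated, so the series of their measures is
  bounded by twice the measure of \<open>T\<close> and its tails vanish.\<close>

lemma hausdorff_outer_caratheodory_closed:
  fixes F T :: "'a::metric_space set"
  assumes F: "closed F"
  shows "hausdorff_outer m (T \<inter> F) + hausdorff_outer m (T - F) = hausdorff_outer m T"
proof (rule antisym)
  have "T = (T \<inter> F) \<union> (T - F)" by auto
  then show "hausdorff_outer m T \<le> hausdorff_outer m (T \<inter> F) + hausdorff_outer m (T - F)"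
    using hausdorff_outer_subadditive[of m "T \<inter> F" "T - F"] by simp
next
  let ?h = "hausdorff_outer m"
  show "?h (T \<inter> F) + ?h (T - F) \<le> ?h T"
  proof (cases "F = {} \<or> ?h T = \<infinity>")
    case True
    then show ?thesis by auto
  next
    case False
    then have ne: "F \<noteq> {}" and fin: "?h T < \<infinity>" by (auto simp: less_top)
    define A where "A k = {x \<in> T. 1 / real (Suc k) \<le> infdist x F}" for k
    define R where "R j = {x \<in> T. 1 / real (Suc (Suc j)) \<le> infdist x F \<and> infdist x F < 1 / real (Suc j)}" for j
    have lip: "infdist x F \<le> infdist y F + dist x y" for x y
      by (metis infdist_triangle)
    have A_sep: "?h (T \<inter> F) + ?h (A k) \<le> ?h T" for k
    proof -
      have "?h (T \<inter> F) + ?h (A k) \<le> ?h ((T \<inter> F) \<union> A k)"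
      proof (rule hausdorff_outer_separated[of "1 / real (Suc k)"])
        fix x y assume "x \<in> T \<inter> F" "y \<in> A k"
        then show "1 / real (Suc k) \<le> dist x y"
          using lip[of y x] by (simp add: A_def dist_commute)
      qed simp
      also have "\<dots> \<le> ?h T" by (rule hausdorff_outer_mono) (auto simp: A_def)
      finally show ?thesis .
    qed
    have R_sum: "(\<Sum>j<n. ?h (R (2 * j + p))) \<le> ?h T" for n p
    proof -
      have "(\<Sum>j<n. ?h (R (2 * j + p))) \<le> ?h (\<Union>j<n. R (2 * j + p))"
      proof (induction n)
        case (Suc n)
        define a b where "a = 1 / real (Suc (2 * n + p))" and "b = 1 / real (2 * n + p)"
        show ?case
        proof (cases "n = 0")
          case True then show ?thesis by (simp add: lessThan_Suc)
        next
          case n: False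
          have "(\<Sum>j<Suc n. ?h (R (2 * j + p))) \<le> ?h (\<Union>j<n. R (2 * j + p)) + ?h (R (2 * n + p))"
            using Suc by (simp add: add_mono)
          also have "\<dots> \<le> ?h ((\<Union>j<n. R (2 * j + p)) \<union> R (2 * n + p))"
          proof (rule hausdorff_outer_separated[of "b - a"])
            show "0 < b - a" using n by (simp add: a_def b_def frac_less2)
            fix x y assume "x \<in> (\<Union>j<n. R (2 * j + p))" and y: "y \<in> R (2 * n + p)"
            then obtain j where j: "j < n" "x \<in> R (2 * j + p)" by auto
            have "b \<le> 1 / real (Suc (Suc (2 * j + p)))"
              unfolding b_def using j(1) by (intro frac_le) auto
            also have "\<dots> \<le> infdist x F" using j by (simp add: R_def)
            finally have "b \<le> infdist x F" .
            moreover have "infdist y F < a" using y by (simp add: R_def a_def)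
            ultimately show "b - a \<le> dist x y" using lip[of x y] by simp
          qed
          also have "(\<Union>j<n. R (2 * j + p)) \<union> R (2 * n + p) = (\<Union>j<Suc n. R (2 * j + p))"
            by (auto simp: lessThan_Suc)
          finally show ?thesis .
        qed
      qed simp
      also have "\<dots> \<le> ?h T" by (rule hausdorff_outer_mono) (auto simp: R_def)
      finally show ?thesis .
    qed
    have R_even_odd: "(\<Sum>j<2 * n. ?h (R j)) = (\<Sum>j<n. ?h (R (2 * j + 0))) + (\<Sum>j<n. ?h (R (2 * j + 1)))" for n
      by (induction n) (simp_all add: ac_simps)
    have R_bound: "(\<Sum>j<n. ?h (R j)) \<le> 2 * ?h T" for n
    proof -
      have "(\<Sum>j<n. ?h (R j)) \<le> (\<Sum>j<2 * n. ?h (R j))" by (intro sum_mono2) auto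
      also have "\<dots> \<le> ?h T + ?h T" unfolding R_even_odd by (intro add_mono R_sum)
      finally show ?thesis by (simp add: mult_2)
    qed
    have R_fin: "(\<Sum>j. ?h (R j)) < \<infinity>"
    proof -
      have "(\<Sum>j. ?h (R j)) \<le> 2 * ?h T"
        using R_bound by (intro suminf_le_const) auto
      also have "\<dots> < \<infinity>" using fin by (simp add: ennreal_mult_less_top)
      finally show ?thesis .
    qed
    have tail: "(\<lambda>k. \<Sum>j. ?h (R (j + k))) \<longlonglongrightarrow> 0"
    proof -
      define r where "r j = enn2real (?h (R j))" for j
      have "?h (R j) < \<infinity>" for j
      proof -
        have "?h (R j) \<le> (\<Sum>j. ?h (R j))" using sum_le_suminf[of "\<lambda>j. ?h (R j)" "{j}"] by simp
        then show ?thesis using R_fin by (rule order_le_less_trans)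
      qed
      then have r: "?h (R j) = ennreal (r j)" "0 \<le> r j" for j by (simp_all add: r_def)
      have summ: "summable r"
        using R_fin r by (intro summable_suminf_not_top) auto
      have "(\<lambda>k. \<Sum>j. r (j + k)) \<longlonglongrightarrow> 0"
        by (rule suminf_exist_split2[OF summ])
      then have "(\<lambda>k. ennreal (\<Sum>j. r (j + k))) \<longlonglongrightarrow> ennreal 0" by (rule tendsto_ennrealI)
      moreover have "ennreal (\<Sum>j. r (j + k)) = (\<Sum>j. ?h (R (j + k)))" for k
        unfolding r(1) using summ r(2) by (intro suminf_ennreal2[symmetric]) (auto simp: summable_iff_shift)
      ultimately show ?thesis by simp
    qed
    have cover: "T - F \<subseteq> A k \<union> (\<Union>j. R (j + k))" for k
    proof
      fix x assume x: "x \<in> T - F"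
      then have pos: "0 < infdist x F" using F ne by (simp add: infdist_pos_not_in_closed)
      show "x \<in> A k \<union> (\<Union>j. R (j + k))"
      proof (cases "x \<in> A k")
        case False
        then have lt: "infdist x F < 1 / real (Suc k)" using x by (simp add: A_def)
        obtain N where "1 / real (Suc N) < infdist x F" using nat_approx_posE[OF pos] by auto
        then have ex: "\<exists>N. 1 / real (Suc N) \<le> infdist x F" by (auto intro: less_imp_le)
        define L where "L = (LEAST N. 1 / real (Suc N) \<le> infdist x F)"
        have L1: "1 / real (Suc L) \<le> infdist x F" unfolding L_def by (rule LeastI_ex[OF ex])
        have "1 / real (Suc L) < 1 / real (Suc k)" using L1 lt by linarith
        then have kL: "k < L" by (simp add: field_simps)
        then have "\<not> 1 / real (Suc (L - 1)) \<le> infdist x F"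
          unfolding L_def by (intro not_less_Least) (use kL L_def in auto)
        then have "x \<in> R ((L - 1 - k) + k)" using kL L1 x by (simp add: R_def)
        then show ?thesis by blast
      qed simp
    qed
    have step: "?h (T \<inter> F) + ?h (T - F) \<le> ?h T + (\<Sum>j. ?h (R (j + k)))" for k
    proof -
      have "?h (T - F) \<le> ?h (A k) + ?h (\<Union>j. R (j + k))"
        using hausdorff_outer_mono[OF cover] hausdorff_outer_subadditive order_trans by blast
      also have "\<dots> \<le> ?h (A k) + (\<Sum>j. ?h (R (j + k)))"
        by (intro add_left_mono hausdorff_outer_countable_subadditive)
      finally have "?h (T \<inter> F) + ?h (T - F) \<le> (?h (T \<inter> F) + ?h (A k)) + (\<Sum>j. ?h (R (j + k)))"
        by (simp add: add_left_mono add.assoc)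
      also have "\<dots> \<le> ?h T + (\<Sum>j. ?h (R (j + k)))" by (intro add_right_mono A_sep)
      finally show ?thesis .
    qed
    have "(\<lambda>k. ?h T + (\<Sum>j. ?h (R (j + k)))) \<longlonglongrightarrow> ?h T + 0"
      by (intro tendsto_add tendsto_const tail)
    then show ?thesis by (intro LIMSEQ_le_const[of _ "?h T"]) (use step in auto)
  qed
qed

text \<open>The Caratheodory-measurable sets form a sigma-algebra, and it contains the closed sets.\<close>

lemma hausdorff_measure_space: "measure_space UNIV (sets borel) (hausdorff_outer m :: 'a::metric_space set \<Rightarrow> ennreal)"
proof -
  let ?h = "hausdorff_outer m :: 'a set \<Rightarrow> ennreal"
  interpret S: sigma_algebra UNIV "UNIV :: 'a set set" by (simp add: sigma_algebra_iff2)
  have "outer_measure_space UNIV ?h"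
    unfolding outer_measure_space_def
  proof (intro conjI)
    show "positive UNIV ?h" by (simp add: positive_def)
    show "increasing UNIV ?h" by (simp add: increasing_def hausdorff_outer_mono)
    show "countably_subadditive UNIV ?h"
      by (simp add: countably_subadditive_def hausdorff_outer_countable_subadditive)
  qed
  then have ms: "measure_space UNIV (lambda_system UNIV UNIV ?h) ?h" by (rule S.caratheodory_lemma)
  then interpret L: sigma_algebra UNIV "lambda_system UNIV UNIV ?h" by (simp add: measure_space_def)
  have "{F. closed F} \<subseteq> lambda_system UNIV UNIV ?h"
    by (auto simp: S.lambda_system_eq hausdorff_outer_caratheodory_closed)
  then have "sigma_sets UNIV {F :: 'a set. closed F} \<subseteq> lambda_system UNIV UNIV ?h"
    by (rule L.sigma_sets_subset)
  moreover have "sets borel = sigma_sets UNIV {F :: 'a set. closed F}"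
    by (subst borel_eq_closed) simp
  ultimately show ?thesis
    by (intro measure_down[OF ms]) (auto simp: sets.sigma_algebra_axioms sigma_algebra_sigma_sets)
qed

lemma sets_hausdorff_measure [simp, measurable_cong]: "sets (hausdorff_measure m :: 'a::metric_space measure) = sets borel"
  unfolding hausdorff_measure_def using sets.sets_measure_of_eq[of "borel :: 'a measure"] by simp

lemma space_hausdorff_measure [simp]: "space (hausdorff_measure m) = UNIV"
  unfolding hausdorff_measure_def by (simp add: space_measure_of_conv)

lemma emeasure_hausdorff_measure:
  fixes A :: "'a::metric_space set"
  assumes "A \<in> sets borel"
  shows "emeasure (hausdorff_measure m) A = hausdorff_outer m A"
  unfolding hausdorff_measure_def
proof (rule emeasure_measure_of_sigma)
  show "sigma_algebra UNIV (sets (borel :: 'a measure))"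
    using sets.sigma_algebra_axioms[of "borel :: 'a measure"] by simp
  show "positive (sets borel) (hausdorff_outer m :: 'a set \<Rightarrow> ennreal)"
    "countably_additive (sets borel) (hausdorff_outer m :: 'a set \<Rightarrow> ennreal)"
    using hausdorff_measure_space[of m] by (auto simp: measure_space_def)
qed fact

section \<open>Lipschitz maps and Hausdorff measure\<close>

text \<open>The image of a cover is a cover with diameters scaled by at most \<open>L\<close>. Positivity of \<open>L\<close> lets the mesh
  be rescaled.\<close>

lemma hausdorff_outer_lipschitz_image:
  fixes f :: "'a::metric_space \<Rightarrow> 'b::metric_space"
  assumes f: "L-lipschitz_on A f" and L: "0 < L"
  shows "hausdorff_outer m (f ` A) \<le> ennreal (L ^ m) * hausdorff_outer m A"
proof (rule hausdorff_outer_le)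
  fix \<delta> :: real assume \<delta>: "0 < \<delta>"
  have "inverse (ennreal (L ^ m)) * hausdorff_pre m \<delta> (f ` A) \<le> hausdorff_pre m (\<delta> / L) A"
  proof (rule hausdorff_pre_greatest)
    fix U :: "nat \<Rightarrow> 'a set"
    assume U: "A \<subseteq> (\<Union>i. U i)" "\<And>i. bounded (U i)" "\<And>i. diameter (U i) \<le> \<delta> / L"
    define W where "W i = f ` (U i \<inter> A)" for i
    have d: "dist x y \<le> L * diameter (U i)" if xy: "x \<in> W i" "y \<in> W i" for x y i
    proof -
      obtain a b where ab: "a \<in> U i \<inter> A" "b \<in> U i \<inter> A" "x = f a" "y = f b" using xy unfolding W_def by blast
      then have "dist x y \<le> L * dist a b" using lipschitz_onD[OF f] by auto
      also have "\<dots> \<le> L * diameter (U i)"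
        using ab U(2) L by (intro mult_left_mono diameter_bounded_bound) auto
      finally show ?thesis .
    qed
    have bd: "bounded (W i)" for i
      using lipschitz_on_uniformly_continuous[OF lipschitz_on_subset[OF f]] U(2) d
      unfolding bounded_two_points by blast
    have diam: "diameter (W i) \<le> L * diameter (U i)" for i
      using d L U(2)[of i] by (auto simp: diameter_def[of "W i"] diameter_ge_0 intro!: cSUP_least)
    have gauge: "hausdorff_gauge m (W i) \<le> ennreal (L ^ m) * hausdorff_gauge m (U i)" for i
    proof (cases "W i = {}")
      case False
      then have "U i \<noteq> {}" by (auto simp: W_def)
      have "unit_ball_vol m * (diameter (W i) / 2) ^ m \<le> unit_ball_vol m * (L * diameter (U i) / 2) ^ m"
        using diam[of i] bd by (intro mult_left_mono power_mono) (auto simp: diameter_ge_0)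
      also have "\<dots> = L ^ m * (unit_ball_vol m * (diameter (U i) / 2) ^ m)"
        by (simp add: power_mult_distrib power_divide)
      finally show ?thesis using False \<open>U i \<noteq> {}\<close> L U(2)[of i]
        by (simp add: hausdorff_gauge_def ennreal_mult[symmetric] diameter_ge_0)
    qed simp
    have "hausdorff_pre m \<delta> (f ` A) \<le> (\<Sum>i. hausdorff_gauge m (W i))"
    proof (rule hausdorff_pre_le)
      show "f ` A \<subseteq> (\<Union>i. W i)" using U(1) by (fastforce simp: W_def)
      show "diameter (W i) \<le> \<delta>" for i
        using diam[of i] U(3)[of i] L by (simp add: field_simps)
    qed (rule bd)
    also have "\<dots> \<le> (\<Sum>i. ennreal (L ^ m) * hausdorff_gauge m (U i))"
      by (intro suminf_le gauge) auto
    also have "\<dots> = ennreal (L ^ m) * (\<Sum>i. hausdorff_gauge m (U i))" by simp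
    finally have "inverse (ennreal (L ^ m)) * hausdorff_pre m \<delta> (f ` A) \<le>
        inverse (ennreal (L ^ m)) * (ennreal (L ^ m) * (\<Sum>i. hausdorff_gauge m (U i)))"
      by (rule mult_left_mono) simp
    also have "\<dots> = (\<Sum>i. hausdorff_gauge m (U i))"
      using L by (simp add: mult.assoc[symmetric] inverse_ennreal ennreal_mult[symmetric])
    finally show "inverse (ennreal (L ^ m)) * hausdorff_pre m \<delta> (f ` A) \<le> (\<Sum>i. hausdorff_gauge m (U i))" .
  qed
  also have "\<dots> \<le> hausdorff_outer m A" using \<delta> L by (intro hausdorff_pre_le_outer) auto
  finally have "ennreal (L ^ m) * (inverse (ennreal (L ^ m)) * hausdorff_pre m \<delta> (f ` A)) \<le> ennreal (L ^ m) * hausdorff_outer m A"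
    by (rule mult_left_mono) simp
  moreover have "ennreal (L ^ m) * inverse (ennreal (L ^ m)) = 1"
    using L by (simp add: inverse_ennreal ennreal_mult[symmetric])
  ultimately show "hausdorff_pre m \<delta> (f ` A) \<le> ennreal (L ^ m) * hausdorff_outer m A"
    by (simp add: mult.assoc[symmetric])
qed

lemma hausdorff_outer_isometry_image:
  fixes T :: "'a::metric_space \<Rightarrow> 'a"
  assumes "\<And>x y. dist (T x) (T y) = dist x y" "\<And>x. T (T x) = x"
  shows "hausdorff_outer m (T ` A) = hausdorff_outer m A"
proof -
  have le: "hausdorff_outer m (T ` B) \<le> hausdorff_outer m B" for B
    using hausdorff_outer_lipschitz_image[of 1 B T m] assms by (simp add: lipschitz_on_def)
  have "T ` T ` A = A" using assms(2) by (simp add: image_image)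
  then show ?thesis using le[of A] le[of "T ` A"] by simp
qed

section \<open>The Prekopa-Leindler inequality\<close>

text \<open>The midpoints of \<open>A\<close> with one fixed point form a copy of \<open>A\<close> of half the size.\<close>

lemma emeasure_midpoints_fixed:
  fixes A :: "real set"
  assumes [measurable]: "A \<in> sets borel"
  shows "emeasure lborel A = 2 * emeasure lborel ((\<lambda>x. (x + b) / 2) ` A)"
    and "(\<lambda>x. (x + b) / 2) ` A \<in> sets borel"
proof -
  have eq: "(\<lambda>x. (x + b) / 2) ` A = (\<lambda>y. - b + 2 * y) -` A \<inter> space borel"
  proof (intro set_eqI iffI)
    fix y assume "y \<in> (\<lambda>y. - b + 2 * y) -` A \<inter> space borel"
    then show "y \<in> (\<lambda>x. (x + b) / 2) ` A" by (intro image_eqI[of _ _ "- b + 2 * y"]) auto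
  qed (auto simp: field_simps)
  show meas: "(\<lambda>x. (x + b) / 2) ` A \<in> sets borel" unfolding eq by measurable
  have "emeasure lborel A = (\<integral>\<^sup>+ x. indicator A x \<partial>lborel)" by simp
  also have "\<dots> = 2 * (\<integral>\<^sup>+ y. indicator A (- b + 2 * y) \<partial>lborel)"
    by (subst nn_integral_real_affine[of _ 2 "- b"]) auto
  also have "(\<integral>\<^sup>+ y. indicator A (- b + 2 * y) \<partial>lborel) = (\<integral>\<^sup>+ y. indicator ((\<lambda>x. (x + b) / 2) ` A) y \<partial>lborel)"
    unfolding eq by (intro nn_integral_cong) (auto simp: indicator_def)
  also have "\<dots> = emeasure lborel ((\<lambda>x. (x + b) / 2) ` A)" using meas by simp
  finally show "emeasure lborel A = 2 * emeasure lborel ((\<lambda>x. (x + b) / 2) ` A)" .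
qed

text \<open>Shrinking \<open>A\<close> towards a point near the infimum of \<open>B\<close>, and \<open>B\<close> towards a point near the
  supremum of \<open>A\<close>, gives two sets of midpoints that overlap only in a short interval.\<close>

lemma brunn_minkowski_real_bounded:
  fixes A B C :: "real set"
  assumes [measurable]: "A \<in> sets borel" "B \<in> sets borel" "C \<in> sets borel"
    and "A \<noteq> {}" "B \<noteq> {}" "bdd_above A" "bdd_below B"
    and mid: "\<And>a b. a \<in> A \<Longrightarrow> b \<in> B \<Longrightarrow> (a + b) / 2 \<in> C"
  shows "emeasure lborel A + emeasure lborel B \<le> 2 * emeasure lborel C"
proof (rule ennreal_le_epsilon)
  fix e :: real assume e: "0 < e"
  obtain a where a: "a \<in> A" "Sup A - e / 2 < a"
    using less_cSupD[of A "Sup A - e / 2"] assms e by auto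
  obtain b where b: "b \<in> B" "b < Inf B + e / 2"
    using cInf_lessD[of B "Inf B + e / 2"] assms e by auto
  define X where "X = (\<lambda>x. (x + b) / 2) ` A"
  define Y where "Y = (\<lambda>x. (x + a) / 2) ` B"
  have [measurable]: "X \<in> sets borel" "Y \<in> sets borel"
    unfolding X_def Y_def by (intro emeasure_midpoints_fixed(2) assms)+
  have "X \<inter> Y \<subseteq> {(a + Inf B) / 2 .. (Sup A + b) / 2}"
  proof
    fix z assume "z \<in> X \<inter> Y"
    then obtain x y where "x \<in> A" "z = (x + b) / 2" "y \<in> B" "z = (y + a) / 2"
      by (auto simp: X_def Y_def)
    moreover from this have "x \<le> Sup A" "Inf B \<le> y" using assms by (auto intro: cSup_upper cInf_lower)
    ultimately show "z \<in> {(a + Inf B) / 2 .. (Sup A + b) / 2}" by auto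
  qed
  then have "emeasure lborel (X \<inter> Y) \<le> emeasure lborel {(a + Inf B) / 2 .. (Sup A + b) / 2}"
    by (intro emeasure_mono) auto
  also have "\<dots> \<le> ennreal (e / 2)"
    using a b e by (auto simp: emeasure_lborel_Icc_eq field_simps intro!: ennreal_leI)
  finally have small: "emeasure lborel (X \<inter> Y) \<le> ennreal (e / 2)" .
  have "emeasure lborel X + emeasure lborel Y = emeasure lborel (X \<union> Y) + emeasure lborel (X \<inter> Y)"
    by (rule emeasure_Un_Int) auto
  also have "\<dots> \<le> emeasure lborel C + ennreal (e / 2)"
  proof (intro add_mono emeasure_mono small)
    show "X \<union> Y \<subseteq> C"
      using mid[OF _ b(1)] mid[OF a(1)] by (auto simp: X_def Y_def add.commute[of _ a])
  qed auto
  finally have "2 * (emeasure lborel X + emeasure lborel Y) \<le> 2 * (emeasure lborel C + ennreal (e / 2))"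
    by (rule mult_left_mono) simp
  moreover have "2 * ennreal (e / 2) = ennreal e"
    using e by (simp add: ennreal_mult'[symmetric] flip: ennreal_numeral)
  ultimately show "emeasure lborel A + emeasure lborel B \<le> 2 * emeasure lborel C + ennreal e"
    using emeasure_midpoints_fixed(1)[of A b] emeasure_midpoints_fixed(1)[of B a]
    by (simp add: X_def Y_def distrib_left)
qed

text \<open>Cutting off \<open>A\<close> from above and \<open>B\<close> from below, far enough out to keep a point of each, exhausts both
  sets by bounded ones.\<close>

lemma brunn_minkowski_real:
  fixes A B C :: "real set"
  assumes [measurable]: "A \<in> sets borel" "B \<in> sets borel" "C \<in> sets borel"
    and ne: "A \<noteq> {}" "B \<noteq> {}"
    and mid: "\<And>a b. a \<in> A \<Longrightarrow> b \<in> B \<Longrightarrow> (a + b) / 2 \<in> C"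
  shows "emeasure lborel A + emeasure lborel B \<le> 2 * emeasure lborel C"
proof -
  obtain a b where ab: "a \<in> A" "b \<in> B" using ne by auto
  define Ak where "Ak k = A \<inter> {..\<bar>a\<bar> + real k}" for k
  define Bk where "Bk k = B \<inter> {- \<bar>b\<bar> - real k..}" for k
  have "emeasure lborel (Ak k) + emeasure lborel (Bk k) \<le> 2 * emeasure lborel C" for k
    using ab mid by (intro brunn_minkowski_real_bounded) (auto simp: Ak_def Bk_def bdd_above_def bdd_below_def)
  then have "(SUP k. emeasure lborel (Ak k) + emeasure lborel (Bk k)) \<le> 2 * emeasure lborel C"
    by (intro SUP_least)
  also have "(SUP k. emeasure lborel (Ak k) + emeasure lborel (Bk k)) =
      (SUP k. emeasure lborel (Ak k)) + (SUP k. emeasure lborel (Bk k))"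
    by (intro ennreal_SUP_add incseq_emeasure) (auto simp: incseq_def Ak_def Bk_def)
  also have "(SUP k. emeasure lborel (Ak k)) = emeasure lborel (\<Union>k. Ak k)"
    by (intro SUP_emeasure_incseq) (auto simp: incseq_def Ak_def)
  also have "(SUP k. emeasure lborel (Bk k)) = emeasure lborel (\<Union>k. Bk k)"
    by (intro SUP_emeasure_incseq) (auto simp: incseq_def Bk_def)
  also have "(\<Union>k. Ak k) = A"
  proof -
    have "\<exists>k. x \<le> \<bar>a\<bar> + real k" for x using real_arch_simple[of "x - \<bar>a\<bar>"] by (auto simp: algebra_simps)
    then show ?thesis by (auto simp: Ak_def)
  qed
  also have "(\<Union>k. Bk k) = B"
  proof -
    have "\<exists>k. - \<bar>b\<bar> - real k \<le> x" for x
    proof -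
      obtain k where "- x - \<bar>b\<bar> \<le> real k" using real_arch_simple by blast
      then have "- \<bar>b\<bar> - real k \<le> x" by linarith
      then show ?thesis ..
    qed
    then show ?thesis by (auto simp: Bk_def)
  qed
  finally show ?thesis .
qed

text \<open>The layer-cake formula with levels scaled to the unit interval, so that the level sets of two
  functions with different maxima can be compared at the same parameter.\<close>

lemma (in sigma_finite_measure) nn_integral_layer_cake:
  fixes \<phi> :: "'a \<Rightarrow> ennreal"
  assumes [measurable]: "\<phi> \<in> borel_measurable M" and c: "0 < c"
  shows "(\<integral>\<^sup>+ x. min (\<phi> x) (ennreal c) \<partial>M) =
    ennreal c * (\<integral>\<^sup>+ t. indicator {0<..<1} t * emeasure M {x \<in> space M. ennreal (c * t) < \<phi> x} \<partial>lborel)"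
proof -
  interpret P: pair_sigma_finite M "lborel :: real measure" by standard
  let ?i = "\<lambda>x t. indicator {0<..<1} t * indicator {t. ennreal (c * t) < \<phi> x} t :: ennreal"
  have pt: "min (\<phi> x) (ennreal c) = ennreal c * (\<integral>\<^sup>+ t. ?i x t \<partial>lborel)" for x
  proof -
    have "(\<integral>\<^sup>+ t. ?i x t \<partial>lborel) =
        (\<integral>\<^sup>+ t. indicator ({0<..<1} \<inter> {t. ennreal (c * t) < \<phi> x}) t \<partial>lborel)"
      by (intro nn_integral_cong) (auto simp: indicator_def)
    also have "\<dots> = emeasure lborel ({0<..<1} \<inter> {t. ennreal (c * t) < \<phi> x})"
      by (rule nn_integral_indicator) measurable
    also have "ennreal c * \<dots> = min (\<phi> x) (ennreal c)"
    proof (cases "\<phi> x")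
      case (real r)
      have "{0<..<1} \<inter> {t. ennreal (c * t) < \<phi> x} = {0<..<min 1 (r / c)}"
        using c real by (auto simp: ennreal_less_iff field_simps)
      then show ?thesis using c real
        by (simp add: ennreal_mult[symmetric] min_def field_simps ennreal_le_iff)
    next
      case top
      have "{0<..<1} \<inter> {t. ennreal (c * t) < \<phi> x} = {0<..<1::real}" using top by auto
      then show ?thesis using c top by simp
    qed
    finally show ?thesis ..
  qed
  have "(\<integral>\<^sup>+ x. min (\<phi> x) (ennreal c) \<partial>M) =
      ennreal c * (\<integral>\<^sup>+ x. (\<integral>\<^sup>+ t. ?i x t \<partial>lborel) \<partial>M)"
    unfolding pt by (rule nn_integral_cmult) measurable
  also have "(\<integral>\<^sup>+ x. (\<integral>\<^sup>+ t. ?i x t \<partial>lborel) \<partial>M) =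
      (\<integral>\<^sup>+ t. (\<integral>\<^sup>+ x. ?i x t \<partial>M) \<partial>lborel)"
    by (rule P.Fubini'[symmetric]) measurable
  also have "\<dots> = (\<integral>\<^sup>+ t. indicator {0<..<1} t * emeasure M {x \<in> space M. ennreal (c * t) < \<phi> x} \<partial>lborel)"
  proof (intro nn_integral_cong)
    fix t :: real
    have "(\<integral>\<^sup>+ x. ?i x t \<partial>M) =
        indicator {0<..<1} t * (\<integral>\<^sup>+ x. indicator {t. ennreal (c * t) < \<phi> x} t \<partial>M)"
      by (rule nn_integral_cmult) measurable
    also have "(\<integral>\<^sup>+ x. indicator {t. ennreal (c * t) < \<phi> x} t \<partial>M) = (\<integral>\<^sup>+ x. indicator {x \<in> space M. ennreal (c * t) < \<phi> x} x \<partial>M)"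
      by (intro nn_integral_cong) (auto simp: indicator_def)
    also have "\<dots> = emeasure M {x \<in> space M. ennreal (c * t) < \<phi> x}"
      by (rule nn_integral_indicator) measurable
    finally show "(\<integral>\<^sup>+ x. ?i x t \<partial>M) =
        indicator {0<..<1} t * emeasure M {x \<in> space M. ennreal (c * t) < \<phi> x}" .
  qed
  finally show ?thesis .
qed

lemma ennreal_mult_le_square_mean:
  fixes a b c :: ennreal
  assumes "a + b \<le> 2 * c"
  shows "a * b \<le> c\<^sup>2"
proof (cases c)
  case (real r)
  then have fin: "a < \<infinity>" "b < \<infinity>" using assms
    by (auto simp: ennreal_mult_less_top less_top[symmetric] ennreal_add_eq_top top_unique ennreal_mult_eq_top_iff)
  then obtain x y where xy: "a = ennreal x" "b = ennreal y" "0 \<le> x" "0 \<le> y"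
    by (metis enn2real_nonneg ennreal_enn2real infinity_ennreal_def)
  have "x + y \<le> 2 * r"
    using assms xy real by (simp add: ennreal_plus[symmetric] ennreal_mult'[symmetric] del: ennreal_plus flip: ennreal_numeral)
  then have "(x + y)\<^sup>2 \<le> (2 * r)\<^sup>2" using xy by (intro power_mono) auto
  moreover have "4 * (x * y) \<le> (x + y)\<^sup>2" using zero_le_power2[of "x - y"] by (simp add: power2_eq_square algebra_simps)
  ultimately have "x * y \<le> r\<^sup>2" by (simp add: power_mult_distrib)
  then show ?thesis using xy real by (simp add: ennreal_mult[symmetric] ennreal_power)
next
  case top then show ?thesis by (simp add: power2_eq_square ennreal_top_mult)
qed

lemma ennreal_mult_strict_mono:
  fixes a b c d :: ennreal
  assumes "a < b" "c < d"
  shows "a * c < b * d"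
proof -
  obtain x y where xy: "a = ennreal x" "c = ennreal y" "0 \<le> x" "0 \<le> y"
    using assms by (metis enn2real_nonneg ennreal_enn2real order_less_le_trans top_greatest)
  have pos: "b \<noteq> 0" "d \<noteq> 0" using assms by auto
  show ?thesis
  proof (cases "b = top \<or> d = top")
    case True
    then have "b * d = top" using pos by (auto simp: ennreal_mult_eq_top_iff)
    then show ?thesis using xy by (simp add: ennreal_mult[symmetric])
  next
    case False
    then obtain u v where "b = ennreal u" "d = ennreal v" "0 \<le> u" "0 \<le> v"
      by (metis enn2real_nonneg ennreal_enn2real less_top)
    then show ?thesis using assms xy
      by (simp add: ennreal_mult[symmetric] ennreal_less_iff mult_strict_mono')
  qed
qed

lemma ennreal_power2_le_imp_le:
  fixes a b :: ennreal
  assumes "a\<^sup>2 \<le> b\<^sup>2"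
  shows "a \<le> b"
  using assms ennreal_mult_strict_mono[of b a b a] by (auto simp: power2_eq_square not_less[symmetric])

text \<open>With the maxima normalised, the superlevel set of \<open>h\<close> at each level contains the midpoints of
  the superlevel sets of \<open>f\<close> and \<open>g\<close>, both nonempty; integrate the one-dimensional
  Brunn-Minkowski inequality over the levels.\<close>

lemma prekopa_leindler_real_bounded:
  fixes f g h :: "real \<Rightarrow> ennreal"
  assumes [measurable]: "f \<in> borel_measurable borel" "g \<in> borel_measurable borel" "h \<in> borel_measurable borel"
    and mid: "\<And>x y. f x * g y \<le> (h ((x + y) / 2))\<^sup>2"
    and bf: "\<And>x. f x \<le> ennreal K" and bg: "\<And>x. g x \<le> ennreal K"
  shows "(\<integral>\<^sup>+ x. f x \<partial>lborel) * (\<integral>\<^sup>+ x. g x \<partial>lborel) \<le> (\<integral>\<^sup>+ x. h x \<partial>lborel)\<^sup>2"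
proof (cases "(SUP x. f x) = 0 \<or> (SUP x. g x) = 0")
  case True
  then have "(\<forall>x. f x = 0) \<or> (\<forall>x. g x = 0)"
    by (metis SUP_upper UNIV_I le_zero_eq)
  then show ?thesis by auto
next
  case False
  have "(SUP x. f x) \<le> ennreal K" "(SUP x. g x) \<le> ennreal K" using bf bg by (auto intro: SUP_least)
  then have "(SUP x. f x) < top" "(SUP x. g x) < top"
    by (auto intro: le_less_trans)
  then obtain a b where ab: "(SUP x. f x) = ennreal a" "(SUP x. g x) = ennreal b" "0 < a" "0 < b"
    using False by (metis enn2real_positive_iff ennreal_enn2real zero_less_iff_neq_zero)
  have fa: "f x \<le> ennreal a" and gb: "g x \<le> ennreal b" for x
    unfolding ab(1,2)[symmetric] by (auto intro: SUP_upper)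
  define c where "c = sqrt (a * b)"
  have c: "0 < c" "c * c = a * b" using ab by (auto simp: c_def)
  define F where "F t = emeasure lborel {x. ennreal (a * t) < f x}" for t
  define G where "G t = emeasure lborel {x. ennreal (b * t) < g x}" for t
  define H where "H t = emeasure lborel {x. ennreal (c * t) < h x}" for t
  have level: "F t + G t \<le> 2 * H t" if t: "0 < t" "t < 1" for t
    unfolding F_def G_def H_def
  proof (rule brunn_minkowski_real)
    have "ennreal (a * t) < (SUP x. f x)" "ennreal (b * t) < (SUP x. g x)"
      using ab t by (auto simp: ennreal_less_iff)
    then show "{x. ennreal (a * t) < f x} \<noteq> {}" "{x. ennreal (b * t) < g x} \<noteq> {}"
      by (auto simp: less_SUP_iff)
    fix x y assume "x \<in> {x. ennreal (a * t) < f x}" "y \<in> {x. ennreal (b * t) < g x}"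
    then have "ennreal (a * t) * ennreal (b * t) < f x * g y"
      by (intro ennreal_mult_strict_mono) auto
    also have "\<dots> \<le> (h ((x + y) / 2))\<^sup>2" by (rule mid)
    also have "ennreal (a * t) * ennreal (b * t) = (ennreal (c * t))\<^sup>2"
      using ab t c by (simp add: ennreal_mult[symmetric] ennreal_power power2_eq_square ac_simps)
    finally have "ennreal (c * t) < h ((x + y) / 2)"
      by (meson leD leI power_mono zero_le)
    then show "(x + y) / 2 \<in> {x. ennreal (c * t) < h x}" by simp
  qed measurable
  have lc: "(\<integral>\<^sup>+ x. min (\<phi> x) (ennreal d) \<partial>lborel) = ennreal d * (\<integral>\<^sup>+ t. indicator {0<..<1} t * emeasure lborel {x. ennreal (d * t) < \<phi> x} \<partial>lborel)"
    if [measurable]: "\<phi> \<in> borel_measurable borel" and "0 < d" for \<phi> :: "real \<Rightarrow> ennreal" and d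
    using lborel.nn_integral_layer_cake[of \<phi> d] that by simp
  let ?I = "\<lambda>\<phi>. \<integral>\<^sup>+ t. indicator {0<..<1::real} t * \<phi> t \<partial>lborel :: ennreal"
  have meas_level: "(\<lambda>t. emeasure lborel {x. ennreal (d * t) < \<phi> x}) \<in> borel_measurable borel"
    if [measurable]: "\<phi> \<in> borel_measurable borel" for \<phi> :: "real \<Rightarrow> ennreal" and d
  proof -
    have "(\<lambda>t. \<integral>\<^sup>+ x. indicator {p. ennreal (d * fst p) < \<phi> (snd p)} (t, x) \<partial>lborel) \<in> borel_measurable borel"
      by measurable
    moreover have "(\<integral>\<^sup>+ x. indicator {p. ennreal (d * fst p) < \<phi> (snd p)} (t, x) \<partial>lborel) = emeasure lborel {x. ennreal (d * t) < \<phi> x}" for t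
    proof -
      have "(\<integral>\<^sup>+ x. indicator {p. ennreal (d * fst p) < \<phi> (snd p)} (t, x) \<partial>lborel) =
          (\<integral>\<^sup>+ x. indicator {x. ennreal (d * t) < \<phi> x} x \<partial>lborel)"
        by (intro nn_integral_cong) (auto simp: indicator_def)
      also have "\<dots> = emeasure lborel {x. ennreal (d * t) < \<phi> x}"
        by (rule nn_integral_indicator) measurable
      finally show ?thesis .
    qed
    ultimately show ?thesis by simp
  qed
  have [measurable]: "F \<in> borel_measurable borel" "G \<in> borel_measurable borel" "H \<in> borel_measurable borel"
    unfolding F_def G_def H_def by (rule meas_level, measurable)+
  have If: "(\<integral>\<^sup>+ x. f x \<partial>lborel) = ennreal a * ?I F"
    using lc[of f a] fa ab by (simp add: F_def min_absorb1)
  have Ig: "(\<integral>\<^sup>+ x. g x \<partial>lborel) = ennreal b * ?I G"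
    using lc[of g b] gb ab by (simp add: G_def min_absorb1)
  have "ennreal c * ?I H = (\<integral>\<^sup>+ x. min (h x) (ennreal c) \<partial>lborel)"
    using lc[of h c] c by (simp add: H_def)
  also have "\<dots> \<le> (\<integral>\<^sup>+ x. h x \<partial>lborel)" by (intro nn_integral_mono) auto
  finally have Ih: "ennreal c * ?I H \<le> (\<integral>\<^sup>+ x. h x \<partial>lborel)" .
  have "?I F + ?I G = ?I (\<lambda>t. F t + G t)"
    by (subst nn_integral_add[symmetric]) (auto simp: distrib_left)
  also have "\<dots> \<le> ?I (\<lambda>t. 2 * H t)"
    using level by (intro nn_integral_mono) (auto simp: indicator_def)
  also have "\<dots> = 2 * ?I H"
    by (subst nn_integral_cmult[symmetric]) (auto simp: ac_simps)
  finally have "?I F * ?I G \<le> (?I H)\<^sup>2" by (rule ennreal_mult_le_square_mean)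
  then have "ennreal (c * c) * (?I F * ?I G) \<le> ennreal (c * c) * (?I H)\<^sup>2"
    by (rule mult_left_mono) simp
  also have "\<dots> = (ennreal c * ?I H)\<^sup>2"
    using ennreal_mult[of c c] c(1) by (simp only: power2_eq_square ac_simps less_imp_le)
  also have "\<dots> \<le> (\<integral>\<^sup>+ x. h x \<partial>lborel)\<^sup>2" by (intro power_mono Ih) simp
  also have "ennreal (c * c) * (?I F * ?I G) = (\<integral>\<^sup>+ x. f x \<partial>lborel) * (\<integral>\<^sup>+ x. g x \<partial>lborel)"
    unfolding If Ig c(2) using ab by (simp add: ennreal_mult ac_simps)
  finally show ?thesis .
qed

lemma nn_integral_SUP_truncate:
  fixes f :: "'a \<Rightarrow> ennreal"
  assumes [measurable]: "f \<in> borel_measurable M"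
  shows "(\<integral>\<^sup>+ x. f x \<partial>M) = (SUP k. \<integral>\<^sup>+ x. min (f x) (of_nat k) \<partial>M)"
proof -
  have "(SUP k. min (f x) (of_nat k)) = f x" for x
  proof -
    have "(SUP k. inf (f x) (of_nat k)) = inf (f x) (SUP k. of_nat k :: ennreal)"
      by (rule inf_SUP[symmetric])
    then show ?thesis by (simp add: ennreal_SUP_of_nat_eq_top inf_min)
  qed
  then have "(\<integral>\<^sup>+ x. f x \<partial>M) = (\<integral>\<^sup>+ x. (SUP k. min (f x) (of_nat k)) \<partial>M)" by simp
  also have "\<dots> = (SUP k. \<integral>\<^sup>+ x. min (f x) (of_nat k) \<partial>M)"
  proof (rule nn_integral_monotone_convergence_SUP)
    show "incseq (\<lambda>k x. min (f x) (of_nat k))"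
      by (auto simp: incseq_def le_fun_def min_def intro: order_trans of_nat_mono)
  qed measurable
  finally show ?thesis .
qed

text \<open>Truncating \<open>f\<close> and \<open>g\<close> preserves the hypothesis, so the bounded case passes to the limit.\<close>

lemma prekopa_leindler_real:
  fixes f g h :: "real \<Rightarrow> ennreal"
  assumes [measurable]: "f \<in> borel_measurable borel" "g \<in> borel_measurable borel" "h \<in> borel_measurable borel"
    and mid: "\<And>x y. f x * g y \<le> (h ((x + y) / 2))\<^sup>2"
  shows "(\<integral>\<^sup>+ x. f x \<partial>lborel) * (\<integral>\<^sup>+ x. g x \<partial>lborel) \<le> (\<integral>\<^sup>+ x. h x \<partial>lborel)\<^sup>2"
proof -
  let ?f = "\<lambda>k x. min (f x) (of_nat k)" and ?g = "\<lambda>k x. min (g x) (of_nat k)"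
  have "(\<integral>\<^sup>+ x. ?f k x \<partial>lborel) * (\<integral>\<^sup>+ x. ?g l x \<partial>lborel) \<le> (\<integral>\<^sup>+ x. h x \<partial>lborel)\<^sup>2" for k l
  proof (rule prekopa_leindler_real_bounded[where K = "real (max k l)"])
    fix x y
    have "?f k x * ?g l y \<le> f x * g y" by (intro mult_mono) auto
    then show "?f k x * ?g l y \<le> (h ((x + y) / 2))\<^sup>2" using mid order_trans by blast
    show "?f k x \<le> ennreal (real (max k l))" "?g l x \<le> ennreal (real (max k l))"
      by (auto simp: ennreal_of_nat_eq_real_of_nat[symmetric] intro!: min.coboundedI2 of_nat_mono)
  qed measurable
  then show ?thesis
    unfolding nn_integral_SUP_truncate[of f lborel, simplified] nn_integral_SUP_truncate[of g lborel, simplified]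
      SUP_mult_right_ennreal SUP_mult_left_ennreal
    by (intro SUP_least)
qed

section \<open>Lebesgue measure on coordinate subspaces\<close>

text \<open>The dimension of a Euclidean space is fixed by its type, so Lebesgue measure on the coordinate
  subspace spanned by \<open>I\<close> is carried as a Borel measure on the whole space. Adjoining one basis vector
  raises the dimension by one, which makes induction on the dimension possible.\<close>

definition coord_lebesgue :: "'a set \<Rightarrow> 'a::euclidean_space measure" where
  "coord_lebesgue I = distr (Pi\<^sub>M I (\<lambda>_. lborel)) borel (\<lambda>f. \<Sum>i\<in>I. f i *\<^sub>R i)"

lemma coord_lebesgue_Basis: "coord_lebesgue Basis = lborel"
  unfolding coord_lebesgue_def by (rule lborel_eq[symmetric])

lemma sets_coord_lebesgue [simp, measurable_cong]: "sets (coord_lebesgue I) = sets borel"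
  by (simp add: coord_lebesgue_def)

lemma space_coord_lebesgue [simp]: "space (coord_lebesgue I) = UNIV"
  by (simp add: coord_lebesgue_def)

lemma measurable_coord_sum [measurable]:
  fixes I :: "'a::euclidean_space set"
  shows "(\<lambda>f. \<Sum>i\<in>I. f i *\<^sub>R i) \<in> borel_measurable (Pi\<^sub>M I (\<lambda>_. lborel))"
proof (rule borel_measurable_sum)
  fix i assume "i \<in> I"
  then have "(\<lambda>f. f i) \<in> borel_measurable (Pi\<^sub>M I (\<lambda>_. lborel))"
    using measurable_component_singleton[of i I "\<lambda>_. lborel :: real measure"] by simp
  then show "(\<lambda>f. f i *\<^sub>R i) \<in> borel_measurable (Pi\<^sub>M I (\<lambda>_. lborel))" by measurable
qed

lemma nn_integral_coord_lebesgue: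
  assumes "g \<in> borel_measurable borel"
  shows "(\<integral>\<^sup>+ x. g x \<partial>coord_lebesgue I) = (\<integral>\<^sup>+ f. g (\<Sum>i\<in>I. f i *\<^sub>R i) \<partial>Pi\<^sub>M I (\<lambda>_. lborel))"
  unfolding coord_lebesgue_def using assms by (intro nn_integral_distr) (auto intro: measurable_coord_sum)

lemma nn_integral_coord_lebesgue_empty:
  assumes "g \<in> borel_measurable borel"
  shows "(\<integral>\<^sup>+ x. g x \<partial>coord_lebesgue {}) = g 0"
  using assms by (subst nn_integral_coord_lebesgue) (auto simp: PiM_empty nn_integral_count_space_finite)

text \<open>The recursion on which all inductions over the dimension rest.\<close>

lemma nn_integral_coord_lebesgue_insert:
  assumes g [measurable]: "g \<in> borel_measurable borel" and I: "finite I" "i \<notin> I"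
  shows "(\<integral>\<^sup>+ x. g x \<partial>coord_lebesgue (insert i I)) = (\<integral>\<^sup>+ t. \<integral>\<^sup>+ x. g (x + t *\<^sub>R i) \<partial>coord_lebesgue I \<partial>lborel)"
proof -
  interpret product_sigma_finite "\<lambda>_::'a. lborel :: real measure" by standard
  have sum: "(\<Sum>j\<in>insert i I. (f(i := t)) j *\<^sub>R j) = (\<Sum>j\<in>I. f j *\<^sub>R j) + t *\<^sub>R i" for f t
  proof -
    have "(\<Sum>j\<in>I. (f(i := t)) j *\<^sub>R j) = (\<Sum>j\<in>I. f j *\<^sub>R j)" using I by (intro sum.cong) auto
    then show ?thesis using I by (simp add: add.commute)
  qed
  have "(\<integral>\<^sup>+ x. g x \<partial>coord_lebesgue (insert i I)) =
      (\<integral>\<^sup>+ t. \<integral>\<^sup>+ f. g (\<Sum>j\<in>insert i I. (f(i := t)) j *\<^sub>R j) \<partial>Pi\<^sub>M I (\<lambda>_. lborel) \<partial>lborel)"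
    unfolding nn_integral_coord_lebesgue[OF g]
    by (rule product_nn_integral_insert_rev[OF I]) (rule measurable_compose[OF measurable_coord_sum g])
  also have "\<dots> = (\<integral>\<^sup>+ t. \<integral>\<^sup>+ x. g (x + t *\<^sub>R i) \<partial>coord_lebesgue I \<partial>lborel)"
    unfolding sum by (intro nn_integral_cong, subst nn_integral_coord_lebesgue) auto
  finally show ?thesis .
qed

lemma emeasure_coord_lebesgue_cball:
  assumes I: "I \<subseteq> Basis" and r: "0 < r"
  shows "emeasure (coord_lebesgue I) (cball 0 r) = ennreal (unit_ball_vol (real (card I)) * r ^ card I)"
proof -
  have fin: "finite I" using I finite_Basis finite_subset by blast
  have norm: "norm (\<Sum>i\<in>I. f i *\<^sub>R i) = sqrt (\<Sum>i\<in>I. (f i)\<^sup>2)" for f :: "'a \<Rightarrow> real"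
  proof -
    have "(\<Sum>i\<in>I. f i *\<^sub>R i) \<bullet> (\<Sum>i\<in>I. f i *\<^sub>R i) = (\<Sum>i\<in>I. \<Sum>j\<in>I. if i = j then f i * f j else 0)"
      unfolding inner_sum_left inner_sum_right
      using I by (intro sum.cong refl) (auto simp: inner_Basis subset_eq)
    also have "\<dots> = (\<Sum>i\<in>I. (f i)\<^sup>2)" using fin by (simp add: power2_eq_square)
    finally show ?thesis by (simp add: norm_eq_sqrt_inner)
  qed
  have "emeasure (coord_lebesgue I) (cball 0 r) =
      emeasure (Pi\<^sub>M I (\<lambda>_. lborel)) ({f. sqrt (\<Sum>i\<in>I. (f i)\<^sup>2) \<le> r} \<inter> space (Pi\<^sub>M I (\<lambda>_. lborel)))"
    unfolding coord_lebesgue_def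
    by (subst emeasure_distr) (auto simp: norm intro!: arg_cong2[where f=emeasure] measurable_coord_sum)
  also have "\<dots> = ennreal (unit_ball_vol (real (card I)) * r ^ card I)"
    using fin r by (rule emeasure_cball_aux)
  finally show ?thesis .
qed

lemma emeasure_coord_lebesgue_ball:
  assumes I: "I \<subseteq> Basis" and r: "0 < r"
  shows "emeasure (coord_lebesgue I) (ball 0 r) = ennreal (unit_ball_vol (real (card I)) * r ^ card I)"
proof (rule antisym)
  show "emeasure (coord_lebesgue I) (ball 0 r) \<le> ennreal (unit_ball_vol (real (card I)) * r ^ card I)"
    unfolding emeasure_coord_lebesgue_cball[OF assms, symmetric] by (intro emeasure_mono) auto
  have "(\<lambda>k. ennreal (unit_ball_vol (real (card I)) * (r * (1 - inverse (real (Suc (Suc k))))) ^ card I)) \<longlonglongrightarrow>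
      ennreal (unit_ball_vol (real (card I)) * (r * (1 - 0)) ^ card I)"
    by (intro tendsto_ennrealI tendsto_intros LIMSEQ_Suc[OF LIMSEQ_inverse_real_of_nat])
  moreover have "ennreal (unit_ball_vol (real (card I)) * (r * (1 - inverse (real (Suc (Suc k))))) ^ card I) \<le>
      emeasure (coord_lebesgue I) (ball 0 r)" for k
  proof -
    have "inverse (real (Suc (Suc k))) < 1" "0 < inverse (real (Suc (Suc k)))"
      by (auto simp: field_simps)
    then have "0 < r * (1 - inverse (real (Suc (Suc k))))" "r * (1 - inverse (real (Suc (Suc k)))) < r"
      using r by auto
    then show ?thesis
      by (subst emeasure_coord_lebesgue_cball[OF I, symmetric]) (auto intro!: emeasure_mono)
  qed
  ultimately show "ennreal (unit_ball_vol (real (card I)) * r ^ card I) \<le> emeasure (coord_lebesgue I) (ball 0 r)"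
    by (intro LIMSEQ_le_const2) auto
qed

lemma sigma_finite_coord_lebesgue:
  assumes "I \<subseteq> Basis"
  shows "sigma_finite_measure (coord_lebesgue I)"
proof
  show "\<exists>A. countable A \<and> A \<subseteq> sets (coord_lebesgue I) \<and> \<Union> A = space (coord_lebesgue I) \<and>
      (\<forall>a\<in>A. emeasure (coord_lebesgue I) a \<noteq> \<infinity>)"
  proof (intro exI[of _ "range (\<lambda>k. cball 0 (real (Suc k)))"] conjI)
    have "\<exists>k. norm x \<le> real (Suc k)" for x :: 'a
      using real_arch_simple[of "norm x"] by (metis of_nat_Suc add_increasing zero_le_one)
    then show "\<Union> (range (\<lambda>k. cball 0 (real (Suc k)))) = space (coord_lebesgue I)" by auto
  qed (use assms in \<open>auto simp: emeasure_coord_lebesgue_cball simp del: of_nat_Suc\<close>)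
qed

lemma measurable_coord_lebesgue_slice:
  assumes [measurable]: "g \<in> borel_measurable borel" and I: "I \<subseteq> Basis"
  shows "(\<lambda>t. \<integral>\<^sup>+ x. g (x + t *\<^sub>R i) \<partial>coord_lebesgue I) \<in> borel_measurable borel"
proof -
  interpret sigma_finite_measure "coord_lebesgue I" by (rule sigma_finite_coord_lebesgue[OF I])
  show ?thesis by measurable
qed

text \<open>One induction for translations and for the reflection in the origin, the cases \<open>e = 1\<close> and \<open>e = -1\<close>.\<close>

lemma nn_integral_coord_lebesgue_affine:
  assumes "finite I" "I \<subseteq> Basis" "g \<in> borel_measurable borel" and e: "\<bar>e\<bar> = 1"
  shows "(\<integral>\<^sup>+ x. g (e *\<^sub>R x + (\<Sum>i\<in>I. c i *\<^sub>R i)) \<partial>coord_lebesgue I) = (\<integral>\<^sup>+ x. g x \<partial>coord_lebesgue I)"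
  using assms(1-3)
proof (induction I arbitrary: g)
  case empty
  then show ?case by (simp add: nn_integral_coord_lebesgue_empty)
next
  case (insert i I)
  note [measurable] = insert.prems(2)
  let ?s = "\<lambda>t. \<integral>\<^sup>+ x. g (x + t *\<^sub>R i) \<partial>coord_lebesgue I"
  let ?c = "\<Sum>i\<in>insert i I. c i *\<^sub>R i"
  have "(\<integral>\<^sup>+ x. g (e *\<^sub>R x + ?c) \<partial>coord_lebesgue (insert i I)) =
      (\<integral>\<^sup>+ t. \<integral>\<^sup>+ x. g (e *\<^sub>R (x + t *\<^sub>R i) + ?c) \<partial>coord_lebesgue I \<partial>lborel)"
    by (rule nn_integral_coord_lebesgue_insert) (use insert in auto)
  also have "\<dots> = (\<integral>\<^sup>+ t. ?s (c i + e * t) \<partial>lborel)"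
  proof (rule nn_integral_cong)
    fix t :: real
    have "(\<integral>\<^sup>+ x. g (e *\<^sub>R (x + t *\<^sub>R i) + ?c) \<partial>coord_lebesgue I) =
      (\<integral>\<^sup>+ x. g ((e *\<^sub>R x + (\<Sum>i\<in>I. c i *\<^sub>R i)) + (c i + e * t) *\<^sub>R i) \<partial>coord_lebesgue I)"
      using insert.hyps by (intro nn_integral_cong arg_cong[of _ _ g]) (simp add: scaleR_add_left scaleR_add_right add_ac)
    also have "\<dots> = ?s (c i + e * t)" using insert.prems(1) by (intro insert.IH) auto
    finally show "(\<integral>\<^sup>+ x. g (e *\<^sub>R (x + t *\<^sub>R i) + ?c) \<partial>coord_lebesgue I) = ?s (c i + e * t)" .
  qed
  also have "\<dots> = (\<integral>\<^sup>+ t. ?s t \<partial>lborel)"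
    using nn_integral_real_affine[of ?s e "c i"] measurable_coord_lebesgue_slice[of g I i] insert.prems e by auto
  also have "\<dots> = (\<integral>\<^sup>+ x. g x \<partial>coord_lebesgue (insert i I))"
    by (rule nn_integral_coord_lebesgue_insert[symmetric]) (use insert in auto)
  finally show ?case .
qed

lemma nn_integral_coord_lebesgue_uminus:
  assumes "finite I" "I \<subseteq> Basis" "g \<in> borel_measurable borel"
  shows "(\<integral>\<^sup>+ x. g (- x) \<partial>coord_lebesgue I) = (\<integral>\<^sup>+ x. g x \<partial>coord_lebesgue I)"
  using nn_integral_coord_lebesgue_affine[OF assms, of "-1" "\<lambda>_. 0"] by simp

lemma nn_integral_coord_lebesgue_translation:
  assumes "finite I" "I \<subseteq> Basis" "g \<in> borel_measurable borel"
  shows "(\<integral>\<^sup>+ x. g (x + (\<Sum>i\<in>I. c i *\<^sub>R i)) \<partial>coord_lebesgue I) = (\<integral>\<^sup>+ x. g x \<partial>coord_lebesgue I)"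
  using nn_integral_coord_lebesgue_affine[OF assms, of 1 c] by simp

text \<open>For fixed last coordinates \<open>s\<close> and \<open>t\<close> the slices of \<open>f\<close>, \<open>g\<close> and \<open>h\<close> satisfy the hypothesis one
  dimension lower. The induction hypothesis says that the slice integrals, as functions of the last
  coordinate, again satisfy it.\<close>

lemma prekopa_leindler_coord:
  fixes f g h :: "'a::euclidean_space \<Rightarrow> ennreal"
  assumes "finite I" "I \<subseteq> Basis"
    and "f \<in> borel_measurable borel" "g \<in> borel_measurable borel" "h \<in> borel_measurable borel"
    and "\<And>x y. f x * g y \<le> (h ((x + y) /\<^sub>R 2))\<^sup>2"
  shows "(\<integral>\<^sup>+ x. f x \<partial>coord_lebesgue I) * (\<integral>\<^sup>+ x. g x \<partial>coord_lebesgue I) \<le> (\<integral>\<^sup>+ x. h x \<partial>coord_lebesgue I)\<^sup>2"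
  using assms
proof (induction I arbitrary: f g h)
  case empty
  then show ?case using empty.prems(5)[of 0 0] by (simp add: nn_integral_coord_lebesgue_empty)
next
  case (insert i I)
  note [measurable] = insert.prems(2-4)
  let ?s = "\<lambda>f t. \<integral>\<^sup>+ x. f (x + t *\<^sub>R i) \<partial>coord_lebesgue I"
  have slices: "(\<integral>\<^sup>+ x. k x \<partial>coord_lebesgue (insert i I)) = (\<integral>\<^sup>+ t. ?s k t \<partial>lborel)"
    if "k \<in> borel_measurable borel" for k
    using that insert by (intro nn_integral_coord_lebesgue_insert) auto
  show ?case
    unfolding slices[OF insert.prems(2)] slices[OF insert.prems(3)] slices[OF insert.prems(4)]
  proof (rule prekopa_leindler_real)
    fix s t :: real
    show "?s f s * ?s g t \<le> (?s h ((s + t) / 2))\<^sup>2"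
    proof (rule insert.IH)
      fix x y :: 'a
      have "(x + s *\<^sub>R i + (y + t *\<^sub>R i)) /\<^sub>R 2 = (x + y) /\<^sub>R 2 + ((s + t) / 2) *\<^sub>R i"
        by (simp add: scaleR_add_left scaleR_add_right add_divide_distrib add_ac)
      then show "f (x + s *\<^sub>R i) * g (y + t *\<^sub>R i) \<le> (h ((x + y) /\<^sub>R 2 + ((s + t) / 2) *\<^sub>R i))\<^sup>2"
        using insert.prems(5)[of "x + s *\<^sub>R i" "y + t *\<^sub>R i"] by simp
    qed (use insert in auto)
  qed (use insert in \<open>auto intro!: measurable_coord_lebesgue_slice\<close>)
qed

text \<open>The set of half differences of points of \<open>A\<close> is symmetric, lies in the ball whose radius is half
  the diameter of \<open>A\<close>, and by the Prekopa-Leindler inequality for \<open>A\<close> and \<open>-A\<close> is at least as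
  large as \<open>A\<close>.\<close>

theorem isodiametric_inequality:
  fixes A :: "'a::euclidean_space set"
  assumes A: "compact A" "A \<noteq> {}" and I: "I \<subseteq> Basis"
  shows "emeasure (coord_lebesgue I) A \<le> ennreal (unit_ball_vol (real (card I)) * (diameter A / 2) ^ card I)"
proof -
  have fin: "finite I" using I finite_Basis finite_subset by blast
  define D where "D = (\<lambda>p. (fst p - snd p) /\<^sub>R 2) ` (A \<times> A)"
  have "compact D" unfolding D_def using A
    by (intro compact_continuous_image compact_Times continuous_intros)
  have Ab [measurable]: "A \<in> sets borel" and Db [measurable]: "D \<in> sets borel"
    using A \<open>compact D\<close> by (auto intro: borel_compact)
  have "(\<integral>\<^sup>+ x. indicator A x \<partial>coord_lebesgue I) * (\<integral>\<^sup>+ x. indicator A (- x) \<partial>coord_lebesgue I) \<le> (\<integral>\<^sup>+ x. indicator D x \<partial>coord_lebesgue I)\<^sup>2"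
  proof (rule prekopa_leindler_coord[OF fin I])
    fix x y
    have "(x + y) /\<^sub>R 2 \<in> D" if "x \<in> A" "- y \<in> A"
      unfolding D_def using that by (intro image_eqI[of _ _ "(x, - y)"]) auto
    then show "indicator A x * indicator A (- y) \<le> (indicator D ((x + y) /\<^sub>R 2) :: ennreal)\<^sup>2"
      by (auto simp: indicator_def)
  qed measurable
  then have "(emeasure (coord_lebesgue I) A)\<^sup>2 \<le> (emeasure (coord_lebesgue I) D)\<^sup>2"
    by (subst (asm) nn_integral_coord_lebesgue_uminus[OF fin I]) (auto simp: power2_eq_square)
  then have AD: "emeasure (coord_lebesgue I) A \<le> emeasure (coord_lebesgue I) D"
    by (rule ennreal_power2_le_imp_le)
  have bound: "emeasure (coord_lebesgue I) D \<le> ennreal (unit_ball_vol (real (card I)) * (diameter A / 2 + e) ^ card I)"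
    if e: "0 < e" for e
  proof -
    have d0: "0 \<le> diameter A" using A by (intro diameter_ge_0 compact_imp_bounded)
    have "D \<subseteq> cball 0 (diameter A / 2 + e)"

    proof
      fix z assume "z \<in> D"
      then obtain x y where xy: "x \<in> A" "y \<in> A" "z = (x - y) /\<^sub>R 2" by (auto simp: D_def)
      then have "norm (x - y) \<le> diameter A"
        using diameter_bounded_bound[OF compact_imp_bounded[OF A(1)]] by (auto simp: dist_norm)
      then show "z \<in> cball 0 (diameter A / 2 + e)" using e xy(3) by simp
    qed
    then have "emeasure (coord_lebesgue I) D \<le> emeasure (coord_lebesgue I) (cball 0 (diameter A / 2 + e))"
      by (intro emeasure_mono) auto
    also have "\<dots> = ennreal (unit_ball_vol (real (card I)) * (diameter A / 2 + e) ^ card I)"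
      using I d0 e by (intro emeasure_coord_lebesgue_cball) auto
    finally show ?thesis .
  qed
  have "(\<lambda>k. ennreal (unit_ball_vol (real (card I)) * (diameter A / 2 + inverse (real (Suc k))) ^ card I)) \<longlonglongrightarrow>
      ennreal (unit_ball_vol (real (card I)) * (diameter A / 2 + 0) ^ card I)"
    by (intro tendsto_ennrealI tendsto_intros LIMSEQ_inverse_real_of_nat)
  then have "emeasure (coord_lebesgue I) D \<le> ennreal (unit_ball_vol (real (card I)) * (diameter A / 2 + 0) ^ card I)"
    by (rule LIMSEQ_le_const) (use bound in auto)
  with AD show ?thesis by simp
qed

section \<open>Hausdorff measure of discs in a coordinate hyperplane\<close>

lemma card_Basis_minus: "b \<in> Basis \<Longrightarrow> card (Basis - {b :: 'a::euclidean_space}) = DIM('a) - 1"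
  by (simp add: card_Diff_singleton)

lemma nn_integral_lborel_slices:
  fixes b :: "'a::euclidean_space"
  assumes "b \<in> Basis" "g \<in> borel_measurable borel"
  shows "(\<integral>\<^sup>+ x. g x \<partial>lborel) = (\<integral>\<^sup>+ t. \<integral>\<^sup>+ x. g (x + t *\<^sub>R b) \<partial>coord_lebesgue (Basis - {b}) \<partial>lborel)"
  using nn_integral_coord_lebesgue_insert[of g "Basis - {b}" b] assms
  by (simp add: insert_absorb coord_lebesgue_Basis)

lemma AE_coord_lebesgue_orthogonal:
  fixes b :: "'a::euclidean_space"
  assumes b: "b \<in> Basis"
  shows "AE x in coord_lebesgue (Basis - {b}). x \<bullet> b = 0"
proof -
  have "(\<Sum>i\<in>Basis - {b}. f i *\<^sub>R i) \<bullet> b = 0" for f :: "'a \<Rightarrow> real"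
    using b by (auto simp: inner_sum_left inner_Basis intro!: sum.neutral)
  then show ?thesis
    unfolding coord_lebesgue_def by (subst AE_distr_iff) (auto intro: measurable_coord_sum)
qed

text \<open>The covering families produced by the Vitali theorems are countable sets, possibly finite, and not
  sequences.\<close>

lemma hausdorff_pre_le_countable:
  fixes U :: "'i \<Rightarrow> 'a::metric_space set"
  assumes C: "countable C" and U: "A \<subseteq> (\<Union>i\<in>C. U i)" "\<And>i. i \<in> C \<Longrightarrow> bounded (U i)"
    "\<And>i. i \<in> C \<Longrightarrow> diameter (U i) \<le> \<delta>" and \<delta>: "0 \<le> \<delta>"
  shows "hausdorff_pre m \<delta> A \<le> (\<integral>\<^sup>+ i. hausdorff_gauge m (U i) \<partial>count_space C)"
proof -
  let ?e = "to_nat_on C"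
  define W where "W n = (if n \<in> ?e ` C then U (from_nat_into C n) else {})" for n
  have WU: "W (?e i) = U i" if "i \<in> C" for i using that C by (simp add: W_def)
  have W: "bounded (W n) \<and> diameter (W n) \<le> \<delta>" for n
  proof (cases "n \<in> ?e ` C")
    case True
    then have "from_nat_into C n \<in> C" by (intro from_nat_into) auto
    then show ?thesis using True U(2,3) by (simp add: W_def)
  qed (simp add: W_def \<delta>)
  have "A \<subseteq> (\<Union>n. W n)"
    using U(1) WU by blast
  then have "hausdorff_pre m \<delta> A \<le> (\<Sum>n. hausdorff_gauge m (W n))"
    using W by (intro hausdorff_pre_le) auto
  also have "\<dots> = (\<integral>\<^sup>+ n. hausdorff_gauge m (W n) \<partial>count_space UNIV)"
    by (rule nn_integral_count_space_nat[symmetric])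
  also have "\<dots> = (\<integral>\<^sup>+ n. hausdorff_gauge m (W n) \<partial>count_space (?e ` C))"
    by (rule nn_integral_count_space_eq) (auto simp: W_def)
  also have "\<dots> = (\<integral>\<^sup>+ i. hausdorff_gauge m (W (?e i)) \<partial>count_space C)"
    by (rule nn_integral_bij_count_space[symmetric]) (simp add: bij_betw_def inj_on_to_nat_on[OF C])
  also have "\<dots> = (\<integral>\<^sup>+ i. hausdorff_gauge m (U i) \<partial>count_space C)"
    by (intro nn_integral_cong) (simp add: WU)
  finally show ?thesis .
qed

lemma inner_Basis_self: "b \<in> Basis \<Longrightarrow> b \<bullet> b = (1::real)"
  by (simp add: inner_Basis)

lemma hausdorff_gauge_le:
  fixes U :: "'a::metric_space set"
  assumes "bounded U" "diameter U \<le> 2 * s"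
  shows "hausdorff_gauge m U \<le> ennreal (unit_ball_vol (real m) * s ^ m)"
  using assms diameter_ge_0[of U]
  by (auto simp: hausdorff_gauge_def intro!: ennreal_leI mult_left_mono power_mono)

lemma norm_split:
  fixes b :: "'a::real_inner"
  assumes "norm b = 1" "p \<bullet> b = 0"
  shows "(norm (p + t *\<^sub>R b))\<^sup>2 = (norm p)\<^sup>2 + t\<^sup>2"
  using norm_add_Pythagorean[of p "t *\<^sub>R b"] assms by (simp add: orthogonal_def)

text \<open>By Pythagoras, the slice of a ball at height \<open>t\<close> is a disc. It is empty if the radicand is not
  positive, and then \<open>sqrt\<close> returns a radius that is not positive either.\<close>

lemma slice_ball:
  fixes b :: "'a::real_inner"
  assumes b: "norm b = 1" and x: "x \<bullet> b = 0" and \<rho>: "0 < \<rho>"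
  shows "x + t *\<^sub>R b \<in> ball a \<rho> \<longleftrightarrow> x \<in> ball (a - (a \<bullet> b) *\<^sub>R b) (sqrt (\<rho>\<^sup>2 - (t - a \<bullet> b)\<^sup>2))"
proof -
  let ?p = "a - (a \<bullet> b) *\<^sub>R b"
  have "(?p - x) \<bullet> b = 0" using x b by (simp add: inner_diff_left norm_eq_1)
  moreover have "a - (x + t *\<^sub>R b) = (?p - x) + (a \<bullet> b - t) *\<^sub>R b" by (simp add: algebra_simps)
  ultimately have pyth: "(dist a (x + t *\<^sub>R b))\<^sup>2 = (dist ?p x)\<^sup>2 + (t - a \<bullet> b)\<^sup>2"
    using norm_split[OF b, of "?p - x" "a \<bullet> b - t"] by (simp only: dist_norm power2_commute[of t])
  have "dist a (x + t *\<^sub>R b) < \<rho> \<longleftrightarrow> (dist a (x + t *\<^sub>R b))\<^sup>2 < \<rho>\<^sup>2"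
    using \<rho> abs_le_square_iff[of \<rho> "dist a (x + t *\<^sub>R b)"] by (simp add: not_le[symmetric])
  also have "\<dots> \<longleftrightarrow> sqrt ((dist ?p x)\<^sup>2) < sqrt (\<rho>\<^sup>2 - (t - a \<bullet> b)\<^sup>2)"
    unfolding pyth real_sqrt_less_iff by linarith
  finally show ?thesis by simp
qed

text \<open>Cover the cylinder of height one over the null set \<open>E\<close> by enlarged disjoint balls of small total
  volume. Each of its horizontal slices is a copy of \<open>E\<close> covered by slices of the balls, and a ball of
  radius \<open>\<rho>\<close> only meets slices within height \<open>\<rho>\<close> of its centre, so the gauge sums, averaged over the
  height, are bounded by a multiple of the total volume.\<close>

lemma hausdorff_pre_null:
  fixes b :: "'a::euclidean_space"
  assumes b: "b \<in> Basis" and [measurable]: "E \<in> sets borel" and E: "\<And>x. x \<in> E \<Longrightarrow> x \<bullet> b = 0"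
    and null: "emeasure (coord_lebesgue (Basis - {b})) E = 0" and \<delta>: "0 < \<delta>"
  shows "hausdorff_pre (DIM('a) - 1) \<delta> E = 0"
proof (cases "E = {}")
  case True then show ?thesis using \<delta> by simp
next
  case False
  define m where "m = DIM('a) - 1"
  have n: "DIM('a) = Suc m" using DIM_positive[where 'a='a] by (simp add: m_def del: DIM_positive)
  have bb: "b \<bullet> b = 1" using b by (simp add: inner_Basis_self)
  let ?L = "coord_lebesgue (Basis - {b})"
  define cyl where "cyl = {x. 0 < x \<bullet> b \<and> x \<bullet> b < 1 \<and> x - (x \<bullet> b) *\<^sub>R b \<in> E}"
  have [measurable]: "cyl \<in> sets borel" unfolding cyl_def by measurable
  have "emeasure lborel cyl = (\<integral>\<^sup>+ t. \<integral>\<^sup>+ x. indicator cyl (x + t *\<^sub>R b) \<partial>?L \<partial>lborel)"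
    using nn_integral_lborel_slices[OF b, of "indicator cyl"] by simp
  also have "\<dots> = (\<integral>\<^sup>+ t. 0 \<partial>(lborel :: real measure))"
  proof (rule nn_integral_cong)
    fix t :: real
    have "(\<integral>\<^sup>+ x. indicator cyl (x + t *\<^sub>R b) \<partial>?L) \<le> (\<integral>\<^sup>+ x. indicator E x \<partial>?L)"
    proof (rule nn_integral_mono_AE)
      show "AE x in ?L. indicator cyl (x + t *\<^sub>R b) \<le> (indicator E x :: ennreal)"
        using AE_coord_lebesgue_orthogonal[OF b]
        by eventually_elim (auto simp: cyl_def indicator_def inner_add_left bb)
    qed
    then show "(\<integral>\<^sup>+ x. indicator cyl (x + t *\<^sub>R b) \<partial>?L) = 0" using null by simp
  qed
  finally have cyl0: "emeasure lborel cyl = 0" by simp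
  \<comment> \<open>The gauge of a slice of a ball enlarged to radius \<open>5 \<rho>\<close>, times the range \<open>10 \<rho>\<close> of heights at which
    it is met, is \<open>c\<close> times the volume of the ball of radius \<open>\<rho>\<close>.\<close>
  define c where "c = 10 * 5 ^ m * unit_ball_vol (real m) / unit_ball_vol (real (Suc m))"
  have c: "0 < c" by (simp add: c_def)
  have bound: "hausdorff_pre m \<delta> E \<le> ennreal c * ennreal e" if e: "0 < e" for e
  proof -
    obtain G where G: "open G" "cyl \<subseteq> G" "emeasure lborel (G - cyl) < ennreal e"
      using outer_regular_lborel[of cyl e] e by auto
    have [measurable]: "G \<in> sets borel" using G by simp
    have "emeasure lborel G \<le> emeasure lborel cyl + emeasure lborel (G - cyl)"
      using emeasure_subadditive[of cyl lborel "G - cyl"] G(2) by (simp add: Un_absorb1)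
    then have Ge: "emeasure lborel G \<le> ennreal e" using cyl0 G(3) by simp
    \<comment> \<open>Five-fold enlarged balls must still have diameter at most \<open>\<delta>\<close>.\<close>
    define K where "K = {(a, \<rho>). 0 < \<rho> \<and> \<rho> \<le> \<delta> / 10 \<and> ball a \<rho> \<subseteq> G}"
    have K_bound: "0 < snd i \<and> snd i \<le> \<delta> / 10" if "i \<in> K" for i using that by (auto simp: K_def)
    have "cyl \<subseteq> (\<Union>i\<in>K. ball (fst i) (snd i))"
    proof
      fix x assume "x \<in> cyl"
      then obtain \<rho> where "0 < \<rho>" "ball x \<rho> \<subseteq> G" using G(1,2) by (meson openE subsetD)
      then have "(x, min \<rho> (\<delta> / 10)) \<in> K" using \<delta> by (auto simp: K_def)
      then show "x \<in> (\<Union>i\<in>K. ball (fst i) (snd i))"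
        using \<open>0 < \<rho>\<close> \<delta> by (intro UN_I[of "(x, min \<rho> (\<delta> / 10))"]) auto
    qed
    then obtain C where C: "countable C" "C \<subseteq> K"
      "pairwise (\<lambda>i j. disjnt (ball (fst i) (snd i)) (ball (fst j) (snd j))) C"
      "cyl \<subseteq> (\<Union>i\<in>C. ball (fst i) (5 * snd i))"
      using Vitali_covering_lemma_balls[of cyl fst snd K "\<delta> / 10"] K_bound by blast
    have \<rho>: "0 < snd i" "snd i \<le> \<delta> / 10" "ball (fst i) (snd i) \<subseteq> G" if "i \<in> C" for i
      using subsetD[OF C(2) that] unfolding K_def by (cases i; auto)+
    define \<phi> where "\<phi> t i = ennreal (unit_ball_vol (real m) * (5 * snd i) ^ m) * indicator {fst i \<bullet> b - 5 * snd i <..< fst i \<bullet> b + 5 * snd i} t"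
      for t :: real and i :: "'a \<times> real"
    have slice: "hausdorff_pre m \<delta> E \<le> (\<integral>\<^sup>+ i. \<phi> t i \<partial>count_space C)" if t: "0 < t" "t < 1" for t
    proof -
      define U where "U i = {x. x \<bullet> b = 0 \<and> x + t *\<^sub>R b \<in> ball (fst i) (5 * snd i)}" for i :: "'a \<times> real"
      have dist_U: "dist x y \<le> 2 * (5 * snd i)" if "x \<in> U i" "y \<in> U i" for x y i
      proof -
        have "dist x y = dist (x + t *\<^sub>R b) (y + t *\<^sub>R b)" by simp
        also have "\<dots> \<le> dist (fst i) (x + t *\<^sub>R b) + dist (fst i) (y + t *\<^sub>R b)"
          by (rule dist_triangle3)
        also have "\<dots> \<le> 2 * (5 * snd i)" using that unfolding U_def by auto
        finally show ?thesis .
      qed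
      have bd: "bounded (U i)" for i using dist_U unfolding bounded_two_points by blast
      have diam: "diameter (U i) \<le> 2 * (5 * snd i)" if "i \<in> C" for i
        using \<rho>(1)[OF that] dist_U[of _ i] by (intro diameter_le) (auto simp: dist_norm)
      have "hausdorff_pre m \<delta> E \<le> (\<integral>\<^sup>+ i. hausdorff_gauge m (U i) \<partial>count_space C)"
      proof (rule hausdorff_pre_le_countable[OF C(1)])
        show "E \<subseteq> (\<Union>i\<in>C. U i)"
        proof
          fix x assume x: "x \<in> E"
          then have "x + t *\<^sub>R b \<in> cyl" using E[OF x] t by (simp add: cyl_def inner_add_left bb)
          then show "x \<in> (\<Union>i\<in>C. U i)" using C(4) E[OF x] unfolding U_def by blast
        qed
        show "diameter (U i) \<le> \<delta>" if "i \<in> C" for i using diam[OF that] \<rho>(2)[OF that] by simp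
      qed (use bd \<delta> in auto)
      also have "\<dots> \<le> (\<integral>\<^sup>+ i. \<phi> t i \<partial>count_space C)"
      proof (rule nn_integral_mono)
        fix i assume "i \<in> space (count_space C)"
        then have i: "i \<in> C" by simp
        show "hausdorff_gauge m (U i) \<le> \<phi> t i"
        proof (cases "U i = {}")
          case False
          then obtain x where x: "x \<bullet> b = 0" "dist (fst i) (x + t *\<^sub>R b) < 5 * snd i" by (auto simp: U_def)
          have "\<bar>(fst i - (x + t *\<^sub>R b)) \<bullet> b\<bar> \<le> norm (fst i - (x + t *\<^sub>R b))"
            using b by (rule Basis_le_norm)
          then have "\<bar>fst i \<bullet> b - t\<bar> < 5 * snd i"
            using x by (simp add: dist_norm inner_diff_left inner_add_left bb)
          then have "t \<in> {fst i \<bullet> b - 5 * snd i <..< fst i \<bullet> b + 5 * snd i}"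
            unfolding greaterThanLessThan_iff by linarith
          then show ?thesis unfolding \<phi>_def using hausdorff_gauge_le[OF bd diam[OF i], of m]
            by (simp only: indicator_simps mult_1_right)
        qed simp
      qed
      finally show ?thesis .
    qed
    have volume: "(\<integral>\<^sup>+ i. emeasure lborel (ball (fst i) (snd i)) \<partial>count_space C) \<le> ennreal e"
    proof -
      have "(\<integral>\<^sup>+ i. emeasure lborel (ball (fst i) (snd i)) \<partial>count_space C) = emeasure lborel (\<Union>i\<in>C. ball (fst i) (snd i))"
      proof (rule emeasure_UN_countable[symmetric])
        show "disjoint_family_on (\<lambda>i. ball (fst i) (snd i)) C"
          using C(3) unfolding disjoint_family_on_def pairwise_def disjnt_def by blast
      qed (use C(1) in auto)
      also have "\<dots> \<le> emeasure lborel G" using \<rho>(3) by (intro emeasure_mono) auto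
      also have "\<dots> \<le> ennreal e" by (rule Ge)
      finally show ?thesis .
    qed
    interpret cs: sigma_finite_measure "count_space C" by (rule sigma_finite_measure_count_space_countable[OF C(1)])
    interpret P: pair_sigma_finite "count_space C" "lborel :: real measure"
      by (rule pair_sigma_finite.intro[OF cs.sigma_finite_measure_axioms sigma_finite_lborel])
    have "hausdorff_pre m \<delta> E = (\<integral>\<^sup>+ t. hausdorff_pre m \<delta> E * indicator {0<..<1::real} t \<partial>lborel)"
      by (simp add: nn_integral_cmult_indicator)
    also have "\<dots> \<le> (\<integral>\<^sup>+ t. \<integral>\<^sup>+ i. \<phi> t i \<partial>count_space C \<partial>lborel)"
      using slice by (intro nn_integral_mono) (auto simp: indicator_def)
    also have "\<dots> = (\<integral>\<^sup>+ i. \<integral>\<^sup>+ t. \<phi> t i \<partial>lborel \<partial>count_space C)"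
    proof (rule P.Fubini')
      show "(\<lambda>(x, y). \<phi> y x) \<in> borel_measurable (count_space C \<Otimes>\<^sub>M lborel)"
        by (rule measurable_pair_measure_countable1[OF C(1)]) (simp add: \<phi>_def)
    qed
    also have "\<dots> = (\<integral>\<^sup>+ i. ennreal c * emeasure lborel (ball (fst i) (snd i)) \<partial>count_space C)"
    proof (rule nn_integral_cong)
      fix i assume "i \<in> space (count_space C)"
      then have i: "i \<in> C" by simp
      have "(\<integral>\<^sup>+ t. \<phi> t i \<partial>lborel) = ennreal (unit_ball_vol (real m) * (5 * snd i) ^ m) * ennreal (10 * snd i)"
        unfolding \<phi>_def using \<rho>(1)[OF i] by (subst nn_integral_cmult_indicator) auto
      also have "\<dots> = ennreal (c * (unit_ball_vol (real (Suc m)) * snd i ^ Suc m))"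
      proof -
        have "unit_ball_vol (real (Suc m)) \<noteq> 0" using unit_ball_vol_pos[of "real (Suc m)"] by linarith
        then have "unit_ball_vol (real m) * (5 * snd i) ^ m * (10 * snd i) = c * (unit_ball_vol (real (Suc m)) * snd i ^ Suc m)"
          by (simp add: c_def power_mult_distrib del: of_nat_Suc)
        moreover have "ennreal (unit_ball_vol (real m) * (5 * snd i) ^ m) * ennreal (10 * snd i) =
            ennreal (unit_ball_vol (real m) * (5 * snd i) ^ m * (10 * snd i))"
          using \<rho>(1)[OF i] by (intro ennreal_mult[symmetric]) auto
        ultimately show ?thesis by (simp only:)
      qed
      also have "\<dots> = ennreal c * emeasure lborel (ball (fst i) (snd i))"
        using \<rho>(1)[OF i] c by (simp add: emeasure_ball n ennreal_mult)
      finally show "(\<integral>\<^sup>+ t. \<phi> t i \<partial>lborel) = ennreal c * emeasure lborel (ball (fst i) (snd i))" .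
    qed
    also have "\<dots> = ennreal c * (\<integral>\<^sup>+ i. emeasure lborel (ball (fst i) (snd i)) \<partial>count_space C)"
      by (rule nn_integral_cmult) simp
    also have "\<dots> \<le> ennreal c * ennreal e" by (intro mult_left_mono volume) simp
    finally show ?thesis .
  qed
  have small: "hausdorff_pre m \<delta> E \<le> ennreal e" if "0 < e" for e
  proof -
    have "hausdorff_pre m \<delta> E \<le> ennreal c * ennreal (e / c)" using that c by (intro bound) simp
    also have "\<dots> = ennreal e" using c that by (simp add: ennreal_mult[symmetric])
    finally show ?thesis .
  qed
  have "hausdorff_pre m \<delta> E \<le> 0" by (rule ennreal_le_epsilon) (simp add: small)
  then show ?thesis by (simp add: m_def)
qed

text \<open>The isodiametric inequality says that no cover is cheaper than Lebesgue measure.\<close>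

lemma coord_lebesgue_le_hausdorff_outer:
  fixes A :: "'a::euclidean_space set"
  assumes I: "I \<subseteq> Basis"
  shows "emeasure (coord_lebesgue I) A \<le> hausdorff_outer (card I) A"
proof -
  have "emeasure (coord_lebesgue I) A \<le> hausdorff_pre (card I) 1 A"
  proof (rule hausdorff_pre_greatest)
    fix U :: "nat \<Rightarrow> 'a set"
    assume U: "A \<subseteq> (\<Union>i. U i)" "\<And>i. bounded (U i)"
    have "emeasure (coord_lebesgue I) A \<le> emeasure (coord_lebesgue I) (\<Union>i. closure (U i))"
    proof (rule emeasure_mono)
      have "(\<Union>i. U i) \<subseteq> (\<Union>i. closure (U i))" by (intro UN_mono closure_subset) simp
      then show "A \<subseteq> (\<Union>i. closure (U i))" using U(1) by (rule order_trans[rotated])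
    qed (auto intro!: sets.countable_UN)
    also have "\<dots> \<le> (\<Sum>i. emeasure (coord_lebesgue I) (closure (U i)))"
      by (intro emeasure_subadditive_countably) auto
    also have "\<dots> \<le> (\<Sum>i. hausdorff_gauge (card I) (U i))"
    proof (rule suminf_le)
      fix i
      show "emeasure (coord_lebesgue I) (closure (U i)) \<le> hausdorff_gauge (card I) (U i)"
      proof (cases "U i = {}")
        case False
        then show ?thesis
          using isodiametric_inequality[of "closure (U i)" I] U(2)[of i] I
          by (simp add: hausdorff_gauge_def diameter_closure compact_closure)
      qed simp
    qed auto
    finally show "emeasure (coord_lebesgue I) A \<le> (\<Sum>i. hausdorff_gauge (card I) (U i))" .
  qed
  then show ?thesis using hausdorff_pre_le_outer[of 1 "card I" A] by (simp add: order_trans)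
qed

text \<open>Fill the open cylinder of height one over the disc with disjoint small balls up to a Lebesgue null
  set. At almost every height the slices of the balls are disjoint discs filling the slice of the
  cylinder up to a null set, and for discs the gauge equals the Lebesgue measure.\<close>

lemma hausdorff_pre_disc_le:
  fixes b :: "'a::euclidean_space"
  assumes b: "b \<in> Basis" and r: "0 < r" and \<delta>: "0 < \<delta>"
  shows "hausdorff_pre (DIM('a) - 1) \<delta> (ball 0 r \<inter> {x. x \<bullet> b = 0}) \<le>
    ennreal (unit_ball_vol (real (DIM('a) - 1)) * r ^ (DIM('a) - 1))"
proof -
  define m where "m = DIM('a) - 1"
  have bb: "b \<bullet> b = 1" using b by (simp add: inner_Basis_self)
  let ?I = "Basis - {b}" let ?L = "coord_lebesgue (Basis - {b})"
  have card: "card ?I = m" using b by (simp add: card_Basis_minus m_def)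
  define S where "S = {x. 0 < x \<bullet> b \<and> x \<bullet> b < 1 \<and> x - (x \<bullet> b) *\<^sub>R b \<in> ball 0 r}"
  have "S = {x. 0 < x \<bullet> b} \<inter> {x. x \<bullet> b < 1} \<inter> {x. norm (x - (x \<bullet> b) *\<^sub>R b) < r}"
    by (auto simp: S_def)
  then have "open S" by (auto intro!: open_Int open_Collect_less continuous_intros)
  define K where "K = {(a, \<rho>). 0 < \<rho> \<and> \<rho> \<le> \<delta> / 2 \<and> ball a \<rho> \<subseteq> S}"
  have "\<exists>i. i \<in> K \<and> x \<in> ball (fst i) (snd i) \<and> snd i < d" if x: "x \<in> S" and d: "0 < d" for x d
  proof -
    obtain \<rho> where \<rho>: "0 < \<rho>" "ball x \<rho> \<subseteq> S" using \<open>open S\<close> x by (meson openE)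
    define \<sigma> where "\<sigma> = min \<rho> (min (\<delta> / 2) (d / 2))"
    have "0 < \<sigma>" "\<sigma> \<le> \<rho>" "\<sigma> \<le> \<delta> / 2" "\<sigma> < d" using \<rho> \<delta> d by (auto simp: \<sigma>_def)
    moreover from this have "ball x \<sigma> \<subseteq> S" using \<rho>(2) subset_ball by blast
    ultimately show ?thesis by (intro exI[of _ "(x, \<sigma>)"]) (auto simp: K_def)
  qed
  then obtain C where C: "countable C" "C \<subseteq> K"
    "pairwise (\<lambda>i j. disjnt (ball (fst i) (snd i)) (ball (fst j) (snd j))) C"
    "negligible (S - (\<Union>i\<in>C. ball (fst i) (snd i)))"
    using Vitali_covering_theorem_balls[of S K fst snd] by blast
  have \<rho>: "0 < snd i" "snd i \<le> \<delta> / 2" "ball (fst i) (snd i) \<subseteq> S" if "i \<in> C" for i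
    using subsetD[OF C(2) that] unfolding K_def by (cases i; auto)+
  define N where "N = S - (\<Union>i\<in>C. ball (fst i) (snd i))"
  have [measurable]: "N \<in> sets borel" unfolding N_def using \<open>open S\<close>
    by (intro sets.Diff) (auto intro!: borel_open)
  let ?N = "\<lambda>t. \<integral>\<^sup>+ x. indicator N (x + t *\<^sub>R b) \<partial>?L"
  have "emeasure lborel N = 0"
    using C(4) by (simp add: N_def[symmetric] negligible_iff_emeasure0)
  then have "(\<integral>\<^sup>+ t. ?N t \<partial>lborel) = 0"
    using nn_integral_lborel_slices[OF b, of "indicator N"] by simp
  then have AE: "AE t in lborel. ?N t = 0"
    by (subst (asm) nn_integral_0_iff_AE) (auto intro: measurable_coord_lebesgue_slice)
  have "\<exists>t\<in>{0<..<1::real}. ?N t = 0"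
  proof (rule ccontr)
    assume "\<not> (\<exists>t\<in>{0<..<1::real}. ?N t = 0)"
    then have "AE t in lborel. t \<notin> {0<..<1::real}" using AE by (auto elim!: eventually_mono)
    then have "emeasure lborel {0<..<1::real} = 0"
    proof -
      have "{t \<in> space lborel. t \<in> {0<..<1::real}} = {0<..<1}" by auto
      with emeasure_eq_0_AE[OF \<open>AE t in lborel. t \<notin> {0<..<1::real}\<close>] show ?thesis by metis
    qed
    then show False by simp
  qed
  then obtain t where t: "0 < t" "t < 1" and Nt: "?N t = 0" by auto
  define E where "E = {x. x + t *\<^sub>R b \<in> N \<and> x \<bullet> b = 0}"
  have [measurable]: "E \<in> sets borel" unfolding E_def by measurable
  have "emeasure ?L E = (\<integral>\<^sup>+ x. indicator E x \<partial>?L)" by simp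
  also have "\<dots> \<le> ?N t"
    by (intro nn_integral_mono) (auto simp: E_def indicator_def)
  finally have "emeasure ?L E = 0" using Nt by simp
  then have E0: "hausdorff_pre m \<delta> E = 0"
    unfolding m_def using b \<delta> by (intro hausdorff_pre_null) (auto simp: E_def)
  define U where "U i = {x. x \<bullet> b = 0 \<and> x + t *\<^sub>R b \<in> ball (fst i) (snd i)}" for i :: "'a \<times> real"
  have [measurable]: "U i \<in> sets borel" for i unfolding U_def mem_ball by measurable
  define C' where "C' = {i \<in> C. \<bar>t - fst i \<bullet> b\<bar> < snd i}"
  have C': "countable C'" "C' \<subseteq> C" using C(1) by (auto simp: C'_def)
  define p where "p i = fst i - (fst i \<bullet> b) *\<^sub>R b" for i :: "'a \<times> real"
  define s where "s i = sqrt ((snd i)\<^sup>2 - (t - fst i \<bullet> b)\<^sup>2)" for i :: "'a \<times> real"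
  have s: "0 < s i" "s i \<le> snd i" if "i \<in> C'" for i
  proof -
    have "(t - fst i \<bullet> b)\<^sup>2 < (snd i)\<^sup>2"
      using that by (auto simp: C'_def abs_le_square_iff[symmetric] not_le[symmetric])
    then show "0 < s i" by (simp add: s_def)
    have "s i \<le> sqrt ((snd i)\<^sup>2)" unfolding s_def by (intro real_sqrt_le_mono) simp
    then show "s i \<le> snd i" using that \<rho>(1)[of i] C'(2) by auto
  qed
  have U_disc: "x \<in> U i \<longleftrightarrow> dist (p i) x < s i" if i: "i \<in> C'" and x: "x \<bullet> b = 0" for i x
  proof -
    have "0 < snd i" using \<rho>(1)[of i] i C'(2) by auto
    from slice_ball[OF norm_Basis[OF b] x this, of t "fst i"] show ?thesis using x by (simp add: U_def p_def s_def)
  qed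
  have dist_U: "dist x y \<le> 2 * s i" if i: "i \<in> C'" and xy: "x \<in> U i" "y \<in> U i" for x y i
  proof -
    have "dist x y \<le> dist (p i) x + dist (p i) y" by (rule dist_triangle3)
    moreover have "dist (p i) x < s i" "dist (p i) y < s i"
      using U_disc[OF i, of x] U_disc[OF i, of y] xy by (auto simp: U_def)
    ultimately show ?thesis by simp
  qed
  have bd: "bounded (U i)" if "i \<in> C'" for i using dist_U[OF that] unfolding bounded_two_points by blast
  have diam: "diameter (U i) \<le> 2 * s i" if "i \<in> C'" for i
    using s(1)[OF that] dist_U[OF that] by (intro diameter_le) (auto simp: dist_norm)
  have gauge: "hausdorff_gauge m (U i) \<le> emeasure ?L (U i)" if i: "i \<in> C'" for i
  proof -
    have pI: "p i = (\<Sum>j\<in>?I. (p i \<bullet> j) *\<^sub>R j)"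
    proof -
      have "p i \<bullet> b = 0" by (simp add: p_def inner_diff_left bb)
      then have "(\<Sum>j\<in>Basis. (p i \<bullet> j) *\<^sub>R j) = (\<Sum>j\<in>?I. (p i \<bullet> j) *\<^sub>R j)"
        using b by (intro sum.mono_neutral_right) auto
      then show ?thesis by (simp add: euclidean_representation)
    qed
    have "hausdorff_gauge m (U i) \<le> ennreal (unit_ball_vol (real m) * s i ^ m)"
      by (rule hausdorff_gauge_le[OF bd[OF i] diam[OF i]])
    also have "\<dots> = emeasure ?L (ball 0 (s i))"
      using emeasure_coord_lebesgue_ball[of ?I "s i"] s(1)[OF i] by (simp add: card)
    also have "\<dots> = (\<integral>\<^sup>+ x. indicator (ball 0 (s i)) x \<partial>?L)" by simp
    also have "\<dots> = (\<integral>\<^sup>+ x. indicator (ball (p i) (s i)) (x + (\<Sum>j\<in>?I. (p i \<bullet> j) *\<^sub>R j)) \<partial>?L)"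
      unfolding pI[symmetric] by (intro nn_integral_cong) (simp add: indicator_def dist_norm)
    also have "\<dots> = (\<integral>\<^sup>+ x. indicator (ball (p i) (s i)) x \<partial>?L)"
      by (rule nn_integral_coord_lebesgue_translation) (auto intro!: borel_measurable_indicator)
    also have "\<dots> = (\<integral>\<^sup>+ x. indicator (U i) x \<partial>?L)"
    proof (rule nn_integral_cong_AE)
      show "AE x in ?L. indicator (ball (p i) (s i)) x = (indicator (U i) x :: ennreal)"
        using AE_coord_lebesgue_orthogonal[OF b]
        by eventually_elim (simp add: indicator_def U_disc[OF i])
    qed
    also have "\<dots> = emeasure ?L (U i)" by simp
    finally show ?thesis .
  qed
  let ?D = "ball 0 r \<inter> {x. x \<bullet> b = 0}"
  have "?D \<subseteq> (\<Union>i\<in>C'. U i) \<union> E"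
  proof
    fix x assume x: "x \<in> ?D"
    then have xS: "x + t *\<^sub>R b \<in> S" using t by (simp add: S_def inner_add_left bb)
    show "x \<in> (\<Union>i\<in>C'. U i) \<union> E"
    proof (cases "x + t *\<^sub>R b \<in> N")
      case True then show ?thesis using x by (simp add: E_def)
    next
      case False
      then obtain i where i: "i \<in> C" "x + t *\<^sub>R b \<in> ball (fst i) (snd i)" using xS by (auto simp: N_def)
      have "\<bar>(fst i - (x + t *\<^sub>R b)) \<bullet> b\<bar> \<le> norm (fst i - (x + t *\<^sub>R b))"
        using b by (rule Basis_le_norm)
      then have "i \<in> C'"
        using i x by (simp add: C'_def dist_norm inner_diff_left inner_add_left bb)
      then show ?thesis using i x by (auto simp: U_def)
    qed
  qed
  then have "hausdorff_pre m \<delta> ?D \<le> hausdorff_pre m \<delta> ((\<Union>i\<in>C'. U i) \<union> E)" by (rule hausdorff_pre_mono)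
  also have "\<dots> \<le> hausdorff_pre m \<delta> (\<Union>i\<in>C'. U i) + hausdorff_pre m \<delta> E"
    using \<delta> by (intro hausdorff_pre_subadditive) simp
  also have "\<dots> = hausdorff_pre m \<delta> (\<Union>i\<in>C'. U i)" using E0 by simp
  also have "\<dots> \<le> (\<integral>\<^sup>+ i. hausdorff_gauge m (U i) \<partial>count_space C')"
  proof (rule hausdorff_pre_le_countable[OF C'(1)])
    fix i assume i: "i \<in> C'"
    then have "snd i \<le> \<delta> / 2" using \<rho>(2)[of i] subsetD[OF C'(2)] by simp
    then show "diameter (U i) \<le> \<delta>" using diam[OF i] s(2)[OF i] by simp
  qed (use bd \<delta> in auto)
  also have "\<dots> \<le> (\<integral>\<^sup>+ i. emeasure ?L (U i) \<partial>count_space C')"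
    using gauge by (intro nn_integral_mono) simp
  also have "\<dots> = emeasure ?L (\<Union>i\<in>C'. U i)"
  proof (rule emeasure_UN_countable[symmetric])
    show "disjoint_family_on U C'"
      using C(3) C'(2) unfolding disjoint_family_on_def pairwise_def disjnt_def U_def by blast
  qed (use C' in auto)
  also have "\<dots> \<le> emeasure ?L (ball 0 r)"
  proof (rule emeasure_mono)
    show "(\<Union>i\<in>C'. U i) \<subseteq> ball 0 r"
    proof
      fix x assume "x \<in> (\<Union>i\<in>C'. U i)"
      then obtain i where i: "i \<in> C" "x \<bullet> b = 0" "x + t *\<^sub>R b \<in> ball (fst i) (snd i)" using C'(2) by (auto simp: U_def)
      then have "x + t *\<^sub>R b \<in> S" using \<rho>(3) by blast
      then show "x \<in> ball 0 r" using i by (simp add: S_def inner_add_left bb)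
    qed
  qed simp
  also have "\<dots> = ennreal (unit_ball_vol (real m) * r ^ m)"
    using emeasure_coord_lebesgue_ball[of ?I r] r by (simp add: card)
  finally show ?thesis by (simp add: m_def)
qed

text \<open>This fixes the normalisation of Hausdorff measure in codimension one.\<close>

theorem hausdorff_outer_disc:
  fixes b :: "'a::euclidean_space"
  assumes b: "b \<in> Basis" and r: "0 < r"
  shows "hausdorff_outer (DIM('a) - 1) (ball 0 r \<inter> {x. x \<bullet> b = 0}) =
    ennreal (unit_ball_vol (real (DIM('a) - 1)) * r ^ (DIM('a) - 1))"
proof (rule antisym)
  let ?m = "DIM('a) - 1" and ?D = "ball 0 r \<inter> {x. x \<bullet> b = 0}" and ?L = "coord_lebesgue (Basis - {b})"
  show "hausdorff_outer (?m) (?D) \<le>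
      ennreal (unit_ball_vol (real (?m)) * r ^ (?m))"
    using assms by (intro hausdorff_outer_le hausdorff_pre_disc_le)
  have "ennreal (unit_ball_vol (real (?m)) * r ^ (?m)) = emeasure ?L (ball 0 r)"
    using emeasure_coord_lebesgue_ball[of "Basis - {b}" r] assms by (simp add: card_Basis_minus)
  also have "\<dots> = emeasure ?L (?D)"
    using AE_coord_lebesgue_orthogonal[OF b] by (intro emeasure_eq_AE) auto
  also have "\<dots> \<le> hausdorff_outer (?m) (?D)"
    using coord_lebesgue_le_hausdorff_outer[of "Basis - {b}" "?D"] b
    by (simp add: card_Basis_minus)
  finally show "ennreal (unit_ball_vol (real (?m)) * r ^ (?m)) \<le>
      hausdorff_outer (?m) (?D)" .
qed

section \<open>Reflections and invariant measures\<close>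

text \<open>Reflection in the hyperplane orthogonal to \<open>d\<close>; for \<open>d = 0\<close> division by zero makes it the identity.
  Since reflections act transitively on each sphere (\<open>reflect_swap\<close>), they supply all the rotational
  symmetry used below.\<close>

definition reflect :: "'a::real_inner \<Rightarrow> 'a \<Rightarrow> 'a" where
  "reflect d x = x - (2 * (x \<bullet> d) / (d \<bullet> d)) *\<^sub>R d"

lemma reflect_zero [simp]: "reflect 0 x = x"
  by (simp add: reflect_def)

lemma reflect_diff: "reflect d (x - y) = reflect d x - reflect d y"
  by (simp add: reflect_def inner_diff_left algebra_simps diff_divide_distrib)

lemma reflect_add: "reflect d (x + y) = reflect d x + reflect d y"
  by (simp add: reflect_def inner_add_left algebra_simps add_divide_distrib)

lemma inner_reflect_axis: "reflect d x \<bullet> d = - (x \<bullet> d)"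
  by (cases "d = 0") (simp_all add: reflect_def inner_diff_left)

lemma reflect_reflect [simp]: "reflect d (reflect d x) = x"
  unfolding reflect_def[of d "reflect d x"] inner_reflect_axis by (simp add: reflect_def)

lemma inner_reflect [simp]: "reflect d x \<bullet> reflect d y = x \<bullet> y"
proof (cases "d = 0")
  case False
  have "reflect d x \<bullet> reflect d y = reflect d x \<bullet> y - (2 * (y \<bullet> d) / (d \<bullet> d)) * (reflect d x \<bullet> d)"
    by (simp add: reflect_def[of d y] inner_diff_right)
  also have "\<dots> = x \<bullet> y"
    unfolding inner_reflect_axis by (simp add: reflect_def inner_diff_left inner_commute[of d y])
  finally show ?thesis .
qed simp

lemma norm_reflect [simp]: "norm (reflect d x) = norm x"
  by (simp add: norm_eq_sqrt_inner)

lemma dist_reflect [simp]: "dist (reflect d x) (reflect d y) = dist x y"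
  by (simp add: dist_norm reflect_diff[symmetric])

lemma reflect_swap:
  assumes "norm v = norm w"
  shows "reflect (v - w) v = w"
proof (cases "v = w")
  case False
  then have "(v - w) \<bullet> (v - w) \<noteq> 0" by simp
  moreover have "v \<bullet> v = w \<bullet> w" using assms by (simp add: norm_eq_sqrt_inner)
  then have "(v - w) \<bullet> (v - w) = 2 * (v \<bullet> (v - w))"
    by (simp add: inner_diff_left inner_diff_right inner_commute)
  ultimately show ?thesis by (simp add: reflect_def)
qed simp

lemma borel_measurable_reflect [measurable]:
  "reflect (d :: 'a::euclidean_space) \<in> borel_measurable borel"
  unfolding reflect_def by measurable

lemma vimage_reflect: "reflect d -` A = reflect d ` A"
proof (intro set_eqI iffI)
  fix x assume "x \<in> reflect d -` A"
  then show "x \<in> reflect d ` A" by (intro image_eqI[of _ _ "reflect d x"]) auto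
qed auto

lemma nn_integral_hausdorff_reflect:
  fixes g :: "'a::euclidean_space \<Rightarrow> ennreal"
  assumes [measurable]: "g \<in> borel_measurable borel"
  shows "(\<integral>\<^sup>+ x. g (reflect d x) \<partial>hausdorff_measure m) = (\<integral>\<^sup>+ x. g x \<partial>hausdorff_measure m)"
proof -
  have "distr (hausdorff_measure m) borel (reflect d) = hausdorff_measure m"
  proof (rule measure_eqI)
    fix A assume "A \<in> sets (distr (hausdorff_measure m) borel (reflect d))"
    then have A [measurable]: "A \<in> sets borel" by simp
    have "reflect d ` A \<in> sets borel"
      unfolding vimage_reflect[symmetric] using measurable_sets[OF borel_measurable_reflect A] by simp
    then show "emeasure (distr (hausdorff_measure m) borel (reflect d)) A = emeasure (hausdorff_measure m) A"
      using A by (simp add: emeasure_distr vimage_reflect emeasure_hausdorff_measure hausdorff_outer_isometry_image)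
  qed simp
  then have "(\<integral>\<^sup>+ x. g x \<partial>hausdorff_measure m) = (\<integral>\<^sup>+ x. g x \<partial>distr (hausdorff_measure m) borel (reflect d))" by simp
  also have "\<dots> = (\<integral>\<^sup>+ x. g (reflect d x) \<partial>hausdorff_measure m)" by (rule nn_integral_distr) measurable
  finally show ?thesis ..
qed

lemma nn_integral_lborel_affine:
  fixes g :: "'a::euclidean_space \<Rightarrow> ennreal"
  assumes [measurable]: "g \<in> borel_measurable borel" and c: "c \<noteq> 0"
  shows "(\<integral>\<^sup>+ x. g x \<partial>lborel) = ennreal (\<bar>c\<bar> ^ DIM('a)) * (\<integral>\<^sup>+ x. g (t + c *\<^sub>R x) \<partial>lborel)"
  by (subst lborel_affine[OF c, of t]) (simp add: nn_integral_density nn_integral_distr nn_integral_cmult)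

text \<open>Compare the two measures of \<open>A\<close> by integrating, against both measures at once, the indicator of
  \<open>x \<in> A\<close> and \<open>x + y\<close> in the unit ball.\<close>

lemma translation_invariant_eq_lborel:
  fixes \<nu> :: "'a::euclidean_space measure"
  assumes sets [simp, measurable_cong]: "sets \<nu> = sets borel" and "sigma_finite_measure \<nu>"
    and inv: "\<And>g c. g \<in> borel_measurable borel \<Longrightarrow> (\<integral>\<^sup>+ x. g (x + c) \<partial>\<nu>) = (\<integral>\<^sup>+ x. g x \<partial>\<nu>)"
    and ball: "emeasure \<nu> (ball 0 1) = emeasure lborel (ball (0::'a) 1)"
  shows "\<nu> = lborel"
proof (rule measure_eqI)
  fix A assume "A \<in> sets \<nu>"
  then have A [measurable]: "A \<in> sets borel" by simp
  interpret N: sigma_finite_measure \<nu> by fact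
  interpret P: pair_sigma_finite \<nu> "lborel :: 'a measure"
    by (rule pair_sigma_finite.intro[OF N.sigma_finite_measure_axioms sigma_finite_lborel])
  define B where "B = ball (0::'a) 1"
  have B [measurable]: "B \<in> sets borel" by (simp add: B_def)
  have sp [simp]: "space \<nu> = UNIV" using sets_eq_imp_space_eq[OF sets] by simp
  have "emeasure \<nu> A * emeasure lborel B = (\<integral>\<^sup>+ x. indicator A x * emeasure lborel B \<partial>\<nu>)"
    by (simp add: nn_integral_multc)
  also have "\<dots> = (\<integral>\<^sup>+ x. \<integral>\<^sup>+ y. indicator A x * indicator B (x + y) \<partial>lborel \<partial>\<nu>)"
  proof (rule nn_integral_cong)
    fix x
    have "(\<integral>\<^sup>+ y. indicator B (x + y) \<partial>lborel) = emeasure lborel B"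
      using nn_integral_lborel_affine[of "indicator B" 1 x] by simp
    then show "indicator A x * emeasure lborel B = (\<integral>\<^sup>+ y. indicator A x * indicator B (x + y) \<partial>lborel)"
      by (subst nn_integral_cmult) auto
  qed
  also have "\<dots> = (\<integral>\<^sup>+ y. \<integral>\<^sup>+ x. indicator A x * indicator B (x + y) \<partial>\<nu> \<partial>lborel)"
    by (rule P.Fubini'[symmetric]) measurable
  also have "\<dots> = (\<integral>\<^sup>+ y. \<integral>\<^sup>+ x. indicator A (x - y) * indicator B x \<partial>\<nu> \<partial>lborel)"
  proof (rule nn_integral_cong)
    fix y
    show "(\<integral>\<^sup>+ x. indicator A x * indicator B (x + y) \<partial>\<nu>) = (\<integral>\<^sup>+ x. indicator A (x - y) * indicator B x \<partial>\<nu> :: ennreal)"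
      using inv[of "\<lambda>x. indicator A (x - y) * indicator B x" y] by simp
  qed
  also have "\<dots> = (\<integral>\<^sup>+ x. \<integral>\<^sup>+ y. indicator A (x - y) * indicator B x \<partial>lborel \<partial>\<nu>)"
    by (rule P.Fubini') measurable
  also have "\<dots> = (\<integral>\<^sup>+ x. emeasure lborel A * indicator B x \<partial>\<nu>)"
  proof (rule nn_integral_cong)
    fix x
    have "(\<integral>\<^sup>+ y. indicator A (x - y) \<partial>lborel) = emeasure lborel A"
      using nn_integral_lborel_affine[of "indicator A" "-1" x] by simp
    then show "(\<integral>\<^sup>+ y. indicator A (x - y) * indicator B x \<partial>lborel) = emeasure lborel A * indicator B x"
      by (subst nn_integral_multc) auto
  qed
  also have "\<dots> = emeasure lborel A * emeasure \<nu> B" by (simp add: nn_integral_cmult_indicator)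
  finally have "emeasure \<nu> A * emeasure lborel B = emeasure lborel A * emeasure lborel B"
    using ball by (simp add: B_def)
  moreover have "emeasure lborel B = ennreal (unit_ball_vol (DIM('a)))"
    by (simp add: B_def emeasure_ball)
  then have "emeasure lborel B \<noteq> 0" "emeasure lborel B \<noteq> top"
    using unit_ball_vol_pos[of "real DIM('a)"] by (auto simp: ennreal_eq_0_iff not_le)
  ultimately show "emeasure \<nu> A = emeasure lborel A"
    using ennreal_mult_cancel_left[of "emeasure lborel B" "emeasure \<nu> A" "emeasure lborel A"]
    by (simp only: mult.commute[of _ "emeasure lborel B"] simp_thms)
qed simp

text \<open>The image of Lebesgue measure under a linear isometry is again translation invariant, and agrees with
  it on the unit ball.\<close>

lemma lborel_distr_reflect: "distr lborel borel (reflect d) = (lborel :: 'a::euclidean_space measure)"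
proof -
  let ?N = "distr lborel borel (reflect d)"
  have ball: "emeasure ?N (ball 0 r) = emeasure lborel (ball (0::'a) r)" for r
  proof -
    have "reflect d -` ball 0 r = ball 0 r" by auto
    then show ?thesis by (simp add: emeasure_distr)
  qed
  show "?N = lborel"
  proof (rule translation_invariant_eq_lborel)
    show "sigma_finite_measure ?N"
    proof
      show "\<exists>A. countable A \<and> A \<subseteq> sets ?N \<and> \<Union> A = space ?N \<and> (\<forall>a\<in>A. emeasure ?N a \<noteq> \<infinity>)"
      proof (intro exI[of _ "range (\<lambda>k. ball 0 (real k))"] conjI)
        show "\<Union> (range (\<lambda>k. ball 0 (real k))) = space ?N"
          using reals_Archimedean2 by auto
      qed (auto simp: ball emeasure_ball)
    qed
    fix g :: "'a \<Rightarrow> ennreal" and c assume [measurable]: "g \<in> borel_measurable borel"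
    have "(\<integral>\<^sup>+ x. g (x + c) \<partial>?N) = (\<integral>\<^sup>+ x. g (reflect d (reflect d c + 1 *\<^sub>R x)) \<partial>lborel)"
      by (subst nn_integral_distr) (auto simp: reflect_add add.commute)
    also have "\<dots> = (\<integral>\<^sup>+ x. g (reflect d x) \<partial>lborel)"
      using nn_integral_lborel_affine[of "\<lambda>x. g (reflect d x)" 1 "reflect d c"] by simp
    also have "\<dots> = (\<integral>\<^sup>+ x. g x \<partial>?N)" by (subst nn_integral_distr) auto
    finally show "(\<integral>\<^sup>+ x. g (x + c) \<partial>?N) = (\<integral>\<^sup>+ x. g x \<partial>?N)" .
  qed (simp_all add: ball)
qed

lemma nn_integral_lborel_reflect:
  fixes g :: "'a::euclidean_space \<Rightarrow> ennreal"
  assumes [measurable]: "g \<in> borel_measurable borel"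
  shows "(\<integral>\<^sup>+ x. g (reflect d x) \<partial>lborel) = (\<integral>\<^sup>+ x. g x \<partial>lborel)"
  by (subst (2) lborel_distr_reflect[of d, symmetric]) (simp add: nn_integral_distr)

lemma integral_lborel_reflect:
  fixes g :: "'a::euclidean_space \<Rightarrow> real"
  assumes [measurable]: "g \<in> borel_measurable borel"
  shows "(\<integral> x. g (reflect d x) \<partial>lborel) = (\<integral> x. g x \<partial>lborel)"
  by (subst (2) lborel_distr_reflect[of d, symmetric]) (simp add: integral_distr)

section \<open>Surface measure of the sphere\<close>

lemma space_surface_measure [simp]: "space (surface_measure S) = S"
  by (simp add: surface_measure_def space_restrict_space)

lemma sets_surface_measure: "sets (surface_measure S) = sets (restrict_space borel S)"
  unfolding surface_measure_def by (intro sets_restrict_space_cong) simp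

lemma sets_surface_measureI: "A \<in> sets borel \<Longrightarrow> A \<subseteq> S \<Longrightarrow> A \<in> sets (surface_measure S)"
  unfolding sets_surface_measure sets_restrict_space by (intro image_eqI[of _ _ A]) auto

lemma measurable_surface_measure:
  "f \<in> borel_measurable borel \<Longrightarrow> f \<in> borel_measurable (surface_measure S)"
  unfolding surface_measure_def by (intro measurable_restrict_space1) (simp cong: measurable_cong_sets)

lemma nn_integral_surface_measure:
  fixes S :: "'a::euclidean_space set"
  assumes "S \<in> sets borel"
  shows "(\<integral>\<^sup>+ x. g x \<partial>surface_measure S) = (\<integral>\<^sup>+ x. g x * indicator S x \<partial>hausdorff_measure (DIM('a) - 1))"
  unfolding surface_measure_def using assms by (simp add: nn_integral_restrict_space)

lemma emeasure_surface_measure: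
  fixes S :: "'a::euclidean_space set"
  assumes "S \<in> sets borel" "A \<in> sets borel" "A \<subseteq> S"
  shows "emeasure (surface_measure S) A = hausdorff_outer (DIM('a) - 1) A"
  unfolding surface_measure_def using assms
  by (simp add: emeasure_restrict_space emeasure_hausdorff_measure)

lemma borel_sphere [measurable]: "sphere (a :: 'a::euclidean_space) r \<in> sets borel"
  by (intro borel_closed closed_sphere)

lemma nn_integral_sphere_reflect:
  fixes g :: "'a::euclidean_space \<Rightarrow> ennreal"
  assumes [measurable]: "g \<in> borel_measurable borel"
  shows "(\<integral>\<^sup>+ u. g (reflect d u) \<partial>surface_measure (sphere 0 1)) = (\<integral>\<^sup>+ u. g u \<partial>surface_measure (sphere 0 1))"
proof -
  let ?H = "hausdorff_measure (DIM('a) - 1)"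
  have "(\<integral>\<^sup>+ u. g (reflect d u) \<partial>surface_measure (sphere 0 1)) =
      (\<integral>\<^sup>+ u. g (reflect d u) * indicator (sphere 0 1) (reflect d u) \<partial>?H)"
    by (simp add: nn_integral_surface_measure indicator_def)
  also have "\<dots> = (\<integral>\<^sup>+ u. g u * indicator (sphere 0 1) u \<partial>?H)"
    by (rule nn_integral_hausdorff_reflect) measurable
  also have "\<dots> = (\<integral>\<^sup>+ u. g u \<partial>surface_measure (sphere 0 1))" by (simp add: nn_integral_surface_measure)
  finally show ?thesis .
qed

definition cap :: "real \<Rightarrow> 'a::real_inner \<Rightarrow> 'a set" where
  "cap c e = {u. norm u = 1 \<and> c < u \<bullet> e}"

lemma borel_cap [measurable]: "cap c (e :: 'a::euclidean_space) \<in> sets borel"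
  unfolding cap_def by measurable

text \<open>A spherical cap projects onto a flat disc, and projections do not increase distances.\<close>

lemma cap_lower_bound:
  fixes b :: "'a::euclidean_space"
  assumes b: "b \<in> Basis" and c: "0 < c" "c < 1"
  defines "s \<equiv> sqrt (1 - c\<^sup>2)"
  shows "ennreal (unit_ball_vol (real (DIM('a) - 1)) * s ^ (DIM('a) - 1)) \<le> hausdorff_outer (DIM('a) - 1) (cap c b)"
proof -
  have b1: "norm b = 1" "b \<bullet> b = 1" using b by (simp_all add: inner_Basis_self)
  have c2: "c\<^sup>2 < 1" using c by (simp add: power_less_one_iff abs_square_less_1)
  then have s: "0 < s" by (simp add: s_def)
  define P where "P u = u - (u \<bullet> b) *\<^sub>R b" for u
  have P_orth: "P u \<bullet> b = 0" for u by (simp add: P_def inner_diff_left b1)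
  have "ball 0 s \<inter> {x. x \<bullet> b = 0} \<subseteq> P ` cap c b"
  proof
    fix p assume p: "p \<in> ball 0 s \<inter> {x. x \<bullet> b = 0}"
    then have "(norm p)\<^sup>2 < s\<^sup>2" by (intro power_strict_mono) auto
    then have np: "(norm p)\<^sup>2 < 1 - c\<^sup>2" using c2 by (simp add: s_def)
    define t where "t = sqrt (1 - (norm p)\<^sup>2)"
    have "(norm p)\<^sup>2 < 1" using np zero_le_power2[of c] by linarith
    then have t2: "t\<^sup>2 = 1 - (norm p)\<^sup>2" by (simp add: t_def)
    have "sqrt (c\<^sup>2) < t" unfolding t_def using np by (intro real_sqrt_less_mono) simp
    then have ct: "c < t" using c by simp
    have "(norm (p + t *\<^sub>R b))\<^sup>2 = 1" using norm_split[OF b1(1), of p t] p t2 by simp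
    then have "norm (p + t *\<^sub>R b) = 1" using power2_eq_imp_eq[of "norm (p + t *\<^sub>R b)" 1] by simp
    moreover have "(p + t *\<^sub>R b) \<bullet> b = t" using p by (simp add: inner_add_left b1)
    ultimately have "p + t *\<^sub>R b \<in> cap c b" "P (p + t *\<^sub>R b) = p" using ct by (auto simp: cap_def P_def)
    then show "p \<in> P ` cap c b" by (intro image_eqI[of _ P "p + t *\<^sub>R b"]) auto
  qed
  then have "hausdorff_outer (DIM('a) - 1) (ball 0 s \<inter> {x. x \<bullet> b = 0}) \<le> hausdorff_outer (DIM('a) - 1) (P ` cap c b)"
    by (rule hausdorff_outer_mono)
  also have "\<dots> \<le> ennreal (1 ^ (DIM('a) - 1)) * hausdorff_outer (DIM('a) - 1) (cap c b)"
  proof (rule hausdorff_outer_lipschitz_image)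
    show "1-lipschitz_on (cap c b) P"
    proof (rule lipschitz_onI)
      fix x y :: 'a
      define z where "z = x - y"
      have "P z + (z \<bullet> b) *\<^sub>R b = z" by (simp add: P_def)
      then have "(norm z)\<^sup>2 = (norm (P z))\<^sup>2 + (z \<bullet> b)\<^sup>2"
        using norm_split[OF b1(1) P_orth[of z], of "z \<bullet> b"] by (simp only:)
      then have "(norm (P z))\<^sup>2 \<le> (norm z)\<^sup>2" using zero_le_power2[of "z \<bullet> b"] by linarith
      then have "norm (P (x - y)) \<le> norm (x - y)"
        unfolding z_def by (rule power2_le_imp_le[OF _ norm_ge_zero])
      moreover have "P x - P y = P (x - y)" by (simp add: P_def algebra_simps inner_diff_left)
      ultimately show "dist (P x) (P y) \<le> 1 * dist x y" by (simp add: dist_norm)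
    qed simp
  qed simp
  finally show ?thesis using hausdorff_outer_disc[OF b s] by simp
qed

text \<open>The disc is mapped back onto the cap by the graph map \<open>Q\<close>. On the cap the graph has slope at most
  \<open>s / c\<close>, the tangent of the opening angle, so \<open>Q\<close> has Lipschitz constant \<open>1 / c\<close>.\<close>

lemma cap_upper_bound:
  fixes b :: "'a::euclidean_space"
  assumes b: "b \<in> Basis" and c: "0 < c" "c < 1"
  defines "s \<equiv> sqrt (1 - c\<^sup>2)"
  shows "hausdorff_outer (DIM('a) - 1) (cap c b) \<le> ennreal (unit_ball_vol (real (DIM('a) - 1)) * (s / c) ^ (DIM('a) - 1))"
proof -
  have b1: "norm b = 1" "b \<bullet> b = 1" using b by (simp_all add: inner_Basis_self)
  have c2: "c\<^sup>2 < 1" using c by (simp add: power_less_one_iff abs_square_less_1)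
  then have s: "0 < s" "s\<^sup>2 = 1 - c\<^sup>2" by (simp_all add: s_def)
  let ?D = "ball 0 s \<inter> {x. x \<bullet> b = 0}"
  define h where "h p = sqrt (1 - (norm p)\<^sup>2)" for p :: 'a
  define Q where "Q p = p + h p *\<^sub>R b" for p
  have h: "c < h p" "(h p)\<^sup>2 = 1 - (norm p)\<^sup>2" if "p \<in> ?D" for p
  proof -
    have "(norm p)\<^sup>2 < s\<^sup>2" using that by (intro power_strict_mono) auto
    then have np: "c\<^sup>2 < 1 - (norm p)\<^sup>2" using s by simp
    then have "sqrt (c\<^sup>2) < h p" unfolding h_def by (rule real_sqrt_less_mono)
    then show "c < h p" using c by simp
    have "0 \<le> 1 - (norm p)\<^sup>2" using np zero_le_power2[of c] by linarith
    then show "(h p)\<^sup>2 = 1 - (norm p)\<^sup>2" by (simp add: h_def)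
  qed
  have "cap c b \<subseteq> Q ` ?D"
  proof
    fix u assume u: "u \<in> cap c b"
    define p where "p = u - (u \<bullet> b) *\<^sub>R b"
    have pb: "p \<bullet> b = 0" by (simp add: p_def inner_diff_left b1)
    have up: "u = p + (u \<bullet> b) *\<^sub>R b" by (simp add: p_def)
    have "(norm u)\<^sup>2 = (norm p)\<^sup>2 + (u \<bullet> b)\<^sup>2" using norm_split[OF b1(1) pb, of "u \<bullet> b"] up by metis
    then have eq: "1 - (norm p)\<^sup>2 = (u \<bullet> b)\<^sup>2" using u by (simp add: cap_def)
    have cu: "c < u \<bullet> b" using u by (simp add: cap_def)
    then have hp: "h p = u \<bullet> b" using eq c by (simp add: h_def)
    have "c\<^sup>2 < (u \<bullet> b)\<^sup>2" using cu c by (intro power_strict_mono) auto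
    then have "(norm p)\<^sup>2 < s\<^sup>2" using eq s by simp
    then have "norm p < s" using s by (intro power2_less_imp_less[of "norm p"]) auto
    then have "p \<in> ?D" using pb by simp
    moreover have "u = Q p" using up hp by (simp add: Q_def)
    ultimately show "u \<in> Q ` ?D" by blast
  qed
  then have "hausdorff_outer (DIM('a) - 1) (cap c b) \<le> hausdorff_outer (DIM('a) - 1) (Q ` ?D)"
    by (rule hausdorff_outer_mono)
  also have "\<dots> \<le> ennreal ((1 / c) ^ (DIM('a) - 1)) * hausdorff_outer (DIM('a) - 1) ?D"
  proof (rule hausdorff_outer_lipschitz_image)
    show "(1 / c)-lipschitz_on ?D Q"
    proof (rule lipschitz_onI)
      fix x y assume xy: "x \<in> ?D" "y \<in> ?D"
      define d where "d = dist x y"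
      have hx: "c < h x" "c < h y" using h xy by auto
      have "(h x - h y) * (h x + h y) = (h x)\<^sup>2 - (h y)\<^sup>2" by (simp add: power2_eq_square algebra_simps)
      also have "\<dots> = (norm y - norm x) * (norm y + norm x)"
        using h(2)[OF xy(1)] h(2)[OF xy(2)] by (simp add: power2_eq_square algebra_simps)
      finally have "\<bar>(h x - h y) * (h x + h y)\<bar> = \<bar>(norm y - norm x) * (norm y + norm x)\<bar>" by simp
      then have "\<bar>h x - h y\<bar> * (h x + h y) = \<bar>norm y - norm x\<bar> * (norm y + norm x)"
        using hx c by (simp add: abs_mult)
      also have "\<dots> \<le> d * (2 * s)"
        using norm_triangle_ineq3[of y x] xy by (intro mult_mono) (auto simp: d_def dist_norm norm_minus_commute)
      finally have "\<bar>h x - h y\<bar> * (h x + h y) \<le> d * (2 * s)" .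
      moreover have "\<bar>h x - h y\<bar> * (2 * c) \<le> \<bar>h x - h y\<bar> * (h x + h y)"
        using hx by (intro mult_left_mono) auto
      ultimately have "\<bar>h x - h y\<bar> \<le> d * s / c" using c by (simp add: field_simps)
      then have "(h x - h y)\<^sup>2 \<le> (d * s / c)\<^sup>2" by (metis abs_ge_zero power2_abs power_mono)
      then have "d\<^sup>2 + (h x - h y)\<^sup>2 \<le> d\<^sup>2 + d\<^sup>2 * s\<^sup>2 / c\<^sup>2" by (simp add: power_mult_distrib power_divide)
      also have "\<dots> = d\<^sup>2 * (c\<^sup>2 + s\<^sup>2) / c\<^sup>2" using c by (simp add: field_simps)
      also have "\<dots> = (d / c)\<^sup>2" using s(2) by (simp add: power_divide)
      finally have le: "d\<^sup>2 + (h x - h y)\<^sup>2 \<le> (d / c)\<^sup>2" .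
      have "Q x - Q y = (x - y) + (h x - h y) *\<^sub>R b" by (simp add: Q_def algebra_simps)
      then have "(dist (Q x) (Q y))\<^sup>2 = d\<^sup>2 + (h x - h y)\<^sup>2"
        using norm_split[OF b1(1), of "x - y" "h x - h y"] xy by (simp add: dist_norm d_def inner_diff_left)
      then have "(dist (Q x) (Q y))\<^sup>2 \<le> (d / c)\<^sup>2" using le by (simp only:)
      moreover have "0 \<le> d / c" using c by (simp add: d_def)
      ultimately have "dist (Q x) (Q y) \<le> d / c" by (rule power2_le_imp_le)
      then show "dist (Q x) (Q y) \<le> (1 / c) * dist x y" by (simp add: d_def)
    qed (use c in simp)
  qed (use c in simp)
  also have "hausdorff_outer (DIM('a) - 1) ?D = ennreal (unit_ball_vol (real (DIM('a) - 1)) * s ^ (DIM('a) - 1))"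
    by (rule hausdorff_outer_disc[OF b s(1)])
  also have "ennreal ((1 / c) ^ (DIM('a) - 1)) * \<dots> = ennreal (unit_ball_vol (real (DIM('a) - 1)) * (s / c) ^ (DIM('a) - 1))"
    using c s by (subst ennreal_mult[symmetric]) (auto simp: power_divide)
  finally show ?thesis .
qed

lemma sphere_integral_eq:
  fixes k :: "'a::euclidean_space \<Rightarrow> 'a \<Rightarrow> ennreal"
  assumes k: "\<And>v. (\<lambda>u. k u v) \<in> borel_measurable borel"
    and inv: "\<And>d u v. k (reflect d u) (reflect d v) = k u v" and eq: "norm v = norm w"
  shows "(\<integral>\<^sup>+ u. k u v \<partial>surface_measure (sphere 0 1)) = (\<integral>\<^sup>+ u. k u w \<partial>surface_measure (sphere 0 1))"
proof -
  have "k (reflect (v - w) u) w = k u v" for u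
    using inv[of "v - w" u v] reflect_swap[OF eq] by simp
  then show ?thesis using nn_integral_sphere_reflect[OF k, of "v - w" w] by simp
qed

lemma sets_cap: "cap c e \<in> sets (surface_measure (sphere (0::'a::euclidean_space) 1))"
  by (rule sets_surface_measureI) (auto simp: cap_def[of c e])

lemma emeasure_sphere_cap:
  fixes e e' :: "'a::euclidean_space"
  assumes "norm e = norm e'"
  shows "emeasure (surface_measure (sphere 0 1)) (cap c e) = emeasure (surface_measure (sphere 0 1)) (cap c e')"
proof -
  have "(\<integral>\<^sup>+ u. indicator (cap c e) u \<partial>surface_measure (sphere 0 1)) = (\<integral>\<^sup>+ u. indicator (cap c e') u \<partial>surface_measure (sphere 0 1))"
  proof (rule sphere_integral_eq[OF _ _ assms])
    show "indicator (cap c (reflect d v)) (reflect d u) = (indicator (cap c v) u :: ennreal)" for d u v :: 'a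
      by (simp add: indicator_def cap_def)
  qed measurable
  then show ?thesis by (simp add: sets_cap)
qed

text \<open>Finitely many caps cover the sphere, and each has finite measure as a Lipschitz image of a disc.\<close>

lemma finite_measure_sphere: "finite_measure (surface_measure (sphere (0::'a::euclidean_space) 1))"
proof
  let ?M = "surface_measure (sphere (0::'a) 1)"
  obtain b :: 'a where b: "b \<in> Basis" using nonempty_Basis by blast
  have "open {u. 1 / 2 < u \<bullet> e}" for e :: 'a by (intro open_Collect_less continuous_intros)
  moreover have "sphere 0 1 \<subseteq> (\<Union>e\<in>sphere 0 1. {u :: 'a. 1 / 2 < u \<bullet> e})"
  proof
    fix u :: 'a assume u: "u \<in> sphere 0 1"
    then have "u \<bullet> u = 1" by (simp add: norm_eq_1)
    then show "u \<in> (\<Union>e\<in>sphere 0 1. {u. 1 / 2 < u \<bullet> e})" using u by (intro UN_I[of u]) auto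
  qed
  ultimately obtain E where E: "E \<subseteq> sphere 0 1" "finite E" "sphere 0 1 \<subseteq> (\<Union>e\<in>E. {u :: 'a. 1 / 2 < u \<bullet> e})"
    by (rule compactE_image[OF compact_sphere])
  have cap_fin: "emeasure ?M (cap (1 / 2) e) < \<infinity>" if "e \<in> E" for e
  proof -
    have "emeasure ?M (cap (1 / 2) e) = emeasure ?M (cap (1 / 2) b)"
      using that E(1) b by (intro emeasure_sphere_cap) auto
    also have "\<dots> = hausdorff_outer (DIM('a) - 1) (cap (1 / 2) b)"
      by (intro emeasure_surface_measure) (auto simp: cap_def)
    also have "\<dots> < \<infinity>"
      using cap_upper_bound[OF b, of "1 / 2"] by (auto intro: le_less_trans)
    finally show ?thesis .
  qed
  have "emeasure ?M (sphere 0 1) \<le> emeasure ?M (\<Union>e\<in>E. cap (1 / 2) e)"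
  proof (rule emeasure_mono)
    show "sphere 0 1 \<subseteq> (\<Union>e\<in>E. cap (1 / 2) e)"
    proof
      fix u :: 'a assume u: "u \<in> sphere 0 1"
      then obtain e where "e \<in> E" "1 / 2 < u \<bullet> e" using E(3) by blast
      then show "u \<in> (\<Union>e\<in>E. cap (1 / 2) e)" using u by (intro UN_I[of e]) (auto simp: cap_def)
    qed
    show "(\<Union>e\<in>E. cap (1 / 2) e) \<in> sets ?M" using E(2) sets_cap by (intro sets.finite_UN) auto
  qed
  also have "\<dots> \<le> (\<Sum>e\<in>E. emeasure ?M (cap (1 / 2) e))"
    using E(2) sets_cap by (intro emeasure_subadditive_finite) auto
  also have "\<dots> < \<infinity>" using cap_fin E(2) by (simp add: less_top[symmetric])
  finally show "emeasure ?M (space ?M) \<noteq> \<infinity>" by simp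
qed

lemma measurable_pair_borel:
  assumes "(\<lambda>x. x) \<in> M \<rightarrow>\<^sub>M borel" "(\<lambda>x. x) \<in> N \<rightarrow>\<^sub>M borel"
    and f: "case_prod f \<in> borel_measurable (borel \<Otimes>\<^sub>M borel)"
  shows "case_prod f \<in> borel_measurable (M \<Otimes>\<^sub>M N)"
proof -
  have "(\<lambda>p. (fst p, snd p)) \<in> M \<Otimes>\<^sub>M N \<rightarrow>\<^sub>M borel \<Otimes>\<^sub>M borel"
    by (intro measurable_Pair measurable_compose[OF measurable_fst assms(1)] measurable_compose[OF measurable_snd assms(2)])
  from measurable_compose[OF this f] show ?thesis by simp
qed

lemma measurable_ident_surface_measure: "(\<lambda>x. x) \<in> surface_measure S \<rightarrow>\<^sub>M borel"
  by (rule measurable_surface_measure) simp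

lemma pred_mem_ball [measurable (raw)]:
  fixes f :: "'b \<Rightarrow> 'a::euclidean_space"
  assumes [measurable]: "f \<in> borel_measurable M"
  shows "Measurable.pred M (\<lambda>x. f x \<in> ball a r)"
  unfolding mem_ball by measurable

lemma DERIV_power_Suc_divide: "((\<lambda>t::real. t ^ Suc m / real (Suc m)) has_real_derivative t ^ m) (at t)"
  using DERIV_cdivide[OF DERIV_pow[of "Suc m" t], of "real (Suc m)"] by (simp del: of_nat_Suc)

lemma nn_integral_power_Icc:
  assumes "0 \<le> a"
  shows "(\<integral>\<^sup>+ t. ennreal (t ^ m) * indicator {0..a} t \<partial>lborel) = ennreal (a ^ Suc m / real (Suc m))"
proof -
  have "(\<integral>\<^sup>+ t. ennreal (t ^ m) * indicator {0..a} t \<partial>lborel) = ennreal (a ^ Suc m / real (Suc m) - 0 ^ Suc m / real (Suc m))"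
  proof (rule nn_integral_FTC_Icc[where F = "\<lambda>t. t ^ Suc m / real (Suc m)"])
  qed (use assms DERIV_power_Suc_divide in auto)
  then show ?thesis by simp
qed

definition cone_sector :: "real \<Rightarrow> 'a::real_inner \<Rightarrow> 'a set" where
  "cone_sector c e = {w. norm w < 1 \<and> c * norm w < w \<bullet> e}"

lemma borel_cone_sector [measurable]: "cone_sector c (e :: 'a::euclidean_space) \<in> sets borel"
  unfolding cone_sector_def by measurable

text \<open>Horizontal slices of the sector are discs, of radius proportional to the height as long as the
  bounding unit sphere does not interfere, that is, up to height \<open>c\<close>.\<close>

lemma cone_sector_slice:
  fixes b :: "'a::real_inner"
  assumes b: "norm b = 1" and x: "x \<bullet> b = 0" and c: "0 < c" "c < 1"
  defines "s \<equiv> sqrt (1 - c\<^sup>2)"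
  shows "x + t *\<^sub>R b \<in> cone_sector c b \<Longrightarrow> 0 < t \<and> t \<le> 1 \<and> norm x < (s / c) * t"
    and "0 < t \<Longrightarrow> t \<le> c \<Longrightarrow> norm x < (s / c) * t \<Longrightarrow> x + t *\<^sub>R b \<in> cone_sector c b"
proof -
  have c2: "c\<^sup>2 < 1" using c by (simp add: abs_square_less_1)
  then have s: "0 < s" "s\<^sup>2 = 1 - c\<^sup>2" by (simp_all add: s_def)
  have n2: "(norm (x + t *\<^sub>R b))\<^sup>2 = (norm x)\<^sup>2 + t\<^sup>2" by (rule norm_split[OF b x])
  have bb: "b \<bullet> b = 1" using b by (simp add: norm_eq_1)
  have ib: "(x + t *\<^sub>R b) \<bullet> b = t" using x by (simp add: inner_add_left bb)
  have key: "c * norm (x + t *\<^sub>R b) < t \<longleftrightarrow> norm x < (s / c) * t" if t: "0 < t" for t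
  proof -
    have n2: "(norm (x + t *\<^sub>R b))\<^sup>2 = (norm x)\<^sup>2 + t\<^sup>2" by (rule norm_split[OF b x])
    have "c * norm (x + t *\<^sub>R b) < t \<longleftrightarrow> (c * norm (x + t *\<^sub>R b))\<^sup>2 < t\<^sup>2"
      using abs_le_square_iff[of t "c * norm (x + t *\<^sub>R b)"] t c by (simp add: not_le[symmetric])
    also have "\<dots> \<longleftrightarrow> c\<^sup>2 * (norm x)\<^sup>2 < s\<^sup>2 * t\<^sup>2"
      unfolding power_mult_distrib n2 s(2) by (simp add: algebra_simps)
    also have "\<dots> \<longleftrightarrow> (c * norm x)\<^sup>2 < (s * t)\<^sup>2" by (simp add: power_mult_distrib)
    also have "\<dots> \<longleftrightarrow> c * norm x < s * t"
      using abs_le_square_iff[of "s * t" "c * norm x"] t c s by (simp add: not_le[symmetric])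
    also have "\<dots> \<longleftrightarrow> norm x < (s / c) * t" using c by (simp add: field_simps)
    finally show ?thesis .
  qed
  {
    assume "x + t *\<^sub>R b \<in> cone_sector c b"
    then have w: "norm (x + t *\<^sub>R b) < 1" "c * norm (x + t *\<^sub>R b) < t" by (simp_all add: cone_sector_def ib)
    have "0 \<le> c * norm (x + t *\<^sub>R b)" using c by simp
    then have t: "0 < t" using w(2) by linarith
    have "t\<^sup>2 \<le> (norm (x + t *\<^sub>R b))\<^sup>2" using n2 by simp
    then have "t \<le> norm (x + t *\<^sub>R b)" by (rule power2_le_imp_le) simp
    then show "0 < t \<and> t \<le> 1 \<and> norm x < (s / c) * t" using t w key[OF t] by simp
  next
    assume t: "0 < t" "t \<le> c" and "norm x < (s / c) * t"
    then have lt: "c * norm (x + t *\<^sub>R b) < t" using key by simp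
    then have "c * norm (x + t *\<^sub>R b) < c * 1" using t by linarith
    then have "norm (x + t *\<^sub>R b) < 1" using c by (simp only: mult_less_cancel_left_pos)
    then show "x + t *\<^sub>R b \<in> cone_sector c b" using lt by (simp add: cone_sector_def ib)
  }
qed

lemma emeasure_cone_sector_bounds:
  fixes b :: "'a::euclidean_space"
  assumes b: "b \<in> Basis" and c: "0 < c" "c < 1"
  defines "s \<equiv> sqrt (1 - c\<^sup>2)"
  defines "m \<equiv> DIM('a) - 1"
  shows "emeasure lborel (cone_sector c b) \<le> ennreal (unit_ball_vol (real m) * (s / c) ^ m / real (Suc m))"
    and "ennreal (unit_ball_vol (real m) * (s / c) ^ m * c ^ Suc m / real (Suc m)) \<le> emeasure lborel (cone_sector c b)"
proof -
  let ?L = "coord_lebesgue (Basis - {b})"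
  let ?s = "\<lambda>t. \<integral>\<^sup>+ x. indicator (cone_sector c b) (x + t *\<^sub>R b) \<partial>?L"
  have b1: "norm b = 1" using b by simp
  have "c\<^sup>2 < 1" using c by (simp add: abs_square_less_1)
  then have s: "0 < s" by (simp add: s_def)
  define K where "K = unit_ball_vol (real m) * (s / c) ^ m"
  have K: "0 \<le> K" using s c by (simp add: K_def)
  have disc: "(\<integral>\<^sup>+ x. indicator (ball 0 ((s / c) * t)) x \<partial>?L) = ennreal (K * t ^ m)" if "0 < t" for t
  proof -
    have "emeasure ?L (ball 0 ((s / c) * t)) = ennreal (unit_ball_vol (real m) * ((s / c) * t) ^ m)"
      unfolding m_def card_Basis_minus[OF b, symmetric] using that s c
      by (intro emeasure_coord_lebesgue_ball) auto
    then show ?thesis by (simp only: K_def power_mult_distrib mult.assoc nn_integral_indicator sets_coord_lebesgue borel_open open_ball)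
  qed
  have vol: "emeasure lborel (cone_sector c b) = (\<integral>\<^sup>+ t. ?s t \<partial>lborel)"
    using nn_integral_lborel_slices[OF b, of "indicator (cone_sector c b)"] by simp
  have int: "(\<integral>\<^sup>+ t. ennreal (K * t ^ m) * indicator {0..a} t \<partial>lborel) = ennreal (K * a ^ Suc m / real (Suc m))" if "0 \<le> a" for a
  proof -
    have "(\<integral>\<^sup>+ t. ennreal (K * t ^ m) * indicator {0..a} t \<partial>lborel) = (\<integral>\<^sup>+ t. ennreal K * (ennreal (t ^ m) * indicator {0..a} t) \<partial>lborel)"
      using K by (intro nn_integral_cong) (auto simp: indicator_def ennreal_mult)
    also have "\<dots> = ennreal K * ennreal (a ^ Suc m / real (Suc m))"
      using nn_integral_power_Icc[OF that, of m] by (simp add: nn_integral_cmult)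
    also have "\<dots> = ennreal (K * (a ^ Suc m / real (Suc m)))" using K that by (intro ennreal_mult[symmetric]) auto
    finally show ?thesis by simp
  qed
  have "emeasure lborel (cone_sector c b) \<le> (\<integral>\<^sup>+ t. ennreal (K * t ^ m) * indicator {0..1} t \<partial>lborel)"
    unfolding vol
  proof (rule nn_integral_mono)
    fix t :: real
    have "?s t \<le> (\<integral>\<^sup>+ x. indicator {0<..1} t * indicator (ball 0 ((s / c) * t)) x \<partial>?L)"
    proof (rule nn_integral_mono_AE)
      show "AE x in ?L. indicator (cone_sector c b) (x + t *\<^sub>R b) \<le>
          (indicator {0<..1} t * indicator (ball 0 ((s / c) * t)) x :: ennreal)"
        using AE_coord_lebesgue_orthogonal[OF b]
      proof eventually_elim
        case (elim x)
        then show ?case using cone_sector_slice(1)[OF b1 elim c, of t] by (auto simp: indicator_def s_def)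
      qed
    qed
    then show "?s t \<le> ennreal (K * t ^ m) * indicator {0..1} t"
      using disc[of t] by (cases "0 < t \<and> t \<le> 1") (auto simp: indicator_def)
  qed
  also have "\<dots> = ennreal (K / real (Suc m))" using int[of 1] by simp
  finally show "emeasure lborel (cone_sector c b) \<le> ennreal (unit_ball_vol (real m) * (s / c) ^ m / real (Suc m))"
    by (simp add: K_def)
  have "ennreal (K * c ^ Suc m / real (Suc m)) = (\<integral>\<^sup>+ t. ennreal (K * t ^ m) * indicator {0..c} t \<partial>lborel)"
    using int[of c] c by simp
  also have "\<dots> \<le> emeasure lborel (cone_sector c b)"
    unfolding vol
  proof (rule nn_integral_mono_AE)
    \<comment> \<open>At height zero the disc has radius zero and is empty, while \<open>0 ^ m\<close> is one if \<open>m\<close> is zero.\<close>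
    have "AE t in lborel. t \<noteq> (0::real)" by (rule AE_lborel_singleton)
    then show "AE t in lborel. ennreal (K * t ^ m) * indicator {0..c} t \<le> ?s t"
    proof eventually_elim
      case (elim t)
      show ?case
      proof (cases "0 \<le> t \<and> t \<le> c")
        case True
        then have t: "0 < t" "t \<le> c" using elim by auto
        have "(\<integral>\<^sup>+ x. indicator (ball 0 ((s / c) * t)) x \<partial>?L) \<le> ?s t"
        proof (rule nn_integral_mono_AE)
          show "AE x in ?L. (indicator (ball 0 ((s / c) * t)) x :: ennreal) \<le> indicator (cone_sector c b) (x + t *\<^sub>R b)"
            using AE_coord_lebesgue_orthogonal[OF b]
          proof eventually_elim
            case (elim x)
            then show ?case using cone_sector_slice(2)[OF b1 elim c t] by (auto simp: indicator_def s_def)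
          qed
        qed
        then show ?thesis using True disc[OF t(1)] by simp
      qed (auto simp: indicator_def)
    qed
  qed
  finally show "ennreal (unit_ball_vol (real m) * (s / c) ^ m * c ^ Suc m / real (Suc m)) \<le> emeasure lborel (cone_sector c b)"
    by (simp add: K_def)
qed

text \<open>After exchanging the integrals, the inner one, over \<open>w\<close>, is the same for all unit vectors \<open>u\<close> by
  reflection invariance.\<close>

lemma sphere_ball_average:
  fixes k :: "'a::euclidean_space \<Rightarrow> 'a \<Rightarrow> ennreal"
  assumes k: "case_prod k \<in> borel_measurable (borel \<Otimes>\<^sub>M borel)"
    and inv: "\<And>d u w. k (reflect d u) (reflect d w) = k u w" and b: "norm b = 1"
  shows "(\<integral>\<^sup>+ w. \<integral>\<^sup>+ u. k u w \<partial>surface_measure (sphere 0 1) \<partial>lborel) =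
    emeasure (surface_measure (sphere 0 1)) (sphere (0::'a) 1) * (\<integral>\<^sup>+ w. k b w \<partial>lborel)"
proof -
  let ?M = "surface_measure (sphere (0::'a) 1)"
  interpret M: finite_measure ?M by (rule finite_measure_sphere)
  interpret P: pair_sigma_finite ?M "lborel :: 'a measure"
    by (rule pair_sigma_finite.intro[OF M.sigma_finite_measure_axioms sigma_finite_lborel])
  have "case_prod k \<in> borel_measurable (?M \<Otimes>\<^sub>M lborel)"
    by (rule measurable_pair_borel[OF measurable_ident_surface_measure _ k]) simp
  then have "(\<integral>\<^sup>+ w. \<integral>\<^sup>+ u. k u w \<partial>?M \<partial>lborel) = (\<integral>\<^sup>+ u. \<integral>\<^sup>+ w. k u w \<partial>lborel \<partial>?M)" by (rule P.Fubini')
  also have "\<dots> = (\<integral>\<^sup>+ u. (\<integral>\<^sup>+ w. k b w \<partial>lborel) \<partial>?M)"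
  proof (rule nn_integral_cong)
    fix u assume "u \<in> space ?M"
    then have "reflect (u - b) u = b" using b by (intro reflect_swap) simp
    then have eq: "k u (reflect (u - b) w) = k b w" for w using inv[of "u - b" u "reflect (u - b) w"] by simp
    have "(\<lambda>w. k u w) \<in> borel_measurable borel" using measurable_compose[OF measurable_Pair1' k, of u] by simp
    from nn_integral_lborel_reflect[OF this, of "u - b"]
    show "(\<integral>\<^sup>+ w. k u w \<partial>lborel) = (\<integral>\<^sup>+ w. k b w \<partial>lborel)" by (simp add: eq)
  qed
  finally show ?thesis by (simp add: mult.commute)
qed

text \<open>Both sides integrate over all unit vectors \<open>u\<close> and all \<open>w\<close> in the unit ball, the indicator that the
  angle between \<open>u\<close> and \<open>w\<close> has a cosine greater than \<open>c\<close>. For fixed \<open>u\<close> this is the indicator of a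
  sector, for fixed \<open>w\<close> that of a cap.\<close>

lemma sphere_cap_average:
  fixes b :: "'a::euclidean_space"
  assumes b: "b \<in> Basis"
  shows "ennreal (unit_ball_vol (real DIM('a))) * emeasure (surface_measure (sphere 0 1)) (cap c b) =
    emeasure (surface_measure (sphere 0 1)) (sphere (0::'a) 1) * emeasure lborel (cone_sector c b)"
proof -
  let ?M = "surface_measure (sphere (0::'a) 1)"
  define k :: "'a \<Rightarrow> 'a \<Rightarrow> ennreal" where "k u w = indicator {p. norm (snd p) < 1 \<and> c * norm (snd p) < snd p \<bullet> fst p} (u, w)" for u w
  have b1: "norm b = 1" using b by simp
  have "case_prod k \<in> borel_measurable (borel \<Otimes>\<^sub>M borel)"
  proof -
    have "Measurable.pred (borel \<Otimes>\<^sub>M borel) (\<lambda>p :: 'a \<times> 'a. norm (snd p) < 1 \<and> c * norm (snd p) < snd p \<bullet> fst p)"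
      by measurable
    then have "{p :: 'a \<times> 'a. norm (snd p) < 1 \<and> c * norm (snd p) < snd p \<bullet> fst p} \<in> sets (borel \<Otimes>\<^sub>M borel)"
      by (simp add: pred_def space_pair_measure)
    then show ?thesis
      by (simp add: k_def[abs_def] split_beta' borel_measurable_indicator)
  qed
  from sphere_ball_average[OF this _ b1]
  have "(\<integral>\<^sup>+ w. \<integral>\<^sup>+ u. k u w \<partial>?M \<partial>lborel) = emeasure ?M (sphere 0 1) * (\<integral>\<^sup>+ w. k b w \<partial>lborel)"
    by (simp add: k_def indicator_def)
  moreover have "(\<integral>\<^sup>+ w. k b w \<partial>lborel) = (\<integral>\<^sup>+ w. indicator (cone_sector c b) w \<partial>lborel)"
    by (intro nn_integral_cong) (simp add: k_def cone_sector_def indicator_def)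
  ultimately have 1: "(\<integral>\<^sup>+ w. \<integral>\<^sup>+ u. k u w \<partial>?M \<partial>lborel) = emeasure ?M (sphere 0 1) * emeasure lborel (cone_sector c b)"
    by simp
  have "(\<integral>\<^sup>+ w. \<integral>\<^sup>+ u. k u w \<partial>?M \<partial>lborel) = (\<integral>\<^sup>+ w. emeasure ?M (cap c b) * indicator (ball (0::'a) 1) w \<partial>lborel)"
  proof (rule nn_integral_cong_AE)
    have "AE w in lborel. w \<noteq> (0::'a)" by (rule AE_lborel_singleton)
    then show "AE w in lborel. (\<integral>\<^sup>+ u. k u w \<partial>?M) = emeasure ?M (cap c b) * indicator (ball (0::'a) 1) w"
    proof eventually_elim
      case (elim w)
      define e where "e = w /\<^sub>R norm w"
      have e: "norm e = norm b" "w = norm w *\<^sub>R e" using elim b1 by (simp_all add: e_def)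
      have "(\<integral>\<^sup>+ u. k u w \<partial>?M) = (\<integral>\<^sup>+ u. indicator (ball 0 1) w * indicator (cap c e) u \<partial>?M)"
      proof (rule nn_integral_cong)
        fix u assume u: "u \<in> space ?M"
        have "w \<bullet> u = norm w * (u \<bullet> e)" by (subst e(2)) (simp add: inner_commute)
        then have "c * norm w < w \<bullet> u \<longleftrightarrow> c < u \<bullet> e" using elim by (simp add: mult.commute)
        then show "k u w = indicator (ball 0 1) w * indicator (cap c e) u"
          using u by (simp add: k_def indicator_def cap_def)
      qed
      also have "\<dots> = indicator (ball 0 1) w * emeasure ?M (cap c e)"
        by (simp add: nn_integral_cmult_indicator sets_cap)
      finally show ?case using emeasure_sphere_cap[OF e(1), of c] by (simp add: mult.commute)
    qed
  qed
  also have "\<dots> = emeasure ?M (cap c b) * ennreal (unit_ball_vol (real DIM('a)))"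
    by (simp add: nn_integral_cmult_indicator emeasure_ball)
  finally have 2: "(\<integral>\<^sup>+ w. \<integral>\<^sup>+ u. k u w \<partial>?M \<partial>lborel) = emeasure ?M (cap c b) * ennreal (unit_ball_vol (real DIM('a)))" .
  show ?thesis using 1 2 by (simp add: mult.commute)
qed

text \<open>As the opening angle of the cap tends to zero, the cap and its sector are both compared with the
  same flat disc, and the comparison becomes exact.\<close>

theorem emeasure_sphere:
  "emeasure (surface_measure (sphere 0 1)) (sphere (0::'a::euclidean_space) 1) =
    ennreal (real DIM('a) * unit_ball_vol (real DIM('a)))"
proof -
  let ?M = "surface_measure (sphere (0::'a) 1)"
  obtain b :: 'a where b: "b \<in> Basis" using nonempty_Basis by blast
  interpret M: finite_measure ?M by (rule finite_measure_sphere)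
  define m where "m = DIM('a) - 1"
  have n: "DIM('a) = Suc m" using DIM_positive[where 'a='a] by (simp add: m_def del: DIM_positive)
  define A where "A = measure ?M (sphere 0 1)"
  have A: "emeasure ?M (sphere 0 1) = ennreal A" "0 \<le> A" by (simp_all add: A_def M.emeasure_eq_measure)
  define v where "v = unit_ball_vol (real (Suc m))"
  define w where "w = unit_ball_vol (real m)"
  have vw: "0 < v" "0 < w" using unit_ball_vol_pos[of "real (Suc m)"] by (simp_all add: v_def w_def)
  have bounds: "real (Suc m) * v * c ^ m \<le> A \<and> A * c ^ Suc m \<le> real (Suc m) * v" if c: "0 < c" "c < 1" for c
  proof -
    define s where "s = sqrt (1 - c\<^sup>2)"
    have "c\<^sup>2 < 1" using c by (simp add: abs_square_less_1)
    then have s: "0 < s" by (simp add: s_def)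
    have cap: "emeasure ?M (cap c b) = hausdorff_outer m (cap c b)"
      unfolding m_def by (intro emeasure_surface_measure) (auto simp: cap_def)
    have avg: "ennreal v * emeasure ?M (cap c b) = ennreal A * emeasure lborel (cone_sector c b)"
      using sphere_cap_average[OF b, of c] by (simp only: A n v_def)
    have "ennreal (v * (w * s ^ m)) = ennreal v * ennreal (w * s ^ m)"
      using vw s by (intro ennreal_mult) auto
    also have "\<dots> \<le> ennreal v * emeasure ?M (cap c b)"
      unfolding cap using cap_lower_bound[OF b c] by (intro mult_left_mono) (simp_all add: s_def w_def m_def)
    also have "\<dots> = ennreal A * emeasure lborel (cone_sector c b)" by (rule avg)
    also have "\<dots> \<le> ennreal A * ennreal (w * (s / c) ^ m / real (Suc m))"
      using emeasure_cone_sector_bounds(1)[OF b c] by (intro mult_left_mono) (simp_all add: s_def w_def m_def)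
    also have "\<dots> = ennreal (A * (w * (s / c) ^ m / real (Suc m)))"
      using A vw s c by (intro ennreal_mult[symmetric]) auto
    finally have "v * (w * s ^ m) \<le> A * (w * (s / c) ^ m / real (Suc m))"
      using A vw s c by (subst (asm) ennreal_le_iff) auto
    also have "\<dots> = (w * s ^ m) * (A / (c ^ m * real (Suc m)))" by (simp add: power_divide)
    finally have "(w * s ^ m) * v \<le> (w * s ^ m) * (A / (c ^ m * real (Suc m)))" by (simp only: mult.commute)
    moreover have "0 < w * s ^ m" using vw s by simp
    ultimately have "v \<le> A / (c ^ m * real (Suc m))" by (simp only: mult_le_cancel_left_pos)
    then have lower: "real (Suc m) * v * c ^ m \<le> A" using c by (simp add: pos_le_divide_eq mult_ac)
    have "ennreal (A * (w * (s / c) ^ m * c ^ Suc m / real (Suc m))) = ennreal A * ennreal (w * (s / c) ^ m * c ^ Suc m / real (Suc m))"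
      using A vw s c by (intro ennreal_mult) auto
    also have "\<dots> \<le> ennreal A * emeasure lborel (cone_sector c b)"
      using emeasure_cone_sector_bounds(2)[OF b c] by (intro mult_left_mono) (simp_all add: s_def w_def m_def)
    also have "\<dots> = ennreal v * emeasure ?M (cap c b)" by (rule avg[symmetric])
    also have "\<dots> \<le> ennreal v * ennreal (w * (s / c) ^ m)"
      unfolding cap using cap_upper_bound[OF b c] by (intro mult_left_mono) (simp_all add: s_def w_def m_def)
    also have "\<dots> = ennreal (v * (w * (s / c) ^ m))"
      using vw s c by (intro ennreal_mult[symmetric]) auto
    finally have "A * (w * (s / c) ^ m * c ^ Suc m / real (Suc m)) \<le> v * (w * (s / c) ^ m)"
      using vw s c by (subst (asm) ennreal_le_iff) auto
    then have "(w * (s / c) ^ m) * (A * c ^ Suc m / real (Suc m)) \<le> (w * (s / c) ^ m) * v" by (simp add: mult_ac)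
    moreover have "0 < w * (s / c) ^ m" using vw s c by simp
    ultimately have "A * c ^ Suc m / real (Suc m) \<le> v" by (simp only: mult_le_cancel_left_pos)
    then have "A * c ^ Suc m \<le> real (Suc m) * v" by (simp add: pos_divide_le_eq mult_ac del: power_Suc of_nat_Suc)
    with lower show ?thesis by simp
  qed
  define c where "c k = 1 - inverse (real (Suc (Suc k)))" for k
  have c: "0 < c k" "c k < 1" for k by (simp_all add: c_def inverse_less_1_iff del: of_nat_Suc)
  have "c \<longlonglongrightarrow> 1 - 0" unfolding c_def
    by (intro tendsto_intros LIMSEQ_Suc[OF LIMSEQ_inverse_real_of_nat])
  then have c1: "c \<longlonglongrightarrow> 1" by simp
  have "(\<lambda>k. real (Suc m) * v * c k ^ m) \<longlonglongrightarrow> real (Suc m) * v * 1 ^ m"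
    by (intro tendsto_intros c1)
  then have "real (Suc m) * v * 1 ^ m \<le> A" by (rule LIMSEQ_le_const2) (use bounds c in auto)
  moreover have "(\<lambda>k. A * c k ^ Suc m) \<longlonglongrightarrow> A * 1 ^ Suc m"
    by (intro tendsto_intros c1)
  then have "A * 1 ^ Suc m \<le> real (Suc m) * v" by (rule LIMSEQ_le_const2) (use bounds c in blast)
  ultimately have "A = real (Suc m) * v" by simp
  then show ?thesis using A(1) by (simp only: n v_def)
qed

section \<open>The average of a linear functional over the sphere\<close>

text \<open>By the layer-cake formula: the points of norm exceeding \<open>t\<close> fill a spherical shell.\<close>

lemma nn_integral_ball_norm:
  "(\<integral>\<^sup>+ w. ennreal (norm w) * indicator (ball 0 1) w \<partial>(lborel :: 'a::euclidean_space measure)) =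
    ennreal (unit_ball_vol (real DIM('a)) * real DIM('a) / real (Suc DIM('a)))"
proof -
  define n where "n = DIM('a)"
  define v where "v = unit_ball_vol (real n)"
  have v: "0 \<le> v" by (simp add: v_def)
  define \<phi> where "\<phi> w = ennreal (norm w) * indicator (ball 0 1) w" for w :: 'a
  have [measurable]: "\<phi> \<in> borel_measurable borel" unfolding \<phi>_def[abs_def] by measurable
  have "min (\<phi> w) (ennreal 1) = \<phi> w" for w
    by (auto simp: \<phi>_def indicator_def min_absorb1 simp del: ennreal_1)
  then have "(\<integral>\<^sup>+ w. \<phi> w \<partial>lborel) = ennreal 1 * (\<integral>\<^sup>+ t. indicator {0<..<1} t * emeasure lborel {w. ennreal (1 * t) < \<phi> w} \<partial>lborel)"
    using lborel.nn_integral_layer_cake[of \<phi> 1] by simp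
  also have "\<dots> = (\<integral>\<^sup>+ t. indicator {0<..<1} t * emeasure lborel {w. ennreal (1 * t) < \<phi> w} \<partial>lborel)" by simp
  also have "\<dots> = (\<integral>\<^sup>+ t. ennreal (v * (1 - t ^ n)) * indicator {0..1} t \<partial>lborel)"
  proof (rule nn_integral_cong_AE)
    have "AE t in lborel. t \<noteq> (0::real)" "AE t in lborel. t \<noteq> (1::real)" by (rule AE_lborel_singleton)+
    then show "AE t in lborel. indicator {0<..<1} t * emeasure lborel {w. ennreal (1 * t) < \<phi> w} = ennreal (v * (1 - t ^ n)) * indicator {0..1} t"
    proof eventually_elim
      case (elim t)
      show ?case
      proof (cases "0 \<le> t \<and> t \<le> 1")
        case True
        then have t: "0 < t" "t < 1" using elim by auto
        have "{w. ennreal (1 * t) < \<phi> w} = ball 0 1 - cball 0 t"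
        proof (rule set_eqI)
          fix w
          show "w \<in> {w. ennreal (1 * t) < \<phi> w} \<longleftrightarrow> w \<in> ball 0 1 - cball 0 t"
            using t by (cases "norm w < 1") (simp_all add: \<phi>_def indicator_def ennreal_less_iff not_le)
        qed
        moreover have "emeasure lborel (ball (0::'a) 1 - cball 0 t) = emeasure lborel (ball (0::'a) 1) - emeasure lborel (cball (0::'a) t)"
        proof (rule emeasure_Diff)
          show "cball 0 t \<subseteq> ball (0::'a) 1" using t by auto
          show "emeasure lborel (cball (0::'a) t) \<noteq> \<infinity>" using emeasure_cball[of t "0::'a"] t by simp
        qed auto
        ultimately have "emeasure lborel {w. ennreal (1 * t) < \<phi> w} = emeasure lborel (ball (0::'a) 1) - emeasure lborel (cball (0::'a) t)"
          by (simp only:)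
        also have "\<dots> = ennreal (v * (1 - t ^ n))"
          using t v by (simp add: emeasure_ball emeasure_cball ennreal_minus n_def[symmetric] v_def[symmetric] algebra_simps)
        finally show ?thesis using t by simp
      qed (auto simp: indicator_def)
    qed
  qed
  also have "\<dots> = ennreal (v * (1 - 1 ^ Suc n / real (Suc n)) - v * (0 - 0 ^ Suc n / real (Suc n)))"
  proof (rule nn_integral_FTC_Icc[where F = "\<lambda>t. v * (t - t ^ Suc n / real (Suc n))"])
    fix t :: real assume "t \<in> {0..1}"
    then have t: "0 \<le> t" "t \<le> 1" by auto
    show "((\<lambda>t. v * (t - t ^ Suc n / real (Suc n))) has_real_derivative v * (1 - t ^ n)) (at t)"
      by (intro DERIV_cmult DERIV_diff DERIV_ident DERIV_power_Suc_divide)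
    show "0 \<le> v * (1 - t ^ n)" using v t by (simp add: power_le_one)
  qed auto
  also have "v * (1 - 1 ^ Suc n / real (Suc n)) - v * (0 - 0 ^ Suc n / real (Suc n)) = v * real n / real (Suc n)"
    by (simp add: field_simps)
  finally show ?thesis by (simp add: \<phi>_def v_def n_def)
qed

text \<open>The primitive \<open>sqrt (1 - t\<^sup>2) ^ (m + 2) / (m + 2)\<close> is obtained by the chain rule, which fails at the
  zeros of the root, so the fundamental theorem is used on open intervals; the absolute value forces a
  split at zero.\<close>

lemma nn_integral_abs_weighted_power:
  "(\<integral>\<^sup>+ t. ennreal (\<bar>t\<bar> * sqrt (1 - t\<^sup>2) ^ m) * indicator {-1..1} t \<partial>lborel) = ennreal (2 / real (m + 2))"
proof -
  let ?F = "\<lambda>t::real. sqrt (1 - t\<^sup>2) ^ (m + 2) / real (m + 2)"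
  have deriv: "(?F has_real_derivative - (t * sqrt (1 - t\<^sup>2) ^ m)) (at t)" if "-1 < t" "t < 1" for t
  proof -
    have pos: "0 < 1 - t\<^sup>2" using that by (simp add: abs_square_less_1[of t] abs_less_iff)
    have "((\<lambda>t. sqrt (1 - t\<^sup>2)) has_real_derivative (- t / sqrt (1 - t\<^sup>2))) (at t)"
      using pos by (auto intro!: derivative_eq_intros simp: field_simps)
    from DERIV_power[OF this, of "m + 2"]
    have "((\<lambda>t. sqrt (1 - t\<^sup>2) ^ (m + 2)) has_real_derivative real (m + 2) * (- t / sqrt (1 - t\<^sup>2) * sqrt (1 - t\<^sup>2) ^ (m + 1))) (at t)"
      by simp
    from DERIV_cdivide[OF this, of "real (m + 2)"]
    have "(?F has_real_derivative (- t / sqrt (1 - t\<^sup>2) * sqrt (1 - t\<^sup>2) ^ (m + 1))) (at t)" by simp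
    moreover have "- t / sqrt (1 - t\<^sup>2) * sqrt (1 - t\<^sup>2) ^ (m + 1) = - (t * sqrt (1 - t\<^sup>2) ^ m)"
      using pos by simp
    ultimately show ?thesis by simp
  qed
  have cont: "continuous_on S ?F" for S by (intro continuous_intros) auto
  have F: "?F 1 = 0" "?F (-1) = 0" "?F 0 = 1 / real (m + 2)" by simp_all
  have "((\<lambda>t. - (t * sqrt (1 - t\<^sup>2) ^ m)) has_integral (?F 0 - ?F (-1))) {-1..0}"
    using deriv cont by (intro fundamental_theorem_of_calculus_interior)
      (auto simp: has_real_derivative_iff_has_vector_derivative[symmetric])
  then have left: "((\<lambda>t. \<bar>t\<bar> * sqrt (1 - t\<^sup>2) ^ m) has_integral (1 / real (m + 2))) {-1..0}"
    unfolding F diff_zero by (rule has_integral_eq[rotated]) auto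
  have "((\<lambda>t. - (t * sqrt (1 - t\<^sup>2) ^ m)) has_integral (?F 1 - ?F 0)) {0..1}"
    using deriv cont by (intro fundamental_theorem_of_calculus_interior)
      (auto simp: has_real_derivative_iff_has_vector_derivative[symmetric])
  then have "((\<lambda>t. - (- (t * sqrt (1 - t\<^sup>2) ^ m))) has_integral - (?F 1 - ?F 0)) {0..1}"
    by (rule has_integral_neg)
  then have right: "((\<lambda>t. \<bar>t\<bar> * sqrt (1 - t\<^sup>2) ^ m) has_integral (1 / real (m + 2))) {0..1}"
    unfolding F diff_0 minus_minus by (rule has_integral_eq[rotated]) auto
  have "((\<lambda>t. \<bar>t\<bar> * sqrt (1 - t\<^sup>2) ^ m) has_integral (1 / real (m + 2) + 1 / real (m + 2))) {-1..1}"
    by (rule has_integral_combine[OF _ _ left right]) auto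
  then have "(\<integral>\<^sup>+ t. ennreal (\<bar>t\<bar> * sqrt (1 - t\<^sup>2) ^ m) * indicator {-1..1} t \<partial>lborel) = ennreal (1 / real (m + 2) + 1 / real (m + 2))"
    by (intro nn_integral_has_integral_lebesgue') (auto simp: abs_square_le_1)
  then show ?thesis by simp
qed

text \<open>Integrate over the slices orthogonal to \<open>b\<close>: at height \<open>t\<close> the slice is a disc of radius
  \<open>sqrt (1 - t\<^sup>2)\<close>.\<close>

lemma nn_integral_ball_abs_inner:
  fixes b :: "'a::euclidean_space"
  assumes b: "b \<in> Basis"
  shows "(\<integral>\<^sup>+ w. ennreal \<bar>w \<bullet> b\<bar> * indicator (ball 0 1) w \<partial>lborel) =
    ennreal (unit_ball_vol (real (DIM('a) - 1)) * (2 / real (Suc DIM('a))))"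
proof -
  let ?L = "coord_lebesgue (Basis - {b})"
  let ?f = "\<lambda>w. ennreal \<bar>w \<bullet> b\<bar> * indicator (ball 0 1) w"
  define m where "m = DIM('a) - 1"
  have n: "DIM('a) = Suc m" using DIM_positive[where 'a='a] by (simp add: m_def del: DIM_positive)
  define v where "v = unit_ball_vol (real m)"
  have v: "0 \<le> v" by (simp add: v_def)
  have b1: "norm b = 1" "b \<bullet> b = 1" using b by (simp_all add: inner_Basis_self)
  have "(\<integral>\<^sup>+ w. ?f w \<partial>lborel) =
      (\<integral>\<^sup>+ t. \<integral>\<^sup>+ x. ?f (x + t *\<^sub>R b) \<partial>?L \<partial>lborel)"
    by (rule nn_integral_lborel_slices[OF b]) measurable
  also have "\<dots> = (\<integral>\<^sup>+ t. ennreal v * (ennreal (\<bar>t\<bar> * sqrt (1 - t\<^sup>2) ^ m) * indicator {-1..1} t) \<partial>lborel)"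
  proof (rule nn_integral_cong_AE)
    have "AE t in lborel. t \<noteq> (-1::real)" "AE t in lborel. t \<noteq> (1::real)" by (rule AE_lborel_singleton)+
    then show "AE t in lborel. (\<integral>\<^sup>+ x. ?f (x + t *\<^sub>R b) \<partial>?L) =
        ennreal v * (ennreal (\<bar>t\<bar> * sqrt (1 - t\<^sup>2) ^ m) * indicator {-1..1} t)"
    proof eventually_elim
      case (elim t)
      define r where "r = sqrt (1 - t\<^sup>2)"
      have "(\<integral>\<^sup>+ x. ?f (x + t *\<^sub>R b) \<partial>?L) = (\<integral>\<^sup>+ x. ennreal \<bar>t\<bar> * indicator (ball 0 r) x \<partial>?L)"
      proof (rule nn_integral_cong_AE)
        show "AE x in ?L. ?f (x + t *\<^sub>R b) = ennreal \<bar>t\<bar> * indicator (ball 0 r) x"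
          using AE_coord_lebesgue_orthogonal[OF b]
        proof eventually_elim
          case (elim x)
          then show ?case
            using slice_ball[OF b1(1) elim, of 1 t 0] by (simp add: indicator_def inner_add_left b1 r_def)
        qed
      qed
      also have "\<dots> = ennreal \<bar>t\<bar> * emeasure ?L (ball 0 r)" by (simp add: nn_integral_cmult_indicator)
      also have "\<dots> = ennreal v * (ennreal (\<bar>t\<bar> * r ^ m) * indicator {-1..1} t)"
      proof (cases "-1 \<le> t \<and> t \<le> 1")
        case True
        then have "0 < r" using elim by (simp add: r_def abs_square_less_1[of t] abs_less_iff)
        moreover from this have "emeasure ?L (ball 0 r) = ennreal (v * r ^ m)"
          using emeasure_coord_lebesgue_ball[of "Basis - {b}" r] b by (simp add: card_Basis_minus m_def v_def)
        ultimately show ?thesis using True v by (simp add: ennreal_mult[symmetric] mult_ac)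
      next
        case False
        then have "r \<le> 0" using abs_square_le_1[of t] by (auto simp: r_def)
        then show ?thesis using False by (simp add: ball_empty indicator_def)
      qed
      finally show ?case by (simp add: r_def)
    qed
  qed
  also have "\<dots> = ennreal v * ennreal (2 / real (m + 2))"
    unfolding nn_integral_abs_weighted_power[symmetric] by (rule nn_integral_cmult) measurable
  also have "\<dots> = ennreal (v * (2 / real (m + 2)))" using v by (intro ennreal_mult[symmetric]) auto
  finally show ?thesis by (simp add: n v_def)
qed

text \<open>Average the integral over the unit ball, so that reflection invariance reduces it to the area of
  the sphere and two integrals over the ball.\<close>

theorem nn_integral_sphere_abs_inner:
  fixes v :: "'a::euclidean_space"
  assumes v: "norm v = 1"
  shows "(\<integral>\<^sup>+ u. ennreal \<bar>u \<bullet> v\<bar> \<partial>surface_measure (sphere 0 1)) = ennreal (2 * unit_ball_vol (real (DIM('a) - 1)))"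
proof -
  let ?M = "surface_measure (sphere (0::'a) 1)"
  obtain b :: 'a where b: "b \<in> Basis" using nonempty_Basis by blast
  have b1: "norm b = 1" using b by simp
  define J where "J = (\<integral>\<^sup>+ u. ennreal \<bar>u \<bullet> v\<bar> \<partial>?M)"
  have J: "(\<integral>\<^sup>+ u. ennreal \<bar>u \<bullet> e\<bar> \<partial>?M) = J" if "norm e = 1" for e
    unfolding J_def by (rule sphere_integral_eq) (use that v in auto)
  define k :: "'a \<Rightarrow> 'a \<Rightarrow> ennreal" where "k u w = ennreal \<bar>w \<bullet> u\<bar> * indicator (ball 0 1) w" for u w
  have "case_prod k \<in> borel_measurable (borel \<Otimes>\<^sub>M borel)"
    unfolding k_def[abs_def] split_beta' by measurable
  from sphere_ball_average[OF this _ b1]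
  have "(\<integral>\<^sup>+ w. \<integral>\<^sup>+ u. k u w \<partial>?M \<partial>lborel) = emeasure ?M (sphere 0 1) * (\<integral>\<^sup>+ w. k b w \<partial>lborel)"
    by (simp add: k_def indicator_def)
  then have 1: "(\<integral>\<^sup>+ w. \<integral>\<^sup>+ u. k u w \<partial>?M \<partial>lborel) =
      ennreal (real DIM('a) * unit_ball_vol (real DIM('a))) * ennreal (unit_ball_vol (real (DIM('a) - 1)) * (2 / real (Suc DIM('a))))"
    unfolding emeasure_sphere unfolding k_def nn_integral_ball_abs_inner[OF b] .
  have "(\<integral>\<^sup>+ w. \<integral>\<^sup>+ u. k u w \<partial>?M \<partial>lborel) = (\<integral>\<^sup>+ w. J * (ennreal (norm w) * indicator (ball (0::'a) 1) w) \<partial>lborel)"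
  proof (rule nn_integral_cong_AE)
    have "AE w in lborel. w \<noteq> (0::'a)" by (rule AE_lborel_singleton)
    then show "AE w in lborel. (\<integral>\<^sup>+ u. k u w \<partial>?M) = J * (ennreal (norm w) * indicator (ball (0::'a) 1) w)"
    proof eventually_elim
      case (elim w)
      define e where "e = w /\<^sub>R norm w"
      have e: "norm e = 1" "w = norm w *\<^sub>R e" using elim by (simp_all add: e_def)
      have [measurable]: "(\<lambda>u. ennreal \<bar>u \<bullet> e\<bar>) \<in> borel_measurable ?M"
        by (rule measurable_surface_measure) measurable
      have "(\<integral>\<^sup>+ u. k u w \<partial>?M) = (\<integral>\<^sup>+ u. (ennreal (norm w) * indicator (ball 0 1) w) * ennreal \<bar>u \<bullet> e\<bar> \<partial>?M)"
      proof (rule nn_integral_cong)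
        fix u
        have "w \<bullet> u = norm w * (u \<bullet> e)" by (subst e(2)) (simp add: inner_commute)
        then have "\<bar>w \<bullet> u\<bar> = norm w * \<bar>u \<bullet> e\<bar>" by (simp add: abs_mult)
        then show "k u w = (ennreal (norm w) * indicator (ball 0 1) w) * ennreal \<bar>u \<bullet> e\<bar>"
          by (simp add: k_def ennreal_mult mult_ac)
      qed
      also have "\<dots> = (ennreal (norm w) * indicator (ball 0 1) w) * J"
        unfolding J[OF e(1), symmetric] by (rule nn_integral_cmult) measurable
      finally show ?case by (simp only: mult.commute)
    qed
  qed
  also have "\<dots> = J * (\<integral>\<^sup>+ w. ennreal (norm w) * indicator (ball (0::'a) 1) w \<partial>lborel)"
    by (rule nn_integral_cmult) measurable
  finally have 2: "(\<integral>\<^sup>+ w. \<integral>\<^sup>+ u. k u w \<partial>?M \<partial>lborel) = J * ennreal (unit_ball_vol (real DIM('a)) * real DIM('a) / real (Suc DIM('a)))"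
    unfolding nn_integral_ball_norm .
  define a where "a = unit_ball_vol (real DIM('a)) * real DIM('a) / real (Suc DIM('a))"
  define p where "p = 2 * unit_ball_vol (real (DIM('a) - 1))"
  have "0 < unit_ball_vol (real DIM('a))" by simp
  then have a: "0 < a" unfolding a_def using DIM_positive[where 'a='a]
    by (intro divide_pos_pos mult_pos_pos) (simp_all del: DIM_positive)
  have p: "0 \<le> p" by (simp add: p_def)
  have "J * ennreal a = ennreal (unit_ball_vol (real (DIM('a) - 1)) * (2 / real (Suc DIM('a)))) * ennreal (real DIM('a) * unit_ball_vol (real DIM('a)))"
    using 1 2 by (simp only: a_def mult.commute)
  also have "\<dots> = ennreal ((unit_ball_vol (real (DIM('a) - 1)) * (2 / real (Suc DIM('a)))) * (real DIM('a) * unit_ball_vol (real DIM('a))))"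
    by (intro ennreal_mult[symmetric]) auto
  also have "(unit_ball_vol (real (DIM('a) - 1)) * (2 / real (Suc DIM('a)))) * (real DIM('a) * unit_ball_vol (real DIM('a))) = p * a"
    by (simp add: a_def p_def mult_ac)
  also have "ennreal (p * a) = ennreal p * ennreal a" using p a by (intro ennreal_mult) auto
  finally have "ennreal a * J = ennreal a * ennreal p" by (simp only: mult.commute)
  then have "J = ennreal p" using a by (simp add: ennreal_mult_cancel_left ennreal_eq_0_iff)
  then show ?thesis by (simp only: J_def p_def)
qed

section \<open>Measurability of the outward normal\<close>

text \<open>Truncation to the unit ball makes the integral exist for every Borel set.\<close>

definition first_moment :: "'a::euclidean_space set \<Rightarrow> 'a" where
  "first_moment A = (\<integral> y. indicator (A \<inter> ball 0 1) y *\<^sub>R y \<partial>lborel)"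

lemma integrable_indicator_bounded:
  fixes f :: "'a::euclidean_space \<Rightarrow> 'b::euclidean_space"
  assumes [measurable]: "f \<in> borel_measurable borel" and f: "\<And>y. norm (f y) \<le> indicator (ball 0 1) y"
  shows "integrable lborel f"
proof (rule Bochner_Integration.integrable_bound)
  show "integrable lborel (indicator (ball 0 1) :: 'a \<Rightarrow> real)"
    by (simp add: integrable_indicator_iff emeasure_ball)
qed (use f in auto)

lemma integrable_first_moment:
  assumes [measurable]: "A \<in> sets borel"
  shows "integrable lborel (\<lambda>y::'a::euclidean_space. indicator (A \<inter> ball 0 1) y *\<^sub>R y)"
proof (rule integrable_indicator_bounded)
  have "A \<inter> ball 0 1 \<in> sets borel" by auto
  then show "(\<lambda>y. indicator (A \<inter> ball 0 1) y *\<^sub>R y) \<in> borel_measurable borel" by measurable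
  show "norm (indicator (A \<inter> ball 0 1) y *\<^sub>R y) \<le> indicator (ball 0 1) y" for y
    by (auto simp: indicator_def)
qed

lemma norm_first_moment_diff_le:
  fixes A B :: "'a::euclidean_space set"
  assumes [measurable]: "A \<in> sets borel" "B \<in> sets borel"
  shows "norm (first_moment A - first_moment B) \<le> measure lborel (((A - B) \<union> (B - A)) \<inter> ball 0 1)"
proof -
  let ?D = "((A - B) \<union> (B - A)) \<inter> ball 0 1"
  have D: "?D \<in> sets borel" by auto
  have intD: "integrable lborel (indicator ?D :: 'a \<Rightarrow> real)"
    using D by (intro integrable_indicator_bounded) (auto simp: indicator_def)
  note ints = integrable_first_moment[OF assms(1)] integrable_first_moment[OF assms(2)]
  have "first_moment A - first_moment B = (\<integral> y. indicator (A \<inter> ball 0 1) y *\<^sub>R y - indicator (B \<inter> ball 0 1) y *\<^sub>R y \<partial>lborel)"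
    unfolding first_moment_def using ints by (intro Bochner_Integration.integral_diff[symmetric]) auto
  also have "norm \<dots> \<le> (\<integral> y. norm (indicator (A \<inter> ball 0 1) y *\<^sub>R y - indicator (B \<inter> ball 0 1) y *\<^sub>R y) \<partial>lborel)"
    by (rule integral_norm_bound)
  also have "\<dots> \<le> (\<integral> y. indicator ?D y \<partial>lborel)"
  proof (rule integral_mono)
    show "integrable lborel (\<lambda>y. norm (indicator (A \<inter> ball 0 1) y *\<^sub>R y - indicator (B \<inter> ball 0 1) y *\<^sub>R y))"
      using ints by (intro integrable_norm Bochner_Integration.integrable_diff)
  qed (rule intD, auto simp: indicator_def)
  also have "\<dots> = measure lborel ?D" using D by simp
  finally show ?thesis .
qed

text \<open>Reflections in vectors orthogonal to \<open>v\<close> preserve the half ball, so its first moment is a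
  multiple of \<open>v\<close>; the coefficient is negative because all its points are on one side.\<close>

lemma first_moment_half_space:
  fixes v :: "'a::euclidean_space"
  assumes v: "norm v = 1"
  shows "\<exists>\<kappa>>0. first_moment {y. y \<bullet> v < 0} = - \<kappa> *\<^sub>R v"
proof -
  let ?A = "{y. y \<bullet> v < 0}"
  define J where "J = first_moment ?A"
  have A [measurable]: "?A \<in> sets borel" by measurable
  have vv: "v \<bullet> v = 1" using v by (simp add: norm_eq_1)
  have inner: "J \<bullet> w = (\<integral> y. indicator (?A \<inter> ball 0 1) y * (y \<bullet> w) \<partial>lborel)" for w
    unfolding J_def first_moment_def
    by (subst integral_inner_left[symmetric]) (auto intro: integrable_first_moment[OF A])
  have AB [measurable]: "?A \<inter> ball 0 1 \<in> sets borel" by auto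
  have orth: "J \<bullet> w = 0" if w: "w \<bullet> v = 0" for w
  proof -
    have "(\<integral> y. indicator (?A \<inter> ball 0 1) y * (y \<bullet> w) \<partial>lborel) =
        (\<integral> y. indicator (?A \<inter> ball 0 1) (reflect w y) * (reflect w y \<bullet> w) \<partial>lborel)"
      by (rule integral_lborel_reflect[symmetric]) measurable
    also have "\<dots> = (\<integral> y. - (indicator (?A \<inter> ball 0 1) y * (y \<bullet> w)) \<partial>lborel)"
    proof (rule Bochner_Integration.integral_cong)
      fix y
      have "reflect w y \<bullet> v = y \<bullet> v" using w by (simp add: reflect_def inner_diff_left)
      then show "indicator (?A \<inter> ball 0 1) (reflect w y) * (reflect w y \<bullet> w) = - (indicator (?A \<inter> ball 0 1) y * (y \<bullet> w))"
        by (simp add: inner_reflect_axis indicator_def)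
    qed simp
    also have "\<dots> = - (\<integral> y. indicator (?A \<inter> ball 0 1) y * (y \<bullet> w) \<partial>lborel)" by simp
    finally show ?thesis by (simp add: inner)
  qed
  define w where "w = J - (J \<bullet> v) *\<^sub>R v"
  have wv: "w \<bullet> v = 0" by (simp add: w_def inner_diff_left vv)
  have "w \<bullet> w = J \<bullet> w - (J \<bullet> v) * (v \<bullet> w)" by (simp add: w_def inner_diff_left)
  also have "\<dots> = 0" using orth[OF wv] wv by (simp add: inner_commute)
  finally have J: "J = (J \<bullet> v) *\<^sub>R v" by (simp add: w_def)
  let ?f = "\<lambda>y. - (indicator (?A \<inter> ball 0 1) y * (y \<bullet> v))"
  have f: "integrable lborel ?f" "\<And>y. 0 \<le> ?f y"
  proof -
    show "integrable lborel ?f"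
    proof (rule integrable_indicator_bounded)
      fix y :: 'a
      have "\<bar>y \<bullet> v\<bar> \<le> norm y" using Cauchy_Schwarz_ineq2[of y v] v by simp
      then show "norm (?f y) \<le> indicator (ball 0 1) y" by (auto simp: indicator_def)
    qed measurable
  qed (auto simp: indicator_def)
  have "- (J \<bullet> v) = integral\<^sup>L lborel ?f" by (simp add: inner)
  moreover have "integral\<^sup>L lborel ?f \<noteq> 0"
  proof
    assume "integral\<^sup>L lborel ?f = 0"
    then have "AE y in lborel. ?f y = 0"
      by (subst (asm) integral_nonneg_eq_0_iff_AE[OF f(1)]) (use f(2) in auto)
    then have "AE y in lborel. y \<notin> ?A \<inter> ball 0 1" by eventually_elim (auto simp: indicator_def)
    then have "?A \<inter> ball 0 1 \<in> null_sets lborel" using AB by (subst AE_iff_null_sets) auto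
    then have "negligible (?A \<inter> ball 0 1)" by (simp add: negligible_iff_null_sets null_sets_completionI)
    moreover have "open (?A \<inter> ball 0 1)" by (intro open_Int open_Collect_less continuous_intros open_ball)
    moreover have "- (v /\<^sub>R 2) \<in> ?A \<inter> ball 0 1" using v vv by simp
    ultimately show False using open_not_negligible by blast
  qed
  moreover have "0 \<le> integral\<^sup>L lborel ?f" using f(2) by (intro Bochner_Integration.integral_nonneg) auto
  ultimately have "0 < - (J \<bullet> v)" by linarith
  then show ?thesis using J unfolding J_def[symmetric] by (intro exI[of _ "- (J \<bullet> v)"]) simp
qed

lemma measure_lborel_blow_up:
  fixes S :: "'a::euclidean_space set"
  assumes [measurable]: "S \<in> sets borel" and r: "0 < r"
  shows "measure lborel {y. q + r *\<^sub>R y \<in> S} = measure lborel S / r ^ DIM('a)"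
proof -
  have "{y. q + r *\<^sub>R y \<in> S} \<in> sets borel" by measurable
  then have "(\<integral>\<^sup>+ y. indicator {y. q + r *\<^sub>R y \<in> S} y \<partial>lborel) = emeasure lborel {y. q + r *\<^sub>R y \<in> S}"
    by simp
  moreover have "(\<integral>\<^sup>+ y. indicator S (q + r *\<^sub>R y) \<partial>lborel) = (\<integral>\<^sup>+ y. indicator {y. q + r *\<^sub>R y \<in> S} y \<partial>lborel)"
    by (intro nn_integral_cong) (simp add: indicator_def)
  ultimately have "emeasure lborel S = ennreal (r ^ DIM('a)) * emeasure lborel {y. q + r *\<^sub>R y \<in> S}"
    using nn_integral_lborel_affine[of "indicator S" r q] r by simp
  then have "measure lborel S = r ^ DIM('a) * measure lborel {y. q + r *\<^sub>R y \<in> S}"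
    using r by (simp add: measure_def enn2real_mult)
  then show ?thesis using r by simp
qed

text \<open>Blowing up \<open>K\<close> at \<open>q\<close> turns the two density conditions on \<open>v\<close> into convergence in measure,
  inside the unit ball, to the half space below \<open>v\<close>.\<close>

lemma first_moment_blow_up:
  fixes K :: "'a::euclidean_space set"
  assumes K [measurable]: "K \<in> sets borel" and v: "is_outward_unit_normal K q v"
  shows "((\<lambda>r. first_moment {y. q + r *\<^sub>R y \<in> K}) \<longlongrightarrow> first_moment {y. y \<bullet> v < 0}) (at_right 0)"
proof -
  define S1 where "S1 r = {x \<in> ball q r. (x - q) \<bullet> v > 0} \<inter> K" for r
  define S2 where "S2 r = {x \<in> ball q r. (x - q) \<bullet> v < 0} - K" for r
  have [measurable]: "S1 r \<in> sets borel" "S2 r \<in> sets borel" for r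
    unfolding S1_def S2_def by measurable
  define g where "g r = measure lebesgue (S1 r) / r ^ DIM('a) + measure lebesgue (S2 r) / r ^ DIM('a)" for r
  have nv: "norm v = 1" "v \<noteq> 0" using v by (auto simp: is_outward_unit_normal_def)
  have "(g \<longlongrightarrow> 0 + 0) (at_right 0)"
    unfolding g_def S1_def S2_def using v by (intro tendsto_add) (auto simp: is_outward_unit_normal_def)
  then have g: "(g \<longlongrightarrow> 0) (at_right 0)" by simp
  have bound: "norm (first_moment {y. q + r *\<^sub>R y \<in> K} - first_moment {y. y \<bullet> v < 0}) \<le> g r" if r: "0 < r" for r
  proof -
    let ?A = "{y. q + r *\<^sub>R y \<in> K}" and ?B = "{y. y \<bullet> v < 0}"
    let ?T1 = "{y. q + r *\<^sub>R y \<in> S1 r}" and ?T2 = "{y. q + r *\<^sub>R y \<in> S2 r}" and ?H = "{y. v \<bullet> y = 0} \<inter> ball 0 1"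
    have in_ball: "q + r *\<^sub>R y \<in> ball q r \<longleftrightarrow> y \<in> ball 0 1" for y
      using r by (simp add: dist_norm)
    have inner: "(q + r *\<^sub>R y - q) \<bullet> v = r * (y \<bullet> v)" for y by simp
    have T1: "y \<in> ?T1 \<longleftrightarrow> y \<in> ball 0 1 \<and> y \<bullet> v > 0 \<and> y \<in> ?A" for y
      unfolding S1_def mem_Collect_eq Int_iff in_ball inner using r by (simp add: zero_less_mult_iff)
    have T2: "y \<in> ?T2 \<longleftrightarrow> y \<in> ball 0 1 \<and> y \<bullet> v < 0 \<and> y \<notin> ?A" for y
      unfolding S2_def mem_Collect_eq Diff_iff in_ball inner using r by (simp add: mult_less_0_iff)
    have meas: "?A \<in> sets borel" "?B \<in> sets borel" "?T1 \<in> sets borel" "?T2 \<in> sets borel" "?H \<in> sets borel"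
      by (measurable; simp)+
    have ball_fin: "ball 0 1 \<in> fmeasurable (lborel :: 'a measure)"
      by (simp add: fmeasurable_def emeasure_ball)
    have sub: "((?A - ?B) \<union> (?B - ?A)) \<inter> ball 0 1 \<subseteq> ?T1 \<union> ?T2 \<union> ?H"
    proof
      fix y assume y: "y \<in> ((?A - ?B) \<union> (?B - ?A)) \<inter> ball 0 1"
      consider "y \<bullet> v < 0" | "y \<bullet> v = 0" | "y \<bullet> v > 0" by linarith
      then show "y \<in> ?T1 \<union> ?T2 \<union> ?H"
        using y unfolding Un_iff T1 T2 by cases (simp_all add: inner_commute)
    qed
    have "?T1 \<union> ?T2 \<union> ?H \<subseteq> ball 0 1" using T1 T2 by blast
    then have fin: "?T1 \<union> ?T2 \<union> ?H \<in> fmeasurable lborel"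
      using meas by (intro fmeasurableI2[OF ball_fin]) auto
    have "negligible {y. v \<bullet> y = 0}" by (rule negligible_hyperplane) (simp add: nv(2))
    then have "negligible ?H" by (rule negligible_subset) (rule Int_lower1)
    then have "measure lebesgue ?H = 0" by (rule negligible_imp_measure0)
    then have H0: "measure lborel ?H = 0" using measure_completion[of ?H lborel] meas(5) by (metis sets_lborel)
    have T1m: "measure lborel ?T1 = measure lebesgue (S1 r) / r ^ DIM('a)"
      using measure_lborel_blow_up[of "S1 r" r q] r by simp
    have T2m: "measure lborel ?T2 = measure lebesgue (S2 r) / r ^ DIM('a)"
      using measure_lborel_blow_up[of "S2 r" r q] r by simp
    have "norm (first_moment ?A - first_moment ?B) \<le> measure lborel (((?A - ?B) \<union> (?B - ?A)) \<inter> ball 0 1)"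
      using meas by (intro norm_first_moment_diff_le)
    also have "\<dots> \<le> measure lborel (?T1 \<union> ?T2 \<union> ?H)"
      using meas by (intro measure_mono_fmeasurable[OF sub _ fin]) auto
    also have "\<dots> \<le> measure lborel (?T1 \<union> ?T2) + measure lborel ?H"
      using meas by (intro measure_Un_le) auto
    also have "\<dots> \<le> measure lborel ?T1 + measure lborel ?T2 + measure lborel ?H"
      using meas by (intro add_right_mono measure_Un_le) auto
    also have "\<dots> = g r" unfolding H0 T1m T2m g_def by simp
    finally show ?thesis .
  qed
  have "((\<lambda>r. first_moment {y. q + r *\<^sub>R y \<in> K} - first_moment {y. y \<bullet> v < 0}) \<longlongrightarrow> 0) (at_right 0)"
  proof (rule Lim_null_comparison[OF _ g])
    show "\<forall>\<^sub>F r in at_right 0. norm (first_moment {y. q + r *\<^sub>R y \<in> K} - first_moment {y. y \<bullet> v < 0}) \<le> g r"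
      using eventually_at_right_less[of "0::real"] by eventually_elim (rule bound)
  qed
  then show ?thesis by (rule LIM_zero_cancel)
qed

text \<open>A Borel version of the outward normal, defined at all points; \<open>lim\<close> is an arbitrary vector where the
  limit does not exist.\<close>

definition limit_normal :: "'a::euclidean_space set \<Rightarrow> 'a \<Rightarrow> 'a" where
  "limit_normal K q = - sgn (lim (\<lambda>k. first_moment {y. q + inverse (real (Suc k)) *\<^sub>R y \<in> K}))"

text \<open>The limit is a negative multiple of \<open>v\<close>, so \<open>sgn\<close> discards the unknown coefficient. In particular the
  normal is unique.\<close>

lemma limit_normal_eq:
  assumes "K \<in> sets borel" "is_outward_unit_normal K q v"
  shows "limit_normal K q = v"
proof -
  have nv: "norm v = 1" using assms by (simp add: is_outward_unit_normal_def)
  obtain \<kappa> where \<kappa>: "0 < \<kappa>" "first_moment {y. y \<bullet> v < 0} = - \<kappa> *\<^sub>R v"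
    using first_moment_half_space[OF nv] by blast
  have "filterlim (\<lambda>k. inverse (real (Suc k))) (at_right 0) sequentially"
    using LIMSEQ_inverse_real_of_nat by (auto simp: filterlim_at intro!: always_eventually)
  from filterlim_compose[OF first_moment_blow_up[OF assms] this]
  have "lim (\<lambda>k. first_moment {y. q + inverse (real (Suc k)) *\<^sub>R y \<in> K}) = - \<kappa> *\<^sub>R v"
    unfolding \<kappa>(2) by (rule limI)
  then show ?thesis using \<kappa>(1) nv by (simp add: limit_normal_def sgn_scaleR sgn_minus sgn_div_norm)
qed

lemma outward_unit_normal_eq_limit_normal:
  assumes "K \<in> sets borel" "\<exists>v. is_outward_unit_normal K q v"
  shows "outward_unit_normal K q = limit_normal K q" "norm (limit_normal K q) = 1"
proof -
  obtain v where v: "is_outward_unit_normal K q v" using assms by blast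
  have "outward_unit_normal K q = v"
    unfolding outward_unit_normal_def
    using v limit_normal_eq[OF assms(1)] by (intro the_equality) auto
  then show "outward_unit_normal K q = limit_normal K q" "norm (limit_normal K q) = 1"
    using limit_normal_eq[OF assms(1) v] v by (auto simp: is_outward_unit_normal_def)
qed

lemma borel_measurable_limit_normal:
  fixes K :: "'a::euclidean_space set"
  assumes K [measurable]: "K \<in> sets borel"
  shows "limit_normal K \<in> borel_measurable borel"
proof -
  have "(\<lambda>q. first_moment {y. q + c *\<^sub>R y \<in> K}) \<in> borel_measurable borel" for c
  proof -
    have "(\<lambda>q. \<integral> y. (indicator K (q + c *\<^sub>R y) * indicator (ball 0 1) y) *\<^sub>R y \<partial>lborel) \<in> borel_measurable (borel :: 'a measure)"
      by measurable
    moreover have "(\<integral> y. (indicator K (q + c *\<^sub>R y) * indicator (ball 0 1) y) *\<^sub>R y \<partial>lborel) = first_moment {y. q + c *\<^sub>R y \<in> K}" for q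
      unfolding first_moment_def by (intro Bochner_Integration.integral_cong) (auto simp: indicator_def)
    ultimately show ?thesis by simp
  qed
  then have [measurable]: "(\<lambda>q. first_moment {y. q + inverse (real (Suc k)) *\<^sub>R y \<in> K}) \<in> borel_measurable borel" for k .
  show ?thesis unfolding limit_normal_def[abs_def] sgn_div_norm by measurable
qed

section \<open>Rectifiable sets and the surface area formula\<close>

text \<open>A reflection carries the subspace into a coordinate hyperplane.\<close>

lemma hausdorff_outer_bounded_subspace_finite:
  fixes V :: "'a::euclidean_space set"
  assumes V: "subspace V" "dim V = DIM('a) - 1"
  shows "hausdorff_outer (DIM('a) - 1) (V \<inter> cball 0 r) < \<infinity>"
proof -
  have "dim V < DIM('a)" using V(2) DIM_positive[where 'a='a] by linarith
  then obtain a where a: "a \<noteq> 0" "span V \<subseteq> {x. a \<bullet> x = 0}" using lowdim_subset_hyperplane by blast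
  obtain b :: 'a where b: "b \<in> Basis" using nonempty_Basis by blast
  define e where "e = a /\<^sub>R norm a"
  have e: "norm e = norm b" using a(1) b by (simp add: e_def)
  have orth: "x \<bullet> e = 0" if "x \<in> V" for x
    using a(2) span_base[OF that] by (auto simp: e_def inner_commute)
  have "reflect (e - b) ` (V \<inter> cball 0 r) \<subseteq> ball 0 (\<bar>r\<bar> + 1) \<inter> {x. x \<bullet> b = 0}"
  proof
    fix y assume "y \<in> reflect (e - b) ` (V \<inter> cball 0 r)"
    then obtain x where x: "x \<in> V" "norm x \<le> r" "y = reflect (e - b) x" by auto
    have "y \<bullet> b = x \<bullet> e" using inner_reflect[of "e - b" x e] reflect_swap[OF e] x(3) by simp
    then show "y \<in> ball 0 (\<bar>r\<bar> + 1) \<inter> {x. x \<bullet> b = 0}" using orth[OF x(1)] x by simp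
  qed
  then have "hausdorff_outer (DIM('a) - 1) (reflect (e - b) ` (V \<inter> cball 0 r)) \<le>
      hausdorff_outer (DIM('a) - 1) (ball 0 (\<bar>r\<bar> + 1) \<inter> {x. x \<bullet> b = 0})"
    by (rule hausdorff_outer_mono)
  also have "\<dots> < \<infinity>" using hausdorff_outer_disc[OF b, of "\<bar>r\<bar> + 1"] by simp
  finally show ?thesis by (simp add: hausdorff_outer_isometry_image)
qed

text \<open>The Lipschitz images of bounded pieces of the subspace have finite measure and cover all but a null set.
  They are compact, hence Borel sets.\<close>

lemma sigma_finite_surface_measure:
  fixes S :: "'a::euclidean_space set"
  assumes S: "S \<in> sets borel" and rect: "rectifiable (DIM('a) - 1) S"
  shows "sigma_finite_measure (surface_measure S)"
proof -
  obtain V and f :: "nat \<Rightarrow> 'a \<Rightarrow> 'a" where V: "subspace V" "dim V = DIM('a) - 1"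
    and f: "\<And>i. \<exists>L. L-lipschitz_on V (f i)" and null: "hausdorff_outer (DIM('a) - 1) (S - (\<Union>i. f i ` V)) = 0"
    using rect unfolding rectifiable_def by blast
  define P where "P i k = f i ` (V \<inter> cball 0 (real k))" for i k :: nat
  have compact: "compact (P i k)" for i k
  proof -
    obtain L where "L-lipschitz_on V (f i)" using f by blast
    then have "continuous_on (V \<inter> cball 0 (real k)) (f i)"
      by (intro continuous_on_subset[OF lipschitz_on_continuous_on]) auto
    moreover have "compact (V \<inter> cball 0 (real k))"
      using V(1) by (intro closed_Int_compact closed_subspace compact_cball)
    ultimately show ?thesis unfolding P_def by (rule compact_continuous_image)
  qed
  then have P_sets [measurable]: "P i k \<in> sets borel" for i k by (rule borel_compact)
  have P_fin: "hausdorff_outer (DIM('a) - 1) (P i k) < \<infinity>" for i k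
  proof -
    obtain L where L: "L-lipschitz_on V (f i)" using f by blast
    then have "(max L 1)-lipschitz_on (V \<inter> cball 0 (real k)) (f i)"
      by (intro lipschitz_on_mono[OF L]) auto
    then have "hausdorff_outer (DIM('a) - 1) (P i k) \<le>
        ennreal (max L 1 ^ (DIM('a) - 1)) * hausdorff_outer (DIM('a) - 1) (V \<inter> cball 0 (real k))"
      unfolding P_def by (rule hausdorff_outer_lipschitz_image) simp
    also have "\<dots> < \<infinity>"
      using hausdorff_outer_bounded_subspace_finite[OF V] by (simp add: ennreal_mult_less_top)
    finally show ?thesis .
  qed
  have cover: "(\<Union>i. f i ` V) = (\<Union>i k. P i k)"
  proof -
    have "V = (\<Union>k. V \<inter> cball 0 (real k))"
    proof -
      have "\<exists>k. x \<in> cball 0 (real k)" for x :: 'a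
        using real_arch_simple[of "norm x"] by simp
      then show ?thesis by auto
    qed
    then have "f i ` V = (\<Union>k. P i k)" for i
      unfolding P_def image_UN[symmetric] by simp
    then show ?thesis by simp
  qed
  define N where "N = S - (\<Union>i k. P i k)"
  have N [measurable]: "N \<in> sets borel" unfolding N_def using S by (intro sets.Diff sets.countable_UN) auto
  have in_sets: "A \<in> sets (surface_measure S)" if "A \<in> sets borel" "A \<subseteq> S" for A
    using that by (rule sets_surface_measureI)
  let ?\<A> = "insert N (range (\<lambda>(i, k). S \<inter> P i k))"
  show ?thesis
  proof
    show "\<exists>A. countable A \<and> A \<subseteq> sets (surface_measure S) \<and> \<Union> A = space (surface_measure S) \<and>
        (\<forall>a\<in>A. emeasure (surface_measure S) a \<noteq> \<infinity>)"
    proof (intro exI[of _ ?\<A>] conjI ballI)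
      show "countable ?\<A>" by auto
      show "?\<A> \<subseteq> sets (surface_measure S)"
        using S by (auto intro!: in_sets simp: N_def)
      show "\<Union> ?\<A> = space (surface_measure S)" by (auto simp: N_def)
      fix A assume "A \<in> ?\<A>"
      then consider "A = N" | i k where "A = S \<inter> P i k" by auto
      then show "emeasure (surface_measure S) A \<noteq> \<infinity>"
      proof cases
        case 1
        have "emeasure (surface_measure S) N = hausdorff_outer (DIM('a) - 1) N"
          using S by (intro emeasure_surface_measure) (auto simp: N_def)
        then show ?thesis using 1 null cover by (simp add: N_def)
      next
        case 2
        have "emeasure (surface_measure S) A = hausdorff_outer (DIM('a) - 1) A"
          using S 2 by (intro emeasure_surface_measure) auto
        also have "\<dots> \<le> hausdorff_outer (DIM('a) - 1) (P i k)" using 2 by (intro hausdorff_outer_mono) auto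
        also have "\<dots> < \<infinity>" by (rule P_fin)
        finally show ?thesis by simp
      qed
    qed
  qed
qed

text \<open>The interior points form a union of relatively open sets.\<close>

lemma closed_manifold_boundary:
  fixes K :: "'a::euclidean_space set"
  assumes "closed K"
  shows "closed (manifold_boundary K)"
proof -
  let ?W = "\<Union> {U. openin (top_of_set K) U \<and> (\<exists>V :: 'a set. open V \<and> U homeomorphic V)}"
  have "openin (top_of_set K) ?W" by (rule openin_Union) auto
  from closedin_diff[OF closedin_topspace this] have "closedin (top_of_set K) (K - ?W)"
    by (simp only: topspace_euclidean_subtopology)
  moreover have "manifold_boundary K = K - ?W" unfolding manifold_boundary_def by blast
  ultimately show ?thesis using assms by (simp add: closedin_closed_trans)
qed

theorem theorem3:
  fixes K \<Sigma> :: "'a::euclidean_space set"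
  assumes "compact K"
    and "submanifold_with_boundary K"
    and "\<Sigma> = manifold_boundary K"
    and "rectifiable (DIM('a) - 1) \<Sigma>"
    and "AE q in surface_measure \<Sigma>. \<exists>v. is_outward_unit_normal K q v"
  shows "(\<integral>\<^sup>+ q. 1 \<partial>surface_measure \<Sigma>) =
    ennreal (1 / unit_ball_vol (real (DIM('a) - 1))) *
    (\<integral>\<^sup>+ u. weighted_projected_area K u \<partial>surface_measure (sphere (0::'a) 1))"
proof -
  let ?M = "surface_measure (sphere (0::'a) 1)" and ?S = "surface_measure \<Sigma>"
  define N where "N = limit_normal K"
  define w where "w = unit_ball_vol (real (DIM('a) - 1))"
  have w: "0 < w" by (simp add: w_def)
  have K: "K \<in> sets borel" using assms(1) by (rule borel_compact)
  have N [measurable]: "N \<in> borel_measurable borel" unfolding N_def by (rule borel_measurable_limit_normal[OF K])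
  have "\<Sigma> \<in> sets borel"
    unfolding assms(3) using assms(1) by (intro borel_closed closed_manifold_boundary compact_imp_closed)
  then interpret S: sigma_finite_measure ?S by (rule sigma_finite_surface_measure) (rule assms(4))
  interpret M: finite_measure ?M by (rule finite_measure_sphere)
  interpret P: pair_sigma_finite ?S ?M
    by (rule pair_sigma_finite.intro[OF S.sigma_finite_measure_axioms M.sigma_finite_measure_axioms])
  have normal: "AE q in ?S. outward_unit_normal K q = N q \<and> norm (N q) = 1"
    using assms(5) by eventually_elim (simp add: outward_unit_normal_eq_limit_normal[OF K] N_def)
  define k :: "'a \<Rightarrow> 'a \<Rightarrow> ennreal" where "k q u = ennreal (1 / 2) * ennreal \<bar>u \<bullet> N q\<bar>" for q u
  have k_meas: "case_prod k \<in> borel_measurable (?S \<Otimes>\<^sub>M ?M)"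
  proof (rule measurable_pair_borel[OF measurable_ident_surface_measure measurable_ident_surface_measure])
    show "case_prod k \<in> borel_measurable (borel \<Otimes>\<^sub>M borel)"
      unfolding k_def[abs_def] split_beta' by measurable
  qed
  have abs_meas: "(\<lambda>q. ennreal \<bar>u \<bullet> N q\<bar>) \<in> borel_measurable ?S" "(\<lambda>u. ennreal \<bar>u \<bullet> N q\<bar>) \<in> borel_measurable ?M" for u q
    by (rule measurable_surface_measure, measurable)+
  have "weighted_projected_area K u = (\<integral>\<^sup>+ q. k q u \<partial>?S)" for u
  proof -
    have "(\<integral>\<^sup>+ q. ennreal \<bar>u \<bullet> outward_unit_normal K q\<bar> \<partial>?S) = (\<integral>\<^sup>+ q. ennreal \<bar>u \<bullet> N q\<bar> \<partial>?S)"
      using normal by (intro nn_integral_cong_AE) (auto elim!: eventually_mono)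
    then show ?thesis
      unfolding weighted_projected_area_def k_def assms(3)[symmetric]
      by (simp only: nn_integral_cmult[OF abs_meas(1)])
  qed
  then have "(\<integral>\<^sup>+ u. weighted_projected_area K u \<partial>?M) = (\<integral>\<^sup>+ u. \<integral>\<^sup>+ q. k q u \<partial>?S \<partial>?M)" by simp
  also have "\<dots> = (\<integral>\<^sup>+ q. \<integral>\<^sup>+ u. k q u \<partial>?M \<partial>?S)" by (rule P.Fubini'[OF k_meas])
  also have "\<dots> = (\<integral>\<^sup>+ q. ennreal w \<partial>?S)"
  proof (rule nn_integral_cong_AE)
    show "AE q in ?S. (\<integral>\<^sup>+ u. k q u \<partial>?M) = ennreal w"
      using normal
    proof eventually_elim
      case (elim q)
      have "(\<integral>\<^sup>+ u. k q u \<partial>?M) = ennreal (1 / 2) * (\<integral>\<^sup>+ u. ennreal \<bar>u \<bullet> N q\<bar> \<partial>?M)"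
        unfolding k_def by (rule nn_integral_cmult[OF abs_meas(2)])
      also have "\<dots> = ennreal (1 / 2) * ennreal (2 * w)"
        using nn_integral_sphere_abs_inner[of "N q"] elim by (simp add: w_def)
      also have "\<dots> = ennreal (1 / 2 * (2 * w))" using w by (intro ennreal_mult[symmetric]) auto
      finally show ?case by simp
    qed
  qed
  also have "\<dots> = ennreal w * (\<integral>\<^sup>+ q. 1 \<partial>?S)" by simp
  finally have "ennreal (1 / w) * (\<integral>\<^sup>+ u. weighted_projected_area K u \<partial>?M) = ennreal (1 / w) * ennreal w * (\<integral>\<^sup>+ q. 1 \<partial>?S)"
    by (simp only: mult.assoc)
  also have "ennreal (1 / w) * ennreal w = 1" using w by (simp add: ennreal_mult[symmetric])
  finally show ?thesis by (simp add: w_def)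
qed

end
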